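(* Let $X$ be a compact connected Riemann surface, $S\subset X$ a nonempty finite subset, and $(V,\phi)$ a Lie algebroid on $X$ such that for every $x\in S$ the homomorphism of fibers $\phi_x^*:(K_X)_x\to V_x^*$ is the zero map. Let $E_*$ be a parabolic vector bundle on $X$ with parabolic structure over $S$. Then the sheaf $\mathcal C_{E_*,V}$ of generalized parabolic Lie algebroid connections on $E_*$ fits in the following short exact sequence of holomorphic vector bundles on $X$: $$0\longrightarrow \mathrm{End}_n(E)\otimes V^*\longrightarrow\mathcal C_{E_*,V}\stackrel{\sigma}{\longrightarrow}\mathcal O_X\longrightarrow0,$$ where $\sigma$ sends a local generalized parabolic Lie algebroid connection $(w,D)$ to its weight $w$.
   Context: $TX$ and $K_X$ are the holomorphic tangent and cotangent bundles of $X$; $W_y$ is the fiber at $y$ of a vector bundle $W$; $S$ is also regarded as a reduced effective divisor. Lie algebroid: a pair $(V,\phi)$ where $V$ is a holomorphic vector bundle on $X$ with a $\mathbb C$-bilinear sheaf pairing $[-,-]:V\otimes_{\mathbb C}V\to V$ (given by an $\mathcal O_X$-linear homomorphism $J^1(V)\otimes J^1(V)\to V$ of holomorphic vector bundles, $J^1$ being the first jet bundle) which is antisymmetric and satisfies the Jacobi identity, and $\phi:V\to TX$ is an $\mathcal O_X$-linear homomorphism (the anchor map) with $\phi([s,t])=[\phi(s),\phi(t)]$ and $[s,ft]=f[s,t]+\phi(s)(f)\,t$ for local holomorphic sections $s,t$ of $V$ and local holomorphic functions $f$. Let $\phi^*:K_X\to V^*$ be the dual of $\phi$, $\mathcal Q:=V^*/\phi^*(K_X)$,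 $q:V^*\to\mathcal Q$ the quotient map, and $\mathcal Q_x:=\mathcal Q/\mathbf m_x\mathcal Q$, where $\mathbf m_x$ is the maximal ideal at $x$. Since $\phi^*$ vanishes over $S$, there is a unique homomorphism $\widetilde\phi^*:K_X\otimes\mathcal O_X(S)\to V^*$ restricting to $\phi^*$ on $K_X$. For $x\in S$, identify $(K_X\otimes\mathcal O_X(S))_x=\mathbb C$ by the Poincaré adjunction formula (the residue; $dz/z\mapsto1$ for a local coordinate $z$ centered at $x$), and let $\psi_x:\mathbb C\to\mathcal Q_x$ be the composition of $\widetilde\phi^*(x)$ with $q(x):V_x^*\to\mathcal Q_x$. Parabolic vector bundle $E_*$ with parabolic structure over $S$: a holomorphic vector bundle $E$ together with, for each $x\in S$, a strictly decreasing filtration $E_x=E_x^1\supsetneq\cdots\supsetneq E_x^{\ell_x}\supsetneq E_x^{\ell_x+1}=0$ by subspaces and real numbers (weights) $0\le\alpha_1^x<\cdots<\alpha_{\ell_x}^x<1$. For $1\le i\le\ell_x+1$, $\mathcal E_{x,i}:=\ker(E\to E_x/E_x^i)$. $\mathrm{End}_n(E)\subset\mathrm{End}(E)$ is the subsheaf of those local sections $s$ such that $s(x)(E_x^i)\subset E_x^{i+1}$ for all $x\in S$ in the domain of $s$ and all $1\le i\le\ell_x$. Generalized connections: for an open $U\subset X$, a generalized Lie algebroid connection on $E|_U$ is a pair $(w,D)$ with $w$ a holomorphic function on $U$ (the weight) and $D:E|_U\to(E\otimes V^* )|_U$ a holomorphic differential operator with $D(fs)=fD(s)+w\cdot s\otimes\phi^*(df)$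 for local holomorphic functions $f$ and local holomorphic sections $s$. For $x\in U$ it induces a $\mathbb C$-linear map $\mathcal S_x:E_x\to E_x\otimes\mathcal Q_x$, $v\mapsto((\mathrm{Id}_E\otimes q)(D(s)))(x)$ for any local section $s$ with $s(x)=v$. It is a generalized quasi-parabolic Lie algebroid connection on $E_*|_U$ if $D(\mathcal E_{x,i}|_U)\subset(\mathcal E_{x,i}\otimes V^* )|_U$ for all $x\in S\cap U$ and $1\le i\le\ell_x+1$; then $\mathcal S_x(E_x^i)\subset E_x^i\otimes\mathcal Q_x$ and $\mathcal S_x$ induces $\widehat D_{i,x}:E_x^i/E_x^{i+1}\to(E_x^i/E_x^{i+1})\otimes\mathcal Q_x$. It is a generalized parabolic Lie algebroid connection on $E_*|_U$ if moreover $\widehat D_{i,x}(v)=w(x)\cdot v\otimes\psi_x(\alpha_i^x)$ for all $x\in S\cap U$, $1\le i\le\ell_x$ and $v\in E_x^i/E_x^{i+1}$. $\mathcal C_{E_*,V}$ is the sheaf whose sections over $U$ are the generalized parabolic Lie algebroid connections $(w,D)$ on $E_*|_U$, with $\mathcal O_X$-module structure $f\cdot(w,D)=(fw,fD)$; the map $\mathrm{End}_n(E)\otimes V^*\to\mathcal C_{E_*,V}$ is $s\mapsto(0,s)$. *)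

theory Defs
  imports "HOL-Complex_Analysis.Complex_Analysis" "HOL-Library.Function_Algebras"
begin

section \<open>Complex vector spaces as a type class\<close>

class complex_vector = ab_group_add +
  fixes scaleC :: "complex \<Rightarrow> 'a \<Rightarrow> 'a"  (infixr \<open>*\<^sub>C\<close> 75)
  assumes scaleC_add_right: "c *\<^sub>C (u + v) = c *\<^sub>C u + c *\<^sub>C v"
    and scaleC_add_left: "(c + d) *\<^sub>C u = c *\<^sub>C u + d *\<^sub>C u"
    and scaleC_scaleC: "c *\<^sub>C (d *\<^sub>C u) = (c * d) *\<^sub>C u"
    and scaleC_one: "1 *\<^sub>C u = u"

global_interpretation complex_vector: vector_space "scaleC :: complex \<Rightarrow> 'a \<Rightarrow> 'a::complex_vector"
  by standard (rule scaleC_add_right scaleC_add_left scaleC_scaleC scaleC_one)+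

instantiation complex :: complex_vector
begin
definition "c *\<^sub>C (z::complex) = c * z"
instance by standard (simp_all add: scaleC_complex_def algebra_simps)
end

instantiation "fun" :: (type, complex_vector) complex_vector
begin
definition "c *\<^sub>C (f::'a \<Rightarrow> 'b) = (\<lambda>x. c *\<^sub>C f x)"
instance
  by standard
    (simp_all add: scaleC_fun_def plus_fun_def scaleC_add_right scaleC_add_left
      scaleC_scaleC scaleC_one)
end


section \<open>Riemann surfaces\<close>

text \<open>
  The surface is the whole of a Hausdorff type, with a holomorphic atlas.
  Local objects (functions, sections, operators) over an open set are total functions that
  vanish outside that set, so that equality of local objects is equality of functions.
\<close>

type_synonym 'x chart = "'x set \<times> ('x \<Rightarrow> complex)"

definition riemann_surface :: "'x::t2_space chart set \<Rightarrow> bool" where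
  "riemann_surface A \<longleftrightarrow>
     (\<Union>(U, z)\<in>A. U) = UNIV \<and>
     (\<forall>(U, z)\<in>A. open U \<and> open (z ` U) \<and> homeomorphism U (z ` U) z (inv_into U z)) \<and>
     (\<forall>(U, z)\<in>A. \<forall>(W, w)\<in>A. (w \<circ> inv_into U z) holomorphic_on z ` (U \<inter> W))"

definition restr :: "'x set \<Rightarrow> ('x \<Rightarrow> 'b::zero) \<Rightarrow> 'x \<Rightarrow> 'b" where
  "restr W s = (\<lambda>y. if y \<in> W then s y else 0)"

definition fmul :: "('x \<Rightarrow> complex) \<Rightarrow> ('x \<Rightarrow> 'b::complex_vector) \<Rightarrow> 'x \<Rightarrow> 'b" where
  "fmul f s = (\<lambda>y. f y *\<^sub>C s y)"

definition holfun :: "'x::t2_space chart set \<Rightarrow> 'x set \<Rightarrow> ('x \<Rightarrow> complex) set" where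
  "holfun A U = {f. (\<forall>y. y \<notin> U \<longrightarrow> f y = 0) \<and>
     (\<forall>(W, z)\<in>A. (f \<circ> inv_into W z) holomorphic_on z ` (U \<inter> W))}"

text \<open>By injectivity such a function is a biholomorphism onto its image.\<close>

definition local_coord ::
  "'x::t2_space chart set \<Rightarrow> 'x \<Rightarrow> 'x set \<Rightarrow> ('x \<Rightarrow> complex) \<Rightarrow> bool" where
  "local_coord A x W z \<longleftrightarrow> open W \<and> x \<in> W \<and> z \<in> holfun A W \<and> inj_on z W \<and> z x = 0"


section \<open>Sheaves of modules over the structure sheaf\<close>

record ('x, 's) omod =
  sec :: "'x set \<Rightarrow> 's set"
  res :: "'x set \<Rightarrow> 's \<Rightarrow> 's"
  smul :: "('x \<Rightarrow> complex) \<Rightarrow> 's \<Rightarrow> 's"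

definition is_omod :: "'x::t2_space chart set \<Rightarrow> ('x, 's::ab_group_add) omod \<Rightarrow> bool" where
  "is_omod A M \<longleftrightarrow>
     (\<forall>U. open U \<longrightarrow>
        0 \<in> sec M U \<and>
        (\<forall>s\<in>sec M U. \<forall>t\<in>sec M U. s - t \<in> sec M U) \<and>
        (\<forall>f\<in>holfun A U. \<forall>s\<in>sec M U. smul M f s \<in> sec M U) \<and>
        (\<forall>f\<in>holfun A U. \<forall>s\<in>sec M U. \<forall>t\<in>sec M U. smul M f (s + t) = smul M f s + smul M f t) \<and>
        (\<forall>f\<in>holfun A U. \<forall>g\<in>holfun A U. \<forall>s\<in>sec M U.
            smul M (f + g) s = smul M f s + smul M g s \<and>
            smul M (fmul f g) s = smul M f (smul M g s)) \<and>
        (\<forall>s\<in>sec M U. smul M (restr U (\<lambda>_. 1)) s = s) \<and>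
        (\<forall>s\<in>sec M U. res M U s = s) \<and>
        (\<forall>W. open W \<and> W \<subseteq> U \<longrightarrow>
           (\<forall>s\<in>sec M U. res M W s \<in> sec M W) \<and>
           (\<forall>s\<in>sec M U. \<forall>t\<in>sec M U. res M W (s + t) = res M W s + res M W t) \<and>
           (\<forall>f\<in>holfun A U. \<forall>s\<in>sec M U. res M W (smul M f s) = smul M (restr W f) (res M W s)) \<and>
           (\<forall>W'. open W' \<and> W' \<subseteq> W \<longrightarrow> (\<forall>s\<in>sec M U. res M W' (res M W s) = res M W' s)))) \<and>
     (\<forall>\<U> t. (\<forall>W\<in>\<U>. open W \<and> t W \<in> sec M W) \<and>
            (\<forall>W\<in>\<U>. \<forall>W'\<in>\<U>. res M (W \<inter> W') (t W) = res M (W \<inter> W') (t W')) \<longrightarrow>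
            (\<exists>!s. s \<in> sec M (\<Union>\<U>) \<and> (\<forall>W\<in>\<U>. res M W s = t W)))"

definition locally_free :: "'x::t2_space chart set \<Rightarrow> ('x, 's::ab_group_add) omod \<Rightarrow> bool" where
  "locally_free A M \<longleftrightarrow>
     (\<forall>x. \<exists>U r e. open U \<and> x \<in> U \<and> (\<forall>i<r. e i \<in> sec M U) \<and>
        (\<forall>W. open W \<and> W \<subseteq> U \<longrightarrow>
           bij_betw (\<lambda>c. \<Sum>i<(r::nat). smul M (c i) (res M W (e i)))
             ({..<r} \<rightarrow>\<^sub>E holfun A W) (sec M W)))"

definition omod_hom :: "'x::t2_space chart set \<Rightarrow> ('x, 's::ab_group_add) omod \<Rightarrow>
    ('x, 't::ab_group_add) omod \<Rightarrow> ('x set \<Rightarrow> 's \<Rightarrow> 't) \<Rightarrow> bool" where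
  "omod_hom A M N h \<longleftrightarrow>
     (\<forall>U. open U \<longrightarrow>
        (\<forall>s\<in>sec M U. h U s \<in> sec N U) \<and>
        (\<forall>s\<in>sec M U. \<forall>t\<in>sec M U. h U (s + t) = h U s + h U t) \<and>
        (\<forall>f\<in>holfun A U. \<forall>s\<in>sec M U. h U (smul M f s) = smul N f (h U s)) \<and>
        (\<forall>W. open W \<and> W \<subseteq> U \<longrightarrow> (\<forall>s\<in>sec M U. h W (res M W s) = res N W (h U s))))"

text \<open>Exactness is exactness of sheaves, hence local in the middle and on the right.\<close>

definition short_exact :: "'x::t2_space chart set \<Rightarrow> ('x, 's::ab_group_add) omod \<Rightarrow>
    ('x set \<Rightarrow> 's \<Rightarrow> 't) \<Rightarrow> ('x, 't::ab_group_add) omod \<Rightarrow>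
    ('x set \<Rightarrow> 't \<Rightarrow> 'u) \<Rightarrow> ('x, 'u::ab_group_add) omod \<Rightarrow> bool" where
  "short_exact A L h M k N \<longleftrightarrow>
     omod_hom A L M h \<and> omod_hom A M N k \<and>
     (\<forall>U. open U \<longrightarrow>
        inj_on (h U) (sec L U) \<and>
        (\<forall>s\<in>sec L U. k U (h U s) = 0) \<and>
        (\<forall>t\<in>sec M U. k U t = 0 \<longrightarrow>
           (\<forall>x\<in>U. \<exists>W. open W \<and> x \<in> W \<and> W \<subseteq> U \<and> (\<exists>s\<in>sec L W. h W s = res M W t))) \<and>
        (\<forall>u\<in>sec N U. \<forall>x\<in>U. \<exists>W. open W \<and> x \<in> W \<and> W \<subseteq> U \<and> (\<exists>t\<in>sec M W. k W t = res N W u)))"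

text \<open>
  A holomorphic vector bundle is identified with its locally free sheaf of sections of finite
  rank.  For such sheaves, exactness of sheaves with locally free cokernel is exactness on fibres.
\<close>

definition short_exact_bundles :: "'x::t2_space chart set \<Rightarrow> ('x, 's::ab_group_add) omod \<Rightarrow>
    ('x set \<Rightarrow> 's \<Rightarrow> 't) \<Rightarrow> ('x, 't::ab_group_add) omod \<Rightarrow>
    ('x set \<Rightarrow> 't \<Rightarrow> 'u) \<Rightarrow> ('x, 'u::ab_group_add) omod \<Rightarrow> bool" where
  "short_exact_bundles A L h M k N \<longleftrightarrow>
     (is_omod A L \<and> locally_free A L) \<and> (is_omod A M \<and> locally_free A M) \<and>
     (is_omod A N \<and> locally_free A N) \<and> short_exact A L h M k N"

definition section_sheaf ::
  "('x set \<Rightarrow> ('x \<Rightarrow> 'b::complex_vector) set) \<Rightarrow> ('x, 'x \<Rightarrow> 'b) omod" where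
  "section_sheaf F = \<lparr>sec = F, res = restr, smul = fmul\<rparr>"


section \<open>Holomorphic vector bundles\<close>

text \<open>
  A bundle is a family of fibres, realised as subspaces of one ambient complex vector space,
  together with its sheaf of holomorphic sections.  The local frames below are local
  trivialisations: they are bases of the fibres, and the holomorphic sections are those with
  holomorphic coefficients.  Since the ambient space is arbitrary, this is no restriction.
\<close>

record ('x, 'b) vbundle =
  fib :: "'x \<Rightarrow> 'b set"
  hsec :: "'x set \<Rightarrow> ('x \<Rightarrow> 'b) set"

definition local_frame :: "'x::t2_space chart set \<Rightarrow> ('x, 'b::complex_vector) vbundle \<Rightarrow>
    'x set \<Rightarrow> nat \<Rightarrow> (nat \<Rightarrow> 'x \<Rightarrow> 'b) \<Rightarrow> bool" where
  "local_frame A E U r e \<longleftrightarrow>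
     open U \<and> (\<forall>i<r. e i \<in> hsec E U) \<and>
     (\<forall>y\<in>U. bij_betw (\<lambda>c. \<Sum>i<r. c i *\<^sub>C e i y) ({..<r} \<rightarrow>\<^sub>E UNIV) (fib E y)) \<and>
     (\<forall>W. open W \<and> W \<subseteq> U \<longrightarrow>
        hsec E W = {s. \<exists>c. (\<forall>i<r. c i \<in> holfun A W) \<and> s = (\<lambda>y. \<Sum>i<r. c i y *\<^sub>C e i y)})"

definition holomorphic_bundle ::
  "'x::t2_space chart set \<Rightarrow> ('x, 'b::complex_vector) vbundle \<Rightarrow> bool" where
  "holomorphic_bundle A E \<longleftrightarrow>
     is_omod A (section_sheaf (hsec E)) \<and> (\<forall>x. \<exists>U r e. x \<in> U \<and> local_frame A E U r e)"

definition linear_maps :: "'a::complex_vector set \<Rightarrow> 'b::complex_vector set \<Rightarrow> ('a \<Rightarrow> 'b) set" where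
  "linear_maps F G = {T. (\<forall>u\<in>F. T u \<in> G) \<and> (\<forall>u. u \<notin> F \<longrightarrow> T u = 0) \<and>
     (\<forall>u\<in>F. \<forall>v\<in>F. T (u + v) = T u + T v) \<and> (\<forall>u\<in>F. \<forall>c. T (c *\<^sub>C u) = c *\<^sub>C T u)}"

definition hom_bundle :: "('x::t2_space, 'a::complex_vector) vbundle \<Rightarrow>
    ('x, 'b::complex_vector) vbundle \<Rightarrow> ('x, 'a \<Rightarrow> 'b) vbundle" where
  "hom_bundle V E = \<lparr>
     fib = (\<lambda>y. linear_maps (fib V y) (fib E y)),
     hsec = (\<lambda>U. {T. (\<forall>y\<in>U. T y \<in> linear_maps (fib V y) (fib E y)) \<and> (\<forall>y. y \<notin> U \<longrightarrow> T y = 0) \<and>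
        (\<forall>W s. open W \<and> W \<subseteq> U \<and> s \<in> hsec V W \<longrightarrow> (\<lambda>y. T y (s y)) \<in> hsec E W)})\<rparr>"

definition trivial_line :: "'x::t2_space chart set \<Rightarrow> ('x, complex) vbundle" where
  "trivial_line A = \<lparr>fib = (\<lambda>_. UNIV), hsec = holfun A\<rparr>"

definition dual_bundle :: "'x::t2_space chart set \<Rightarrow> ('x, 'a::complex_vector) vbundle \<Rightarrow>
    ('x, 'a \<Rightarrow> complex) vbundle" where
  "dual_bundle A V = hom_bundle V (trivial_line A)"

text \<open>
  The tensor product of a bundle with the dual of V is rendered throughout as the bundle of
  homomorphisms from V; on fibres, a tensor e with a functional \<theta> is the following rank one map.
\<close>

definition tens :: "'b::complex_vector \<Rightarrow> ('a \<Rightarrow> complex) \<Rightarrow> 'a \<Rightarrow> 'b" where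
  "tens e \<theta> = (\<lambda>u. \<theta> u *\<^sub>C e)"

text \<open>
  Sections of the tensor product of F with the dual of V, for a subsheaf F of the sections of
  the bundle B.  As V is locally free, this is the sheaf of homomorphisms from V to F.
\<close>

definition twist :: "('x::t2_space, 'a::complex_vector) vbundle \<Rightarrow> ('x, 'b::complex_vector) vbundle \<Rightarrow>
    ('x set \<Rightarrow> ('x \<Rightarrow> 'b) set) \<Rightarrow> 'x set \<Rightarrow> ('x \<Rightarrow> 'a \<Rightarrow> 'b) set" where
  "twist V B F U = {T \<in> hsec (hom_bundle V B) U.
     \<forall>W t. open W \<and> W \<subseteq> U \<and> t \<in> hsec V W \<longrightarrow> (\<lambda>y. T y (t y)) \<in> F W}"


subsection \<open>Tangent and cotangent bundle\<close>

text \<open>Tangent vectors at x are the derivations at x of germs of holomorphic functions.\<close>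

type_synonym 'x tvec = "('x \<Rightarrow> complex) \<Rightarrow> complex"

definition tangent_space :: "'x::t2_space chart set \<Rightarrow> 'x \<Rightarrow> 'x tvec set" where
  "tangent_space A x = {v.
     (\<forall>f. (\<nexists>U. open U \<and> x \<in> U \<and> f \<in> holfun A U) \<longrightarrow> v f = 0) \<and>
     (\<forall>U. open U \<and> x \<in> U \<longrightarrow>
        (\<forall>f\<in>holfun A U. \<forall>g\<in>holfun A U.
           v (f + g) = v f + v g \<and> v (fmul f g) = f x * v g + g x * v f) \<and>
        (\<forall>f\<in>holfun A U. \<forall>c. v (c *\<^sub>C f) = c * v f) \<and>
        (\<forall>f\<in>holfun A U. \<forall>W. open W \<and> x \<in> W \<and> W \<subseteq> U \<longrightarrow> v (restr W f) = v f))}"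

definition tangent_bundle :: "'x::t2_space chart set \<Rightarrow> ('x, 'x tvec) vbundle" where
  "tangent_bundle A = \<lparr>
     fib = tangent_space A,
     hsec = (\<lambda>U. {\<xi>. (\<forall>y\<in>U. \<xi> y \<in> tangent_space A y) \<and> (\<forall>y. y \<notin> U \<longrightarrow> \<xi> y = 0) \<and>
        (\<forall>W f. open W \<and> W \<subseteq> U \<and> f \<in> holfun A W \<longrightarrow> restr W (\<lambda>y. \<xi> y f) \<in> holfun A W)})\<rparr>"

definition cotangent_bundle :: "'x::t2_space chart set \<Rightarrow> ('x, 'x tvec \<Rightarrow> complex) vbundle" where
  "cotangent_bundle A = dual_bundle A (tangent_bundle A)"

definition differential ::
  "'x::t2_space chart set \<Rightarrow> ('x \<Rightarrow> complex) \<Rightarrow> 'x \<Rightarrow> 'x tvec \<Rightarrow> complex" where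
  "differential A f y = (\<lambda>v. if v \<in> tangent_space A y then v f else 0)"


subsection \<open>Differential operators\<close>

definition sheaf_operator :: "('x::t2_space, 'a::complex_vector) vbundle \<Rightarrow>
    ('x, 'b::complex_vector) vbundle \<Rightarrow> 'x set \<Rightarrow> ('x set \<Rightarrow> ('x \<Rightarrow> 'a) \<Rightarrow> 'x \<Rightarrow> 'b) \<Rightarrow> bool" where
  "sheaf_operator E F U D \<longleftrightarrow>
     (\<forall>W. open W \<and> W \<subseteq> U \<longrightarrow>
        (\<forall>s\<in>hsec E W. D W s \<in> hsec F W) \<and>
        (\<forall>s\<in>hsec E W. \<forall>t\<in>hsec E W. D W (s + t) = D W s + D W t) \<and>
        (\<forall>s\<in>hsec E W. \<forall>c. D W (c *\<^sub>C s) = c *\<^sub>C D W s) \<and>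
        (\<forall>W'. open W' \<and> W' \<subseteq> W \<longrightarrow> (\<forall>s\<in>hsec E W. D W' (restr W' s) = restr W' (D W s))))"

text \<open>Order at most n in the sense of Grothendieck, by iterated commutators with functions.\<close>

primrec order_le :: "'x::t2_space chart set \<Rightarrow> ('x, 'a::complex_vector) vbundle \<Rightarrow> nat \<Rightarrow> 'x set \<Rightarrow>
    ('x set \<Rightarrow> ('x \<Rightarrow> 'a) \<Rightarrow> 'x \<Rightarrow> 'b::complex_vector) \<Rightarrow> bool" where
  "order_le A E 0 U D \<longleftrightarrow>
     (\<forall>W f s. open W \<and> W \<subseteq> U \<and> f \<in> holfun A W \<and> s \<in> hsec E W \<longrightarrow>
        D W (fmul f s) = fmul f (D W s))"
| "order_le A E (Suc n) U D \<longleftrightarrow>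
     (\<forall>W f. open W \<and> W \<subseteq> U \<and> f \<in> holfun A W \<longrightarrow>
        order_le A E n W (\<lambda>W' s. D W' (fmul f s) - fmul f (D W' s)))"

definition diff_operator :: "'x::t2_space chart set \<Rightarrow> ('x, 'a::complex_vector) vbundle \<Rightarrow>
    ('x, 'b::complex_vector) vbundle \<Rightarrow> 'x set \<Rightarrow> ('x set \<Rightarrow> ('x \<Rightarrow> 'a) \<Rightarrow> 'x \<Rightarrow> 'b) \<Rightarrow> bool" where
  "diff_operator A E F U D \<longleftrightarrow> sheaf_operator E F U D \<and> (\<exists>n. order_le A E n U D)"


section \<open>Lie algebroids\<close>

text \<open>
  Homomorphisms from the first jet bundle are the differential operators of order at most one;
  a homomorphism from the tensor square of the jet bundle is a pairing which is such an operator
  in each argument.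
\<close>

definition lie_algebroid :: "'x::t2_space chart set \<Rightarrow> ('x, 'v::complex_vector) vbundle \<Rightarrow>
    ('x set \<Rightarrow> ('x \<Rightarrow> 'v) \<Rightarrow> ('x \<Rightarrow> 'v) \<Rightarrow> 'x \<Rightarrow> 'v) \<Rightarrow> ('x \<Rightarrow> 'v \<Rightarrow> 'x tvec) \<Rightarrow> bool" where
  "lie_algebroid A V br \<phi> \<longleftrightarrow>
     holomorphic_bundle A V \<and>
     (\<forall>U. open U \<longrightarrow>
        (\<forall>t\<in>hsec V U.
           sheaf_operator V V U (\<lambda>W s. br W s (restr W t)) \<and>
           order_le A V 1 U (\<lambda>W s. br W s (restr W t)) \<and>
           sheaf_operator V V U (\<lambda>W s. br W (restr W t) s) \<and>
           order_le A V 1 U (\<lambda>W s. br W (restr W t) s)) \<and>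
        (\<forall>s\<in>hsec V U. \<forall>t\<in>hsec V U. br U s t = - br U t s) \<and>
        (\<forall>s\<in>hsec V U. \<forall>t\<in>hsec V U. \<forall>u\<in>hsec V U.
           br U s (br U t u) + br U t (br U u s) + br U u (br U s t) = 0)) \<and>
     \<phi> \<in> hsec (hom_bundle V (tangent_bundle A)) UNIV \<and>
     (\<forall>U. open U \<longrightarrow>
        (\<forall>s\<in>hsec V U. \<forall>t\<in>hsec V U. \<forall>f\<in>holfun A U.
           (\<forall>y\<in>U. \<phi> y (br U s t y) f =
              \<phi> y (s y) (\<lambda>p. \<phi> p (t p) f) - \<phi> y (t y) (\<lambda>p. \<phi> p (s p) f)) \<and>
           br U s (fmul f t) = fmul f (br U s t) + fmul (\<lambda>y. \<phi> y (s y) f) t))"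

definition anchor_dual :: "('x \<Rightarrow> 'v \<Rightarrow> 'x tvec) \<Rightarrow> 'x \<Rightarrow> ('x tvec \<Rightarrow> complex) \<Rightarrow> 'v \<Rightarrow> complex" where
  "anchor_dual \<phi> y \<kappa> = (\<lambda>u. \<kappa> (\<phi> y u))"


subsection \<open>The residual quotient\<close>

text \<open>Quotient spaces are spaces of cosets.\<close>

definition coset :: "'a::ab_group_add set \<Rightarrow> 'a \<Rightarrow> 'a set" where
  "coset N a = (\<lambda>n. a + n) ` N"

text \<open>
  The fibre at x of the cokernel of the dual anchor is the cokernel of its fibre at x, i.e.
  the quotient of the dual fibre by the following subspace.
\<close>

definition conormal :: "'x::t2_space chart set \<Rightarrow> ('x \<Rightarrow> 'v \<Rightarrow> 'x tvec) \<Rightarrow> 'x \<Rightarrow> ('v \<Rightarrow> complex) set" where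
  "conormal A \<phi> x = anchor_dual \<phi> x ` fib (cotangent_bundle A) x"

definition quot_q :: "'x::t2_space chart set \<Rightarrow> ('x \<Rightarrow> 'v \<Rightarrow> 'x tvec) \<Rightarrow> 'x \<Rightarrow>
    ('v \<Rightarrow> complex) \<Rightarrow> ('v \<Rightarrow> complex) set" where
  "quot_q A \<phi> x \<theta> = coset (conormal A \<phi> x) \<theta>"

text \<open>
  Forms with at most simple poles along S, as forms \<omega> off S such that f \<omega> extends
  holomorphically across S for every local function f vanishing on S.
\<close>

definition log_forms :: "'x::t2_space chart set \<Rightarrow> 'x set \<Rightarrow> 'x set \<Rightarrow>
    ('x \<Rightarrow> 'x tvec \<Rightarrow> complex) set" where
  "log_forms A S U = {\<omega> \<in> hsec (cotangent_bundle A) (U - S).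
     \<forall>W f. open W \<and> W \<subseteq> U \<and> f \<in> holfun A W \<and> (\<forall>x\<in>W \<inter> S. f x = 0) \<longrightarrow>
       (\<exists>\<eta>\<in>hsec (cotangent_bundle A) W. \<forall>y\<in>W - S. \<eta> y = f y *\<^sub>C \<omega> y)}"

definition residue_at :: "'x::t2_space chart set \<Rightarrow> 'x set \<Rightarrow> 'x \<Rightarrow> 'x set \<Rightarrow>
    ('x \<Rightarrow> 'x tvec \<Rightarrow> complex) \<Rightarrow> complex" where
  "residue_at A S x U \<omega> = (THE c. \<exists>W z \<eta>. local_coord A x W z \<and> W \<subseteq> U \<and>
     \<eta> \<in> hsec (cotangent_bundle A) W \<and> (\<forall>y\<in>W - S. \<eta> y = z y *\<^sub>C \<omega> y) \<and>
     \<eta> x = c *\<^sub>C differential A z x)"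

text \<open>The extension of the dual anchor to forms with simple poles; its values on sections are unique.\<close>

definition log_anchor_dual :: "'x::t2_space chart set \<Rightarrow> 'x set \<Rightarrow> ('x, 'v::complex_vector) vbundle \<Rightarrow>
    ('x \<Rightarrow> 'v \<Rightarrow> 'x tvec) \<Rightarrow> 'x set \<Rightarrow> ('x \<Rightarrow> 'x tvec \<Rightarrow> complex) \<Rightarrow> 'x \<Rightarrow> 'v \<Rightarrow> complex" where
  "log_anchor_dual A S V \<phi> = (SOME \<Phi>.
     omod_hom A (section_sheaf (log_forms A S)) (section_sheaf (hsec (dual_bundle A V))) \<Phi> \<and>
     (\<forall>U \<omega>. open U \<and> \<omega> \<in> hsec (cotangent_bundle A) U \<longrightarrow>
        \<Phi> U (restr (U - S) \<omega>) = (\<lambda>y. anchor_dual \<phi> y (\<omega> y))))"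

text \<open>
  The value at x of the extended dual anchor on the element of the fibre at x with residue c:
  evaluate on any local form with residue c.
\<close>

definition log_anchor_dual_at :: "'x::t2_space chart set \<Rightarrow> 'x set \<Rightarrow>
    ('x, 'v::complex_vector) vbundle \<Rightarrow> ('x \<Rightarrow> 'v \<Rightarrow> 'x tvec) \<Rightarrow> 'x \<Rightarrow> complex \<Rightarrow> 'v \<Rightarrow> complex" where
  "log_anchor_dual_at A S V \<phi> x c = (THE \<theta>. \<exists>W \<omega>. open W \<and> x \<in> W \<and> \<omega> \<in> log_forms A S W \<and>
     residue_at A S x W \<omega> = c \<and> \<theta> = log_anchor_dual A S V \<phi> W \<omega> x)"

definition psi :: "'x::t2_space chart set \<Rightarrow> 'x set \<Rightarrow> ('x, 'v::complex_vector) vbundle \<Rightarrow>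
    ('x \<Rightarrow> 'v \<Rightarrow> 'x tvec) \<Rightarrow> 'x \<Rightarrow> complex \<Rightarrow> ('v \<Rightarrow> complex) set" where
  "psi A S V \<phi> x c = quot_q A \<phi> x (log_anchor_dual_at A S V \<phi> x c)"


section \<open>Parabolic bundles\<close>

record ('x, 'e) parabolic =
  pbun :: "('x, 'e) vbundle"
  plen :: "'x \<Rightarrow> nat"
  pfil :: "'x \<Rightarrow> nat \<Rightarrow> 'e set"
  pwt :: "'x \<Rightarrow> nat \<Rightarrow> real"

definition parabolic_bundle :: "'x::t2_space chart set \<Rightarrow> 'x set \<Rightarrow>
    ('x, 'e::complex_vector) parabolic \<Rightarrow> bool" where
  "parabolic_bundle A S P \<longleftrightarrow>
     holomorphic_bundle A (pbun P) \<and>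
     (\<forall>x\<in>S.
        pfil P x 1 = fib (pbun P) x \<and>
        pfil P x (plen P x + 1) = {0} \<and>
        (\<forall>i\<in>{1..plen P x + 1}. complex_vector.subspace (pfil P x i)) \<and>
        (\<forall>i\<in>{1..plen P x}. pfil P x (i + 1) \<subset> pfil P x i) \<and>
        (\<forall>i\<in>{1..plen P x}. 0 \<le> pwt P x i \<and> pwt P x i < 1) \<and>
        (\<forall>i\<in>{1..plen P x}. \<forall>j\<in>{1..plen P x}. i < j \<longrightarrow> pwt P x i < pwt P x j))"

definition fil_sheaf :: "('x, 'e) parabolic \<Rightarrow> 'x \<Rightarrow> nat \<Rightarrow> 'x set \<Rightarrow> ('x \<Rightarrow> 'e) set" where
  "fil_sheaf P x i U = {s \<in> hsec (pbun P) U. x \<in> U \<longrightarrow> s x \<in> pfil P x i}"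

definition end_n :: "'x set \<Rightarrow> ('x::t2_space, 'e::complex_vector) parabolic \<Rightarrow> 'x set \<Rightarrow>
    ('x \<Rightarrow> 'e \<Rightarrow> 'e) set" where
  "end_n S P U = {T \<in> hsec (hom_bundle (pbun P) (pbun P)) U.
     \<forall>x\<in>S \<inter> U. \<forall>i\<in>{1..plen P x}. T x ` pfil P x i \<subseteq> pfil P x (i + 1)}"


section \<open>Generalized parabolic Lie algebroid connections\<close>

type_synonym ('x, 'v, 'e) operator = "'x set \<Rightarrow> ('x \<Rightarrow> 'e) \<Rightarrow> 'x \<Rightarrow> 'v \<Rightarrow> 'e"

definition gen_connection :: "'x::t2_space chart set \<Rightarrow> ('x, 'v::complex_vector) vbundle \<Rightarrow>
    ('x \<Rightarrow> 'v \<Rightarrow> 'x tvec) \<Rightarrow> ('x, 'e::complex_vector) vbundle \<Rightarrow> 'x set \<Rightarrow>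
    ('x \<Rightarrow> complex) \<Rightarrow> ('x, 'v, 'e) operator \<Rightarrow> bool" where
  "gen_connection A V \<phi> E U w D \<longleftrightarrow>
     w \<in> holfun A U \<and>
     diff_operator A E (hom_bundle V E) U D \<and>
     (\<forall>W s. \<not> (open W \<and> W \<subseteq> U \<and> s \<in> hsec E W) \<longrightarrow> D W s = 0) \<and>
     (\<forall>W f s. open W \<and> W \<subseteq> U \<and> f \<in> holfun A W \<and> s \<in> hsec E W \<longrightarrow>
        D W (fmul f s) =
          fmul f (D W s) + (\<lambda>y. tens (w y *\<^sub>C s y) (anchor_dual \<phi> y (differential A f y))))"

definition gen_quasi_parabolic :: "'x::t2_space chart set \<Rightarrow> 'x set \<Rightarrow>
    ('x, 'v::complex_vector) vbundle \<Rightarrow> ('x \<Rightarrow> 'v \<Rightarrow> 'x tvec) \<Rightarrow> ('x, 'e::complex_vector) parabolic \<Rightarrow>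
    'x set \<Rightarrow> ('x \<Rightarrow> complex) \<Rightarrow> ('x, 'v, 'e) operator \<Rightarrow> bool" where
  "gen_quasi_parabolic A S V \<phi> P U w D \<longleftrightarrow>
     gen_connection A V \<phi> (pbun P) U w D \<and>
     (\<forall>x\<in>S \<inter> U. \<forall>i\<in>{1..plen P x + 1}. \<forall>W. open W \<and> W \<subseteq> U \<longrightarrow>
        D W ` fil_sheaf P x i W \<subseteq> twist V (pbun P) (fil_sheaf P x i) W)"

text \<open>The tensor product of subspaces, inside the space of linear maps.\<close>

definition tensor_space :: "'e::complex_vector set \<Rightarrow> ('v \<Rightarrow> complex) set \<Rightarrow> ('v \<Rightarrow> 'e) set" where
  "tensor_space F N = complex_vector.span {tens e \<theta> | e \<theta>. e \<in> F \<and> \<theta> \<in> N}"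

text \<open>
  With N the conormal subspace at x, the tensor product of the fibre of E with the residual
  quotient consists of the cosets of (fibre of E) tensor N.
\<close>

definition residual_map :: "'x::t2_space chart set \<Rightarrow> ('x \<Rightarrow> 'v \<Rightarrow> 'x tvec) \<Rightarrow>
    ('x, 'e::complex_vector) vbundle \<Rightarrow> 'x set \<Rightarrow> ('x, 'v, 'e) operator \<Rightarrow> 'x \<Rightarrow> 'e \<Rightarrow> ('v \<Rightarrow> 'e) set" where
  "residual_map A \<phi> E U D x v = (THE C. \<exists>W s. open W \<and> W \<subseteq> U \<and> x \<in> W \<and> s \<in> hsec E W \<and> s x = v \<and>
     C = coset (tensor_space (fib E x) (conormal A \<phi> x)) (D W s x))"

text \<open>
  For subspaces G of F, the tensor product of F/G with the residual quotient is the quotient of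
  (F tensor dual fibre) by the subspace G tensor (dual fibre) + F tensor N.
\<close>

definition gr_denom :: "'x::t2_space chart set \<Rightarrow> ('x, 'v::complex_vector) vbundle \<Rightarrow>
    ('x \<Rightarrow> 'v \<Rightarrow> 'x tvec) \<Rightarrow> 'x \<Rightarrow> 'e::complex_vector set \<Rightarrow> 'e set \<Rightarrow> ('v \<Rightarrow> 'e) set" where
  "gr_denom A V \<phi> x F G = {a + b | a b.
     a \<in> tensor_space G (fib (dual_bundle A V) x) \<and> b \<in> tensor_space F (conormal A \<phi> x)}"

text \<open>The tensor of the class of v in F/G with the class q.\<close>

definition gr_tens :: "'x::t2_space chart set \<Rightarrow> ('x, 'v::complex_vector) vbundle \<Rightarrow>
    ('x \<Rightarrow> 'v \<Rightarrow> 'x tvec) \<Rightarrow> 'x \<Rightarrow> 'e::complex_vector set \<Rightarrow> 'e set \<Rightarrow>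
    'e \<Rightarrow> ('v \<Rightarrow> complex) set \<Rightarrow> ('v \<Rightarrow> 'e) set" where
  "gr_tens A V \<phi> x F G v q = coset (gr_denom A V \<phi> x F G) (tens v (SOME \<theta>. \<theta> \<in> q))"

text \<open>
  The map induced by the residual map on the i-th graded piece at x, evaluated at the class of
  v: choose a representative of the residual value in (i-th filtration step) tensor (dual fibre)
  and project.
\<close>

definition graded_map :: "'x::t2_space chart set \<Rightarrow> ('x, 'v::complex_vector) vbundle \<Rightarrow>
    ('x \<Rightarrow> 'v \<Rightarrow> 'x tvec) \<Rightarrow> ('x, 'e::complex_vector) parabolic \<Rightarrow> 'x set \<Rightarrow>
    ('x, 'v, 'e) operator \<Rightarrow> 'x \<Rightarrow> nat \<Rightarrow> 'e \<Rightarrow> ('v \<Rightarrow> 'e) set" where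
  "graded_map A V \<phi> P U D x i v =
     coset (gr_denom A V \<phi> x (pfil P x i) (pfil P x (i + 1)))
       (SOME T. T \<in> residual_map A \<phi> (pbun P) U D x v \<and>
                T \<in> tensor_space (pfil P x i) (fib (dual_bundle A V) x))"

definition gen_parabolic :: "'x::t2_space chart set \<Rightarrow> 'x set \<Rightarrow>
    ('x, 'v::complex_vector) vbundle \<Rightarrow> ('x \<Rightarrow> 'v \<Rightarrow> 'x tvec) \<Rightarrow> ('x, 'e::complex_vector) parabolic \<Rightarrow>
    'x set \<Rightarrow> ('x \<Rightarrow> complex) \<Rightarrow> ('x, 'v, 'e) operator \<Rightarrow> bool" where
  "gen_parabolic A S V \<phi> P U w D \<longleftrightarrow>
     gen_quasi_parabolic A S V \<phi> P U w D \<and>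
     (\<forall>x\<in>S \<inter> U. \<forall>i\<in>{1..plen P x}. \<forall>v\<in>pfil P x i.
        graded_map A V \<phi> P U D x i v =
        gr_tens A V \<phi> x (pfil P x i) (pfil P x (i + 1))
          (w x *\<^sub>C v) (psi A S V \<phi> x (complex_of_real (pwt P x i))))"


subsection \<open>The sheaves and maps of the exact sequence\<close>

definition conn_sheaf :: "'x::t2_space chart set \<Rightarrow> 'x set \<Rightarrow> ('x, 'v::complex_vector) vbundle \<Rightarrow>
    ('x \<Rightarrow> 'v \<Rightarrow> 'x tvec) \<Rightarrow> ('x, 'e::complex_vector) parabolic \<Rightarrow>
    ('x, ('x \<Rightarrow> complex) \<times> ('x, 'v, 'e) operator) omod" where
  "conn_sheaf A S V \<phi> P = \<lparr>
     sec = (\<lambda>U. {(w, D). gen_parabolic A S V \<phi> P U w D}),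
     res = (\<lambda>U' (w, D). (restr U' w, \<lambda>W. if W \<subseteq> U' then D W else 0)),
     smul = (\<lambda>f (w, D). (fmul f w, \<lambda>W s. fmul f (D W s)))\<rparr>"

definition end_n_dual_sheaf :: "'x set \<Rightarrow> ('x::t2_space, 'v::complex_vector) vbundle \<Rightarrow>
    ('x, 'e::complex_vector) parabolic \<Rightarrow> ('x, 'x \<Rightarrow> 'v \<Rightarrow> 'e \<Rightarrow> 'e) omod" where
  "end_n_dual_sheaf S V P =
     section_sheaf (twist V (hom_bundle (pbun P) (pbun P)) (end_n S P))"

definition structure_sheaf :: "'x::t2_space chart set \<Rightarrow> ('x, 'x \<Rightarrow> complex) omod" where
  "structure_sheaf A = section_sheaf (holfun A)"

definition end_incl :: "('x::t2_space, 'e::complex_vector) parabolic \<Rightarrow> 'x set \<Rightarrow>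
    ('x \<Rightarrow> 'v \<Rightarrow> 'e \<Rightarrow> 'e) \<Rightarrow> ('x \<Rightarrow> complex) \<times> ('x, 'v, 'e) operator" where
  "end_incl P U T = (0, \<lambda>W s. if open W \<and> W \<subseteq> U \<and> s \<in> hsec (pbun P) W
                             then (\<lambda>y u. T y u (s y)) else 0)"

definition weight_map :: "'x set \<Rightarrow> ('x \<Rightarrow> complex) \<times> ('x, 'v, 'e) operator \<Rightarrow> 'x \<Rightarrow> complex" where
  "weight_map U c = fst c"

end

theory Submission
  imports Defs
begin

text \<open>
  Only the points of S need care.  There the anchor vanishes, so the residual quotient is the whole dual
  fibre and the value at x of a generalized connection on a section s depends on s(x) alone.  If z is a
  coordinate centred at x, then the dual anchor maps dz to z \<Psi> for a section \<Psi> of the dual of V, and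
  its logarithmic extension maps dz/z to \<Psi>.  The parabolic condition therefore says that D(s)(x) is
  w(x) \<alpha> s(x) \<otimes> \<Psi>(x) modulo the next filtration step, for s(x) in the step of weight \<alpha>.

  A connection of weight 0 is linear over the functions, hence a section of the first sheaf.  In a frame
  of E adapted to the filtration at x, the operator sending a section with coefficients c(j) to
  the one with coefficients \<phi>*(dc(j)) + \<alpha>(j) c(j) \<Psi> is a local connection of weight 1, which splits
  the sequence locally.  The first sheaf is free near x on the products of a frame of the dual of V with the matrix
  units of the adapted frame, multiplied by z where they do not strictly lower the filtration.
\<close>

section \<open>Sheaves of functions\<close>

text \<open>The residue, the residual map, the extended dual anchor and the graded map are all
  defined by \<open>THE\<close> or \<open>SOME\<close>. Before any condition can be used, each
  choice must be shown independent of coordinates, representatives and local sections. A vanishing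
  anchor at x then makes the conormal space zero and its cosets singletons, so the parabolic
  condition becomes a condition on values in one fibre, \<open>par\<close>. The diagonal term with
  the weights is forced: the operator \<phi>*(dc(j)) alone takes the value 0 at x, while a
  connection of weight 1 must act on each graded piece as \<alpha> times \<Psi>(x). The factor z is
  the right correction of the other matrix units because a section that lowers the filtration at x
  has exactly these entries vanishing there, and a holomorphic function vanishing at x is divisible
  by z. Uniqueness arguments stay away from the points of S: they compare off a finite set and use
  that no point is isolated.\<close>

lemma restr_apply: "restr W s y = (if y \<in> W then s y else 0)"
  by (simp add: restr_def)

lemma restr_in [simp]: "y \<in> W \<Longrightarrow> restr W s y = s y"
  by (simp add: restr_def)

lemma restr_out [simp]: "y \<notin> W \<Longrightarrow> restr W s y = 0"
  by (simp add: restr_def)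

lemma restr_restr_subset: "W \<subseteq> W' \<Longrightarrow> restr W (restr W' s) = restr W s"
  by (rule ext) (auto simp: restr_def)

lemma restr_eq_self: "(\<And>y. y \<notin> W \<Longrightarrow> s y = 0) \<Longrightarrow> restr W s = s"
  by (rule ext) (auto simp: restr_def)

lemma restr_zero [simp]: "restr W 0 = 0"
  by (rule ext) (auto simp: restr_def)

lemma restr_add: "restr W (s + t) = restr W s + restr W (t :: 'x \<Rightarrow> 'b::monoid_add)"
  by (rule ext) (auto simp: restr_def)

lemma restr_diff: "restr W (s - t) = restr W s - restr W (t :: 'x \<Rightarrow> 'b::group_add)"
  by (rule ext) (auto simp: restr_def)

lemma fmul_apply: "fmul f s y = f y *\<^sub>C s y"
  by (simp add: fmul_def)

lemma scaleC_complex [simp]: "a *\<^sub>C (b::complex) = a * b"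
  by (simp add: scaleC_complex_def)

lemma scaleC_fun_apply [simp]: "(c *\<^sub>C f) y = c *\<^sub>C f y"
  by (simp add: scaleC_fun_def)

lemma fun_sum_apply: "(\<Sum>i\<in>I. f i) y = (\<Sum>i\<in>I. f i y :: 'b::comm_monoid_add)"
  by (induction I rule: infinite_finite_induct) auto

lemma scaleC_sum_right: "c *\<^sub>C (\<Sum>i\<in>I. f i) = (\<Sum>i\<in>I. c *\<^sub>C f i)"
  by (rule complex_vector.scale_sum_right)

lemma scaleC_sum_left: "(\<Sum>i\<in>I. f i) *\<^sub>C v = (\<Sum>i\<in>I. f i *\<^sub>C v)"
  by (rule complex_vector.scale_sum_left)

lemma scaleC_diff_right: "c *\<^sub>C (u - v) = c *\<^sub>C u - c *\<^sub>C v"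
  by (rule complex_vector.scale_right_diff_distrib)

lemma scaleC_diff_left: "(c - d) *\<^sub>C u = c *\<^sub>C u - d *\<^sub>C u"
  by (rule complex_vector.scale_left_diff_distrib)

lemmas scaleC_one [simp] scaleC_scaleC [simp]

lemma fmul_restr: "fmul (restr W f) (restr W s) = restr W (fmul f s)"
  by (rule ext) (auto simp: restr_def fmul_def)

text \<open>For functions that vanish outside the open set, the module identities and the uniqueness
  of gluing hold pointwise. What is left of \<open>is_omod\<close> is closure under the operations
  and a local test for membership, which is easier to verify than a gluing statement.\<close>

definition fsheaf :: "'x::t2_space chart set \<Rightarrow> ('x set \<Rightarrow> ('x \<Rightarrow> 'b::complex_vector) set) \<Rightarrow> bool" where
  "fsheaf A F \<longleftrightarrow> (\<forall>U. open U \<longrightarrow>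
     0 \<in> F U \<and>
     (\<forall>s\<in>F U. (\<forall>y. y \<notin> U \<longrightarrow> s y = 0) \<and> (\<forall>t\<in>F U. s - t \<in> F U) \<and>
        (\<forall>f\<in>holfun A U. fmul f s \<in> F U) \<and> (\<forall>W. open W \<and> W \<subseteq> U \<longrightarrow> restr W s \<in> F W)) \<and>
     (\<forall>s. (\<forall>y. y \<notin> U \<longrightarrow> s y = 0) \<and> (\<forall>x\<in>U. \<exists>W. open W \<and> x \<in> W \<and> W \<subseteq> U \<and> restr W s \<in> F W)
        \<longrightarrow> s \<in> F U))"

lemma fsheafI:
  assumes "\<And>U. open U \<Longrightarrow> 0 \<in> F U"
    and "\<And>U s y. open U \<Longrightarrow> s \<in> F U \<Longrightarrow> y \<notin> U \<Longrightarrow> s y = 0"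
    and "\<And>U s t. open U \<Longrightarrow> s \<in> F U \<Longrightarrow> t \<in> F U \<Longrightarrow> s - t \<in> F U"
    and "\<And>U f s. open U \<Longrightarrow> f \<in> holfun A U \<Longrightarrow> s \<in> F U \<Longrightarrow> fmul f s \<in> F U"
    and "\<And>U W s. open U \<Longrightarrow> open W \<Longrightarrow> W \<subseteq> U \<Longrightarrow> s \<in> F U \<Longrightarrow> restr W s \<in> F W"
    and "\<And>U s. open U \<Longrightarrow> (\<And>y. y \<notin> U \<Longrightarrow> s y = 0) \<Longrightarrow>
       (\<And>x. x \<in> U \<Longrightarrow> \<exists>W. open W \<and> x \<in> W \<and> W \<subseteq> U \<and> restr W s \<in> F W) \<Longrightarrow> s \<in> F U"
  shows "fsheaf A F"
proof -
  have "s \<in> F U" if "open U" "(\<forall>y. y \<notin> U \<longrightarrow> s y = 0) \<and>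
    (\<forall>x\<in>U. \<exists>W. open W \<and> x \<in> W \<and> W \<subseteq> U \<and> restr W s \<in> F W)" for U s
    by (rule assms(6)[OF that(1)]) (use that(2) in simp_all)
  then show ?thesis unfolding fsheaf_def
    by (intro allI impI conjI ballI)
      ((elim conjE)?; (rule assms(1); assumption | rule assms(2); assumption | rule assms(3); assumption |
        rule assms(4); assumption | rule assms(5); assumption | blast))+
qed

lemma fsheafD:
  assumes "fsheaf A F"
  shows fsheaf_0: "\<And>U. open U \<Longrightarrow> 0 \<in> F U"
    and fsheaf_out: "\<And>U s y. s \<in> F U \<Longrightarrow> open U \<Longrightarrow> y \<notin> U \<Longrightarrow> s y = 0"
    and fsheaf_diff: "\<And>U s t. open U \<Longrightarrow> s \<in> F U \<Longrightarrow> t \<in> F U \<Longrightarrow> s - t \<in> F U"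
    and fsheaf_fmul: "\<And>U f s. open U \<Longrightarrow> f \<in> holfun A U \<Longrightarrow> s \<in> F U \<Longrightarrow> fmul f s \<in> F U"
    and fsheaf_restr: "\<And>U W s. s \<in> F U \<Longrightarrow> open U \<Longrightarrow> open W \<Longrightarrow> W \<subseteq> U \<Longrightarrow> restr W s \<in> F W"
    and fsheaf_local: "\<And>U s. open U \<Longrightarrow> (\<And>y. y \<notin> U \<Longrightarrow> s y = 0) \<Longrightarrow>
       (\<And>x. x \<in> U \<Longrightarrow> \<exists>W. open W \<and> x \<in> W \<and> W \<subseteq> U \<and> restr W s \<in> F W) \<Longrightarrow> s \<in> F U"
proof -
  note D = assms[unfolded fsheaf_def, THEN spec, THEN mp]
  show "\<And>U. open U \<Longrightarrow> 0 \<in> F U" by (rule D[THEN conjunct1])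
  note D2 = D[THEN conjunct2, THEN conjunct1, THEN bspec]
  show "\<And>U s y. s \<in> F U \<Longrightarrow> open U \<Longrightarrow> y \<notin> U \<Longrightarrow> s y = 0"
    and "\<And>U s t. open U \<Longrightarrow> s \<in> F U \<Longrightarrow> t \<in> F U \<Longrightarrow> s - t \<in> F U"
    and "\<And>U f s. open U \<Longrightarrow> f \<in> holfun A U \<Longrightarrow> s \<in> F U \<Longrightarrow> fmul f s \<in> F U"
    and "\<And>U W s. s \<in> F U \<Longrightarrow> open U \<Longrightarrow> open W \<Longrightarrow> W \<subseteq> U \<Longrightarrow> restr W s \<in> F W"
    using D2 by simp_all
  show "s \<in> F U" if "open U" "\<And>y. y \<notin> U \<Longrightarrow> s y = 0"
    "\<And>x. x \<in> U \<Longrightarrow> \<exists>W. open W \<and> x \<in> W \<and> W \<subseteq> U \<and> restr W s \<in> F W" for U s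
    by (rule D[OF that(1), THEN conjunct2, THEN conjunct2, THEN spec, THEN mp]) (use that in blast)
qed

lemma fsheaf_add: "fsheaf A F \<Longrightarrow> open U \<Longrightarrow> s \<in> F U \<Longrightarrow> t \<in> F U \<Longrightarrow> s + t \<in> F U"
  using fsheaf_diff[of A F U s "0 - t"] fsheaf_diff[of A F U 0 t] fsheaf_0[of A F U] by simp

lemma fsheaf_sum: "fsheaf A F \<Longrightarrow> open U \<Longrightarrow> (\<And>i. i \<in> I \<Longrightarrow> s i \<in> F U) \<Longrightarrow> (\<Sum>i\<in>I. s i) \<in> F U"
  by (induction I rule: infinite_finite_induct) (auto intro: fsheaf_add fsheaf_0)

lemma fsheaf_lincomb:
  assumes "fsheaf A F" "open U" "\<And>i. i \<in> I \<Longrightarrow> c i \<in> holfun A U" "\<And>i. i \<in> I \<Longrightarrow> s i \<in> F U"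
  shows "(\<lambda>y. \<Sum>i\<in>I. c i y *\<^sub>C s i y) \<in> F U"
proof -
  have "(\<lambda>y. \<Sum>i\<in>I. c i y *\<^sub>C s i y) = (\<Sum>i\<in>I. fmul (c i) (s i))"
    by (rule ext) (simp add: fun_sum_apply fmul_def)
  then show ?thesis using assms by (simp add: fsheaf_sum fsheaf_fmul)
qed

lemma fsheaf_restr_self: "fsheaf A F \<Longrightarrow> open U \<Longrightarrow> s \<in> F U \<Longrightarrow> restr U s = s"
  by (rule restr_eq_self) (auto dest: fsheaf_out)

lemma fsheaf_is_omod:
  assumes F: "fsheaf A F"
  shows "is_omod A (section_sheaf F)"
proof -
  have glue: "\<exists>!s. s \<in> F (\<Union>\<U>) \<and> (\<forall>W\<in>\<U>. restr W s = t W)"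
    if t: "\<forall>W\<in>\<U>. open W \<and> t W \<in> F W"
      "\<forall>W\<in>\<U>. \<forall>W'\<in>\<U>. restr (W \<inter> W') (t W) = restr (W \<inter> W') (t W')" for \<U> t
  proof -
    have "\<forall>y\<in>\<Union>\<U>. \<exists>W. W \<in> \<U> \<and> y \<in> W" by blast
    \<comment> \<open>\<open>N\<close> picks one member of the cover for each point. Compatibility
      on overlaps makes the glued value \<open>t (N y) y\<close> independent of the pick.\<close>
    then obtain N where N: "\<And>y. y \<in> \<Union>\<U> \<Longrightarrow> N y \<in> \<U> \<and> y \<in> N y" by metis
    define s where "s y = (if y \<in> \<Union>\<U> then t (N y) y else 0)" for y
    have sy: "s y = t W y" if "W \<in> \<U>" "y \<in> W" for W y
    proof -
      have "restr (N y \<inter> W) (t (N y)) y = restr (N y \<inter> W) (t W) y"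
        using t(2) N that by (metis UnionI)
      moreover have "y \<in> N y" "y \<in> \<Union>\<U>" using that N[of y] by auto
      ultimately show ?thesis using that(2) by (simp add: s_def)
    qed
    have r: "restr W s = t W" if "W \<in> \<U>" for W
      using sy[OF that] fsheaf_out[OF F] t(1) that by (intro ext) (auto simp: restr_apply)
    have "s \<in> F (\<Union>\<U>)"
    proof (rule fsheaf_local[OF F])
      show "open (\<Union>\<U>)" using t(1) by blast
      show "\<And>y. y \<notin> \<Union>\<U> \<Longrightarrow> s y = 0" by (simp add: s_def)
      show "\<exists>W. open W \<and> x \<in> W \<and> W \<subseteq> \<Union>\<U> \<and> restr W s \<in> F W" if "x \<in> \<Union>\<U>" for x
        using N[OF that] t(1) r[of "N x"] by (intro exI[of _ "N x"]) auto
    qed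
    moreover have "s' = s" if "s' \<in> F (\<Union>\<U>)" "\<forall>W\<in>\<U>. restr W s' = t W" for s'
    proof
      fix y
      show "s' y = s y"
      proof (cases "y \<in> \<Union>\<U>")
        case True
        then obtain W where "W \<in> \<U>" "y \<in> W" by blast
        then show ?thesis using that(2) sy by (metis restr_in)
      next
        case False
        have "open (\<Union>\<U>)" using t(1) by blast
        then show ?thesis using False fsheaf_out[OF F that(1)] by (simp add: s_def)
      qed
    qed
    ultimately show ?thesis using r by blast
  qed
  show ?thesis
    unfolding is_omod_def section_sheaf_def omod.simps
  proof (intro conjI allI impI ballI; (elim conjE)?)
    show "\<exists>!s. s \<in> F (\<Union>\<U>) \<and> (\<forall>W\<in>\<U>. restr W s = t W)"
      if "\<forall>W\<in>\<U>. open W \<and> t W \<in> F W"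
      "\<forall>W\<in>\<U>. \<forall>W'\<in>\<U>. restr (W \<inter> W') (t W) = restr (W \<inter> W') (t W')" for \<U> t
      by (rule glue[OF that])
    show "fmul (restr U (\<lambda>_. 1)) s = s" if "open U" "s \<in> F U" for U s
      using fsheaf_out[OF F that(2,1)] by (intro ext) (auto simp: fmul_def restr_apply)
  next
    fix U f s t assume "open U" "f \<in> holfun A U" "s \<in> F U" "t \<in> F U"
    show "fmul f (s + t) = fmul f s + fmul f t"
      by (rule ext) (simp add: fmul_def scaleC_add_right)
  next
    fix U f g s 
    show "fmul (f + g) s = fmul f s + fmul g s"
      by (rule ext) (simp add: fmul_def scaleC_add_left)
    show "fmul (fmul f g) s = fmul f (fmul g s)"
      by (rule ext) (simp add: fmul_def scaleC_scaleC)
  next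
    fix U f s W
    show "restr W (fmul f s) = fmul (restr W f) (restr W s)" by (simp add: fmul_restr)
  qed (auto simp: restr_add restr_restr_subset fsheaf_0[OF F] fsheaf_diff[OF F] fsheaf_fmul[OF F]
    fsheaf_restr[OF F] fsheaf_restr_self[OF F])
qed

text \<open>\<open>holomorphic_bundle\<close> supplies \<open>is_omod\<close>, whereas the arguments
  below use the closure conditions. The local test for membership comes from gluing the restrictions
  of s itself and recognising the result as s.\<close>

lemma is_omod_fsheaf:
  assumes M: "is_omod A (section_sheaf F)"
  shows "fsheaf A F"
proof (rule fsheafI)
  note M' = M[unfolded is_omod_def section_sheaf_def omod.simps]
  have D: "0 \<in> F U \<and> (\<forall>s\<in>F U. \<forall>t\<in>F U. s - t \<in> F U) \<and>
    (\<forall>f\<in>holfun A U. \<forall>s\<in>F U. fmul f s \<in> F U) \<and> (\<forall>s\<in>F U. restr U s = s) \<and>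
    (\<forall>W. open W \<and> W \<subseteq> U \<longrightarrow> (\<forall>s\<in>F U. restr W s \<in> F W))" if "open U" for U
    using spec[OF conjunct1[OF M'], THEN mp, OF that]
    by (elim conjE, intro conjI; (assumption | simp))
  \<comment> \<open>Vanishing outside U is hidden in the axiom that restriction of a section to its
    own domain is the identity.\<close>
  show out: "s y = 0" if "open U" "s \<in> F U" "y \<notin> U" for U s y
    using D[OF that(1)] that(2,3) by (metis restr_out)
  fix U :: "'a set" assume U: "open U"
  note DU = D[OF U]
  show "0 \<in> F U" using DU by simp
  show "s - t \<in> F U" if "s \<in> F U" "t \<in> F U" for s t using DU that by simp
  show "fmul f s \<in> F U" if "f \<in> holfun A U" "s \<in> F U" for f s using DU that by simp
  show "restr W s \<in> F W" if "open W" "W \<subseteq> U" "s \<in> F U" for W s using DU that by simp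
  fix s assume s0: "\<And>y. y \<notin> U \<Longrightarrow> s y = 0"
    and loc: "\<And>x. x \<in> U \<Longrightarrow> \<exists>W. open W \<and> x \<in> W \<and> W \<subseteq> U \<and> restr W s \<in> F W"
  \<comment> \<open>All open subsets over which s is already known to be a section: they cover U,
    and the restrictions of s to them are compatible.\<close>
  define \<U> where "\<U> = {W. open W \<and> W \<subseteq> U \<and> restr W s \<in> F W}"
  have UU: "\<Union>\<U> = U" using loc unfolding \<U>_def by blast
  have "\<exists>!s'. s' \<in> F (\<Union>\<U>) \<and> (\<forall>W\<in>\<U>. restr W s' = restr W s)"
  proof (rule mp[OF spec[OF spec[OF conjunct2[OF M'], of \<U>], of "\<lambda>W. restr W s"]])
    show "(\<forall>W\<in>\<U>. open W \<and> restr W s \<in> F W) \<and>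
      (\<forall>W\<in>\<U>. \<forall>W'\<in>\<U>. restr (W \<inter> W') (restr W s) = restr (W \<inter> W') (restr W' s))"
      by (auto simp: \<U>_def restr_restr_subset)
  qed
  then obtain s' where s': "s' \<in> F U" "\<forall>W\<in>\<U>. restr W s' = restr W s" unfolding UU by blast
  have "s' = s"
  proof
    fix y show "s' y = s y"
    proof (cases "y \<in> U")
      case True
      then obtain W where "W \<in> \<U>" "y \<in> W" using UU by blast
      then show ?thesis using s'(2) by (metis restr_in)
    next
      case False
      then show ?thesis using s0 out[OF U s'(1)] by simp
    qed
  qed
  then show "s \<in> F U" using s'(1) by simp
qed

section \<open>Holomorphic functions and derivations\<close>

locale riemann =
  fixes A :: "'x::t2_space chart set"
  assumes surface: "riemann_surface A"
begin

lemma chartE: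
  obtains U z where "(U, z) \<in> A" "x \<in> U"
proof -
  have "x \<in> (\<Union>(U, z)\<in>A. U)" using surface by (simp add: riemann_surface_def)
  then show thesis using that by auto
qed

lemma chart:
  assumes "(U, z) \<in> A"
  shows chart_open: "open U" and chart_image_open: "open (z ` U)"
    and chart_inv: "y \<in> U \<Longrightarrow> inv_into U z (z y) = y"
    and chart_inv_cont: "continuous_on (z ` U) (inv_into U z)"
    and chart_inj: "inj_on z U"
proof -
  have h: "open U" "open (z ` U)" "homeomorphism U (z ` U) z (inv_into U z)"
    using bspec[OF conjunct1[OF conjunct2[OF surface[unfolded riemann_surface_def]]] assms] by auto
  show "open U" by (rule h(1))
  show "open (z ` U)" by (rule h(2))
  show "y \<in> U \<Longrightarrow> inv_into U z (z y) = y" by (rule homeomorphism_apply1[OF h(3)])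
  show "continuous_on (z ` U) (inv_into U z)" by (rule homeomorphism_cont2[OF h(3)])
  show "inj_on z U" by (rule inj_on_inverseI) (rule homeomorphism_apply1[OF h(3)])
qed

text \<open>The image is the preimage of W under the inverse of the chart, which is continuous on an
  open set.\<close>

lemma chart_image_subset_open:
  assumes "(U, z) \<in> A" "open W" "W \<subseteq> U"
  shows "open (z ` W)"
proof -
  have "z ` W = inv_into U z -` W \<inter> z ` U"
    using chart_inv[OF assms(1)] assms(3) by (auto simp: image_iff)
  then show ?thesis
    using continuous_on_open_vimage[OF chart_image_open[OF assms(1)]] chart_inv_cont[OF assms(1)] assms(2)
    by (metis Int_commute)
qed

lemma transition:
  assumes "(U, z) \<in> A" "(W, w) \<in> A"
  shows "(w \<circ> inv_into U z) holomorphic_on z ` (U \<inter> W)"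
  using bspec[OF conjunct2[OF conjunct2[OF surface[unfolded riemann_surface_def]]] assms(1)] assms(2)
  by fastforce

lemma holfunD: "f \<in> holfun A U \<Longrightarrow> (W, z) \<in> A \<Longrightarrow> (f \<circ> inv_into W z) holomorphic_on z ` (U \<inter> W)"
  unfolding holfun_def by blast

lemma holfun_out: "f \<in> holfun A U \<Longrightarrow> y \<notin> U \<Longrightarrow> f y = 0"
  unfolding holfun_def by blast

lemma holfunI:
  "(\<And>y. y \<notin> U \<Longrightarrow> f y = 0) \<Longrightarrow>
    (\<And>W z. (W, z) \<in> A \<Longrightarrow> (f \<circ> inv_into W z) holomorphic_on z ` (U \<inter> W)) \<Longrightarrow> f \<in> holfun A U"
  unfolding holfun_def by blast

lemma holfun_chart:
  assumes "f \<in> holfun A W" "(U, z) \<in> A" "W \<subseteq> U"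
  shows "(f \<circ> inv_into U z) holomorphic_on z ` W"
  using holfunD[OF assms(1,2)] assms(3) by (simp add: Int_absorb2)

text \<open>Transition maps carry holomorphy in one chart to all the others; \<open>restr\<close>
  installs the value 0 outside W.\<close>

lemma holfun_of_chart:
  assumes z: "(U, z) \<in> A" and W: "open W" "W \<subseteq> U" and G: "G holomorphic_on z ` W"
  shows "restr W (\<lambda>y. G (z y)) \<in> holfun A W"
proof (rule holfunI)
  fix W' w assume w: "(W', w) \<in> A"
  have *: "((G \<circ> (z \<circ> inv_into W' w))) holomorphic_on w ` (W \<inter> W')"
  proof (rule holomorphic_on_compose)
    show "(z \<circ> inv_into W' w) holomorphic_on w ` (W \<inter> W')"
      by (rule holomorphic_on_subset[OF transition[OF w z]]) (use W in auto)
    show "G holomorphic_on (z \<circ> inv_into W' w) ` w ` (W \<inter> W')"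
      by (rule holomorphic_on_subset[OF G]) (auto simp: chart_inv[OF w])
  qed
  show "(restr W (\<lambda>y. G (z y)) \<circ> inv_into W' w) holomorphic_on w ` (W \<inter> W')"
    by (rule holomorphic_transform[OF *]) (auto simp: chart_inv[OF w])
qed simp

lemma hol_const: "restr U (\<lambda>_. c) \<in> holfun A U"
proof (rule holfunI)
  fix W z assume "(W, z) \<in> A"
  show "(restr U (\<lambda>_. c) \<circ> inv_into W z) holomorphic_on z ` (U \<inter> W)"
    by (rule holomorphic_transform[of "\<lambda>_. c"]) (auto simp: chart_inv[OF \<open>(W, z) \<in> A\<close>])
qed simp

lemma hol_0: "0 \<in> holfun A U"
  by (rule holfunI) (auto simp: zero_fun_def o_def)

lemma hol_diff: "f \<in> holfun A U \<Longrightarrow> g \<in> holfun A U \<Longrightarrow> f - g \<in> holfun A U"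
  by (rule holfunI)
    (auto simp: holfun_out fun_diff_def o_def intro!: holomorphic_on_diff dest: holfunD)

lemma hol_add: "f \<in> holfun A U \<Longrightarrow> g \<in> holfun A U \<Longrightarrow> f + g \<in> holfun A U"
  by (rule holfunI)
    (auto simp: holfun_out plus_fun_def o_def intro!: holomorphic_on_add dest: holfunD)

lemma hol_fmul: "f \<in> holfun A U \<Longrightarrow> g \<in> holfun A U \<Longrightarrow> fmul f g \<in> holfun A U"
  by (rule holfunI)
    (auto simp: holfun_out fmul_def o_def intro!: holomorphic_on_mult dest: holfunD)

lemma hol_scale: "f \<in> holfun A U \<Longrightarrow> c *\<^sub>C f \<in> holfun A U"
  by (rule holfunI)
    (auto simp: holfun_out scaleC_fun_def o_def intro!: holomorphic_on_mult dest: holfunD)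

lemma hol_restr: "f \<in> holfun A U \<Longrightarrow> W \<subseteq> U \<Longrightarrow> restr W f \<in> holfun A W"
proof (rule holfunI)
  fix V z assume a: "f \<in> holfun A U" "W \<subseteq> U" "(V, z) \<in> A"
  have "(f \<circ> inv_into V z) holomorphic_on z ` (W \<inter> V)"
    by (rule holomorphic_on_subset[OF holfunD[OF a(1,3)]]) (use a in auto)
  then show "(restr W f \<circ> inv_into V z) holomorphic_on z ` (W \<inter> V)"
    by (rule holomorphic_transform) (auto simp: chart_inv[OF a(3)])
qed simp

lemma hol_inverse:
  assumes "f \<in> holfun A U" "\<And>y. y \<in> U \<Longrightarrow> f y \<noteq> 0"
  shows "restr U (\<lambda>y. inverse (f y)) \<in> holfun A U"
proof (rule holfunI)
  fix W z assume z: "(W, z) \<in> A"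
  have "(\<lambda>q. inverse ((f \<circ> inv_into W z) q)) holomorphic_on z ` (U \<inter> W)"
    by (rule holomorphic_on_inverse[OF holfunD[OF assms(1) z]])
      (auto simp: chart_inv[OF z] assms(2))
  then show "(restr U (\<lambda>y. inverse (f y)) \<circ> inv_into W z) holomorphic_on z ` (U \<inter> W)"
    by (rule holomorphic_transform) (auto simp: chart_inv[OF z])
qed simp

lemma hol_local:
  assumes "open U" "\<And>y. y \<notin> U \<Longrightarrow> f y = 0"
    and loc: "\<And>x. x \<in> U \<Longrightarrow> \<exists>W. open W \<and> x \<in> W \<and> W \<subseteq> U \<and> restr W f \<in> holfun A W"
  shows "f \<in> holfun A U"
proof (rule holfunI)
  fix V z assume z: "(V, z) \<in> A"
  have "(f \<circ> inv_into V z) field_differentiable at q" if q: "q \<in> z ` (U \<inter> V)" for q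
  proof -
    obtain y where y: "y \<in> U" "y \<in> V" "q = z y" using q by blast
    obtain W where W: "open W" "y \<in> W" "W \<subseteq> U" "restr W f \<in> holfun A W" using loc[OF y(1)] by blast
    have "(restr W f \<circ> inv_into V z) holomorphic_on z ` (W \<inter> V)" using holfunD[OF W(4) z] .
    then have h: "(f \<circ> inv_into V z) holomorphic_on z ` (W \<inter> V)"
      by (rule holomorphic_transform) (auto simp: chart_inv[OF z])
    have "open (z ` (W \<inter> V))"
      by (rule chart_image_subset_open[OF z]) (auto simp: W chart_open[OF z])
    moreover have "q \<in> z ` (W \<inter> V)" using y W by blast
    ultimately show ?thesis using h holomorphic_on_imp_differentiable_at by blast
  qed
  then show "(f \<circ> inv_into V z) holomorphic_on z ` (U \<inter> V)"
    by (meson field_differentiable_at_within holomorphic_onI)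
qed (use assms in auto)

lemma fsheaf_holfun: "fsheaf A (holfun A)"
  by (rule fsheafI) (auto simp: hol_0 holfun_out hol_diff hol_fmul hol_restr intro: hol_local)

text \<open>No point of a Riemann surface is isolated.\<close>

lemma hol_eq_0_off_finite:
  assumes f: "f \<in> holfun A U" and U: "open U" and S: "finite S" and 0: "\<And>y. y \<in> U - S \<Longrightarrow> f y = 0"
  shows "f y = 0"
proof (cases "y \<in> U")
  case True
  obtain V z where z: "(V, z) \<in> A" "y \<in> V" using chartE .
  define T where "T = z ` (U \<inter> V)"
  define F where "F = f \<circ> inv_into V z"
  have T: "open T" "z y \<in> T" unfolding T_def
    using chart_image_subset_open[OF z(1), of "U \<inter> V"] U chart_open[OF z(1)] True z(2) by auto
  have "F holomorphic_on T" unfolding F_def T_def by (rule holfunD[OF f z(1)])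
  then have "isCont F (z y)"
    using T continuous_on_eq_continuous_at holomorphic_on_imp_continuous_on by blast
  then have lim: "(F \<longlongrightarrow> F (z y)) (at (z y))" by (simp add: isCont_def)
  have "finite (z ` S)" using S by simp
  then have "open (- (z ` S - {z y}))" by (intro open_Compl finite_imp_closed) simp
  then have "eventually (\<lambda>q. q \<in> - (z ` S - {z y})) (nhds (z y))"
    by (rule eventually_nhds_in_open) simp
  then have "eventually (\<lambda>q. q \<notin> z ` S - {z y}) (nhds (z y))"
    by (rule eventually_mono) auto
  then have "eventually (\<lambda>q. q \<notin> z ` S - {z y}) (at (z y))"
    by (rule filter_leD[rotated]) (simp add: at_within_def)
  moreover have "eventually (\<lambda>q. q \<in> T - {z y}) (at (z y))"
    using T by (intro eventually_at_in_open) auto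
  ultimately have "eventually (\<lambda>q. F q = 0) (at (z y))"
  proof eventually_elim
    case (elim q)
    then obtain p where p: "p \<in> U" "p \<in> V" "q = z p" "q \<noteq> z y" unfolding T_def by blast
    then have "p \<notin> S" using elim by auto
    then show ?case using 0[of p] p by (simp add: F_def chart_inv[OF z(1)])
  qed
  then have "(F \<longlongrightarrow> 0) (at (z y))" by (rule tendsto_eventually)
  then have "F (z y) = 0" using lim tendsto_unique[of "at (z y)"] by auto
  then show ?thesis using z by (simp add: F_def chart_inv[OF z(1)])
qed (use f holfun_out in auto)

lemma hol_eq_off_finite:
  assumes "f \<in> holfun A U" "g \<in> holfun A U" "open U" "finite S" "\<And>y. y \<in> U - S \<Longrightarrow> f y = g y"
  shows "f = g"
proof
  fix y
  have "(f - g) y = 0"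
    by (rule hol_eq_0_off_finite[OF hol_diff[OF assms(1,2)] assms(3,4)]) (use assms(5) in auto)
  then show "f y = g y" by simp
qed

text \<open>Removable singularity in the chart: the quotient of f by the coordinate difference
  extends over p when f vanishes there. If p lies outside W, injectivity of the chart keeps the
  denominator away from 0 and the plain quotient works, so one statement serves every open W in the
  chart.\<close>

lemma hol_divide_chart:
  assumes z: "(U, z) \<in> A" and W: "open W" "W \<subseteq> U" and p: "p \<in> U"
    and f: "f \<in> holfun A W" and 0: "p \<in> W \<Longrightarrow> f p = 0"
  shows "\<exists>g\<in>holfun A W. \<forall>y. f y = (z y - z p) * g y"
proof -
  define F where "F = f \<circ> inv_into U z"
  have F: "F holomorphic_on z ` W" unfolding F_def by (rule holfun_chart[OF f z W(2)])
  have oW: "open (z ` W)" by (rule chart_image_subset_open[OF z W])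
  have Fz: "F (z y) = f y" if "y \<in> W" for y using that W by (auto simp: F_def chart_inv[OF z])
  obtain G where G: "G holomorphic_on z ` W" "\<And>q. q \<in> z ` W \<Longrightarrow> F q = (q - z p) * G q"
  proof (cases "p \<in> W")
    case True
    \<comment> \<open>The value at the centre is the limit of the difference quotients, as
      \<open>pole_lemma\<close> requires.\<close>
    let ?G = "\<lambda>q. if q = z p then deriv F (z p) else (F q - F (z p)) / (q - z p)"
    have "?G holomorphic_on z ` W"
      by (rule pole_lemma[OF F]) (use oW True in \<open>auto simp: interior_open\<close>)
    moreover have "F (z p) = 0" using Fz[OF True] 0[OF True] by simp
    ultimately show ?thesis by (intro that[of ?G]) auto
  next
    case False
    then have "z p \<notin> z ` W" using chart_inj[OF z] W(2) p by (auto dest: inj_onD)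
    then have "q - z p \<noteq> 0" if "q \<in> z ` W" for q using that by (metis eq_iff_diff_eq_0)
    then show ?thesis
      by (intro that[of "\<lambda>q. F q / (q - z p)"] holomorphic_on_divide holomorphic_intros F) simp_all
  qed
  show ?thesis
  proof (intro bexI allI)
    show "restr W (\<lambda>y. G (z y)) \<in> holfun A W" by (rule holfun_of_chart[OF z W G(1)])
    show "f y = (z y - z p) * restr W (\<lambda>y. G (z y)) y" for y
      using G(2)[of "z y"] Fz[of y] holfun_out[OF f, of y] by (auto simp: restr_apply)
  qed
qed

end

section \<open>Tangent vectors as derivations, and local coordinates\<close>

context riemann
begin

lemma tangentD:
  assumes "v \<in> tangent_space A x" "open U" "x \<in> U" "f \<in> holfun A U"
  shows tangent_add: "g \<in> holfun A U \<Longrightarrow> v (f + g) = v f + v g"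
    and tangent_mult: "g \<in> holfun A U \<Longrightarrow> v (fmul f g) = f x * v g + g x * v f"
    and tangent_scale: "v (c *\<^sub>C f) = c * v f"
    and tangent_restr: "open W \<Longrightarrow> x \<in> W \<Longrightarrow> W \<subseteq> U \<Longrightarrow> v (restr W f) = v f"
proof -
  note D = assms(1)[unfolded tangent_space_def mem_Collect_eq, THEN conjunct2, THEN spec[where x=U],
      THEN mp, OF conjI[OF assms(2,3)]]
  note D1 = D[THEN conjunct1, THEN bspec, OF assms(4), THEN bspec]
  show "g \<in> holfun A U \<Longrightarrow> v (f + g) = v f + v g" using D1 by blast
  show "g \<in> holfun A U \<Longrightarrow> v (fmul f g) = f x * v g + g x * v f" using D1 by blast
  note D2 = D[THEN conjunct2]
  show "v (c *\<^sub>C f) = c * v f" by (rule D2[THEN conjunct1, THEN bspec, OF assms(4), THEN spec])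
  show "open W \<Longrightarrow> x \<in> W \<Longrightarrow> W \<subseteq> U \<Longrightarrow> v (restr W f) = v f"
    by (rule D2[THEN conjunct2, THEN bspec, OF assms(4), THEN spec, THEN mp]) (intro conjI)
qed

lemma tangent_junk:
  "v \<in> tangent_space A x \<Longrightarrow> (\<And>U. open U \<Longrightarrow> x \<in> U \<Longrightarrow> f \<notin> holfun A U) \<Longrightarrow> v f = 0"
  unfolding tangent_space_def mem_Collect_eq by (erule conjE, drule spec[of _ f]) blast

lemma tangentI:
  assumes "\<And>f. (\<And>U. open U \<Longrightarrow> x \<in> U \<Longrightarrow> f \<notin> holfun A U) \<Longrightarrow> v f = 0"
    and "\<And>U f g. open U \<Longrightarrow> x \<in> U \<Longrightarrow> f \<in> holfun A U \<Longrightarrow> g \<in> holfun A U \<Longrightarrow> v (f + g) = v f + v g"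
    and "\<And>U f g. open U \<Longrightarrow> x \<in> U \<Longrightarrow> f \<in> holfun A U \<Longrightarrow> g \<in> holfun A U \<Longrightarrow>
      v (fmul f g) = f x * v g + g x * v f"
    and "\<And>U f c. open U \<Longrightarrow> x \<in> U \<Longrightarrow> f \<in> holfun A U \<Longrightarrow> v (c *\<^sub>C f) = c * v f"
    and "\<And>U f W. open U \<Longrightarrow> x \<in> U \<Longrightarrow> f \<in> holfun A U \<Longrightarrow> open W \<Longrightarrow> x \<in> W \<Longrightarrow> W \<subseteq> U \<Longrightarrow> v (restr W f) = v f"
  shows "v \<in> tangent_space A x"
  unfolding tangent_space_def mem_Collect_eq
proof (intro conjI allI impI ballI; (elim conjE)?)
  fix f assume "\<nexists>U. open U \<and> x \<in> U \<and> f \<in> holfun A U"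
  then show "v f = 0" by (intro assms(1)) blast
qed (simp_all add: assms(2-5))

lemma subspace_tangent: "complex_vector.subspace (tangent_space A x)"
  unfolding complex_vector.subspace_def
proof (intro conjI ballI allI)
  show "0 \<in> tangent_space A x" by (rule tangentI) auto
  fix v w c assume v: "v \<in> tangent_space A x" 
  show "c *\<^sub>C v \<in> tangent_space A x"
    by (rule tangentI) (auto simp: tangent_junk[OF v] tangent_add[OF v] tangent_mult[OF v]
      tangent_scale[OF v] tangent_restr[OF v] algebra_simps)
  assume w: "w \<in> tangent_space A x"
  show "v + w \<in> tangent_space A x"
    by (rule tangentI) (auto simp: tangent_junk[OF v] tangent_add[OF v] tangent_mult[OF v]
      tangent_scale[OF v] tangent_restr[OF v] tangent_junk[OF w] tangent_add[OF w] tangent_mult[OF w]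
      tangent_scale[OF w] tangent_restr[OF w] algebra_simps)
qed

text \<open>The Leibniz rule for 1 * 1 = 1 gives v(1) = 2 v(1), hence v(1) = 0; homogeneity takes
  care of the other constants.\<close>

lemma tangent_const:
  assumes "v \<in> tangent_space A x" "open U" "x \<in> U"
  shows "v (restr U (\<lambda>_. c)) = 0"
proof -
  let ?o = "restr U (\<lambda>_. 1) :: 'x \<Rightarrow> complex"
  have o: "?o \<in> holfun A U" by (rule hol_const)
  have "fmul ?o ?o = ?o" by (rule ext) (auto simp: fmul_def restr_apply)
  then have "v ?o = v ?o + v ?o" using tangent_mult[OF assms o o] assms(3) by simp
  then have "v ?o = 0" by simp
  moreover have "restr U (\<lambda>_. c) = c *\<^sub>C ?o" by (rule ext) (auto simp: restr_apply)
  ultimately show ?thesis using tangent_scale[OF assms o, of c] by simp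
qed

text \<open>Hadamard's argument: near y, f - f(y) is the coordinate difference times a holomorphic
  g, so every derivation at y multiplies its value on the coordinate by a = g(y). This factor does
  not depend on v, which makes the tangent space one-dimensional. The free constant c allows the
  coordinate to be centred anywhere.\<close>

lemma tangent_via_chart:
  assumes z: "(U0, z0) \<in> A" and W: "open W" "W \<subseteq> U0" and y: "y \<in> W"
    and f: "open U" "y \<in> U" "f \<in> holfun A U"
  obtains a where "\<And>v. v \<in> tangent_space A y \<Longrightarrow> v f = a * v (restr W (\<lambda>p. z0 p - c))"
proof -
  define W' where "W' = U \<inter> W"
  have W': "open W'" "W' \<subseteq> U0" "y \<in> W'" "W' \<subseteq> U" "W' \<subseteq> W" using W f y by (auto simp: W'_def)
  let ?c = "\<lambda>a. restr W' (\<lambda>_. a) :: 'x \<Rightarrow> complex"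
  let ?z = "restr W (\<lambda>p. z0 p - c)"
  have hz: "?z \<in> holfun A W"
    by (rule holfun_of_chart[OF z W]) (intro holomorphic_intros)
  let ?zy = "restr W' ?z - ?c (z0 y - c)"
  have hzy: "?zy \<in> holfun A W'" by (intro hol_diff hol_restr[OF hz] hol_const W')
  let ?f = "restr W' f - ?c (f y)"
  have hf: "?f \<in> holfun A W'" by (intro hol_diff hol_restr[OF f(3)] hol_const W')
  obtain g where g: "g \<in> holfun A W'" "\<And>p. ?f p = (z0 p - z0 y) * g p"
    using hol_divide_chart[OF z W'(1,2) subsetD[OF W'(2,3)] hf] W'(3) by auto
  have fg: "?f = fmul ?zy g"
  proof
    fix p show "?f p = fmul ?zy g p"
      using g(2)[of p] W'(5) holfun_out[OF g(1), of p] by (cases "p \<in> W'") (auto simp: fmul_def)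
  qed
  show thesis
  proof (rule that)
    fix v assume v: "v \<in> tangent_space A y"
    have "v f = v (?f + ?c (f y))" using tangent_restr[OF v f W'(1,3,4)] by simp
    also have "\<dots> = v ?f" 
      by (simp only: tangent_add[OF v W'(1,3) hf hol_const] tangent_const[OF v W'(1,3)] add_0_right)
    also have "\<dots> = g y * v ?zy"
      unfolding fg using tangent_mult[OF v W'(1,3) hzy g(1)] W'(3,5) by auto
    also have "v ?zy = v (?zy + ?c (z0 y - c))"

      by (simp only: tangent_add[OF v W'(1,3) hzy hol_const] tangent_const[OF v W'(1,3)] add_0_right)
    also have "\<dots> = v ?z" using tangent_restr[OF v W(1) y hz W'(1,3,5)] by simp
    finally show "v f = g y * v ?z" .
  qed
qed

text \<open>The vector field \<open>d\<close> is the derivative with respect to the coordinate \<open>z\<close>.\<close>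

definition coord ::
  "'x \<Rightarrow> 'x set \<Rightarrow> ('x \<Rightarrow> complex) \<Rightarrow> ('x \<Rightarrow> 'x tvec) \<Rightarrow> bool" where
  "coord x W z d \<longleftrightarrow> local_coord A x W z \<and> d \<in> hsec (tangent_bundle A) W \<and>
     (\<forall>y\<in>W. d y z = 1) \<and> (\<forall>y\<in>W. \<forall>v\<in>tangent_space A y. v = v z *\<^sub>C d y) \<and>
     (\<forall>W' f. open W' \<and> W' \<subseteq> W \<and> f \<in> holfun A W' \<and> (x \<in> W' \<longrightarrow> f x = 0) \<longrightarrow>
        (\<exists>g\<in>holfun A W'. f = fmul z g))"

lemma tangent_hsecI:
  assumes "\<And>y. y \<in> U \<Longrightarrow> \<xi> y \<in> tangent_space A y" "\<And>y. y \<notin> U \<Longrightarrow> \<xi> y = 0"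
    "\<And>W f. open W \<Longrightarrow> W \<subseteq> U \<Longrightarrow> f \<in> holfun A W \<Longrightarrow> restr W (\<lambda>y. \<xi> y f) \<in> holfun A W"
  shows "\<xi> \<in> hsec (tangent_bundle A) U"
  using assms unfolding tangent_bundle_def by simp

lemma tangent_hsecD:
  assumes "\<xi> \<in> hsec (tangent_bundle A) U"
  shows "y \<in> U \<Longrightarrow> \<xi> y \<in> tangent_space A y" "y \<notin> U \<Longrightarrow> \<xi> y = 0"
    "open W \<Longrightarrow> W \<subseteq> U \<Longrightarrow> f \<in> holfun A W \<Longrightarrow> restr W (\<lambda>y. \<xi> y f) \<in> holfun A W"
  using assms unfolding tangent_bundle_def by simp_all

lemma fib_tangent [simp]: "fib (tangent_bundle A) = tangent_space A"
  by (simp add: tangent_bundle_def)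

lemma tangent_hsec_restr:
  assumes "\<xi> \<in> hsec (tangent_bundle A) U" "W \<subseteq> U"
  shows "restr W \<xi> \<in> hsec (tangent_bundle A) W"
proof (rule tangent_hsecI)
  fix W' f assume a: "open W'" "W' \<subseteq> W" "f \<in> holfun A W'"
  have "restr W' (\<lambda>y. restr W \<xi> y f) = restr W' (\<lambda>y. \<xi> y f)"
    using a(2) by (intro ext) (auto simp: restr_apply)
  then show "restr W' (\<lambda>y. restr W \<xi> y f) \<in> holfun A W'"
    using tangent_hsecD(3)[OF assms(1) a(1) _ a(3)] a(2) assms(2) by auto
qed (use assms tangent_hsecD(1)[OF assms(1)] in auto)

text \<open>The chart shifted to vanish at x serves as z and differentiation in the chart as d.
  Division by the coordinate difference gives the last clause of \<open>coord\<close>, Hadamard's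
  argument the spanning clause.\<close>

lemma coord_exists:
  assumes N: "open N" "x \<in> N"
  shows "\<exists>W z d. coord x W z d \<and> W \<subseteq> N"
proof -
  obtain U0 z0 where z0: "(U0, z0) \<in> A" "x \<in> U0" using chartE .
  define W where "W = N \<inter> U0"
  have W: "open W" "x \<in> W" "W \<subseteq> U0" using N z0 chart_open[OF z0(1)] by (auto simp: W_def)
  define z where "z = restr W (\<lambda>y. z0 y - z0 x)"
  have hz: "z \<in> holfun A W" unfolding z_def
    by (rule holfun_of_chart[OF z0(1) W(1,3)]) (intro holomorphic_intros)
  \<comment> \<open>Differentiation in the chart, set to 0 on functions that are holomorphic on no
    neighbourhood of y, as \<open>tangent_space\<close> demands of its elements.\<close>
  define dv where "dv y f = (if \<exists>U. open U \<and> y \<in> U \<and> f \<in> holfun A U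
    then deriv (f \<circ> inv_into U0 z0) (z0 y) else 0)" for y f
  have dvE: "dv y f = deriv (f \<circ> inv_into U0 z0) (z0 y)" if "open U" "y \<in> U" "f \<in> holfun A U" for y f U
    using that by (auto simp: dv_def)
  have inv: "inv_into U0 z0 (z0 y) = y" if "y \<in> U0" for y using that chart_inv[OF z0(1)] by simp
  have fd: "(f \<circ> inv_into U0 z0) field_differentiable at (z0 y)"
    if "open U" "y \<in> U" "y \<in> U0" "f \<in> holfun A U" for y f U
  proof -
    have "open (z0 ` (U \<inter> U0))"
      by (rule chart_image_subset_open[OF z0(1)]) (use that chart_open[OF z0(1)] in auto)
    then show ?thesis using holfunD[OF that(4) z0(1)] that holomorphic_on_imp_differentiable_at by blast
  qed
  have dvT: "dv y \<in> tangent_space A y" if y: "y \<in> U0" for y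
  proof (rule tangentI)
    fix U f assume U: "open U" "y \<in> U" and f: "f \<in> holfun A U"
    note F = fd[OF U y f]
    show "dv y (c *\<^sub>C f) = c * dv y f" for c
      using deriv_cmult[OF F, of c] unfolding dvE[OF U f] dvE[OF U hol_scale[OF f]]
      by (simp add: scaleC_fun_def o_def)
    fix W assume V: "open W" "y \<in> W" "W \<subseteq> U"
    have "eventually (\<lambda>q. q \<in> z0 ` (W \<inter> U0)) (nhds (z0 y))"
      by (rule eventually_nhds_in_open[OF chart_image_subset_open[OF z0(1)]])
        (use V y chart_open[OF z0(1)] in auto)
    then have "eventually (\<lambda>q. (restr W f \<circ> inv_into U0 z0) q = (f \<circ> inv_into U0 z0) q) (nhds (z0 y))"
      by eventually_elim (auto simp: inv)
    then show "dv y (restr W f) = dv y f"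
      unfolding dvE[OF U f] dvE[OF V(1,2) hol_restr[OF f V(3)]] by (intro deriv_cong_ev) auto
  next
    fix U f g assume U: "open U" "y \<in> U" and f: "f \<in> holfun A U" and g: "g \<in> holfun A U"
    note F = fd[OF U y f] and G = fd[OF U y g]
    show "dv y (f + g) = dv y f + dv y g"
      using deriv_add[OF F G] unfolding dvE[OF U f] dvE[OF U g] dvE[OF U hol_add[OF f g]]
      by (simp add: plus_fun_def o_def)
    show "dv y (fmul f g) = f y * dv y g + g y * dv y f"
      using deriv_mult[OF F G] unfolding dvE[OF U f] dvE[OF U g] dvE[OF U hol_fmul[OF f g]]
      by (simp add: fmul_def o_def inv[OF y])
  next
    fix f assume "\<And>U. open U \<Longrightarrow> y \<in> U \<Longrightarrow> f \<notin> holfun A U"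
    then show "dv y f = 0" unfolding dv_def by auto
  qed
  define d where "d = restr W dv"
  have dy: "d y = dv y" if "y \<in> W" for y using that by (simp add: d_def)
  have dT: "d y \<in> tangent_space A y" if "y \<in> W" for y using dvT that W by (auto simp: dy)
  have d: "d \<in> hsec (tangent_bundle A) W"
  proof (rule tangent_hsecI)
    fix W' f assume a: "open W'" "W' \<subseteq> W" "f \<in> holfun A W'"
    have aU: "W' \<subseteq> U0" using a W by auto
    have "restr W' (\<lambda>y. d y f) = restr W' (\<lambda>y. deriv (f \<circ> inv_into U0 z0) (z0 y))"
      using a dvE[OF a(1) _ a(3)] by (intro ext) (auto simp: restr_apply dy)
    moreover have "\<dots> \<in> holfun A W'"
      by (rule holfun_of_chart[OF z0(1) a(1) aU])
        (rule holomorphic_deriv[OF holfun_chart[OF a(3) z0(1) aU] chart_image_subset_open[OF z0(1) a(1) aU]])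
    ultimately show "restr W' (\<lambda>y. d y f) \<in> holfun A W'" by simp
  qed (use dT in \<open>auto simp: d_def\<close>)
  have dz: "d y z = 1" if y: "y \<in> W" for y
  proof -
    have "eventually (\<lambda>q. q \<in> z0 ` W) (nhds (z0 y))"
      by (rule eventually_nhds_in_open[OF chart_image_subset_open[OF z0(1) W(1,3)]]) (use y in auto)
    then have "eventually (\<lambda>q. (z \<circ> inv_into U0 z0) q = q - z0 x) (nhds (z0 y))"
      by eventually_elim (use W(3) in \<open>auto simp: inv z_def subsetD\<close>)
    then have "deriv (z \<circ> inv_into U0 z0) (z0 y) = deriv (\<lambda>q. q - z0 x) (z0 y)"
      by (intro deriv_cong_ev) auto
    also have "\<dots> = 1" by (rule DERIV_imp_deriv) (auto intro!: derivative_eq_intros)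
    finally show ?thesis using dvE[OF W(1) y hz] by (simp add: dy[OF y])
  qed
  \<comment> \<open>On a germ f both sides are the same multiple of their values on z, and d takes
    the value 1 on z. On all other functions both are 0 by convention.\<close>
  have span: "v = v z *\<^sub>C d y" if y: "y \<in> W" and v: "v \<in> tangent_space A y" for y v
  proof
    fix f
    show "v f = (v z *\<^sub>C d y) f"
    proof (cases "\<exists>U. open U \<and> y \<in> U \<and> f \<in> holfun A U")
      case True
      then obtain U where U: "open U" "y \<in> U" "f \<in> holfun A U" by blast
      obtain a where a: "\<And>v. v \<in> tangent_space A y \<Longrightarrow> v f = a * v z"
        unfolding z_def using tangent_via_chart[OF z0(1) W(1,3) y U, of "z0 x"] by blast
      show ?thesis using a[OF v] a[OF dT[OF y]] dz[OF y] by simp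
    next
      case False
      then show ?thesis using tangent_junk[OF v] tangent_junk[OF dT[OF y]] by auto
    qed
  qed
  have "inj_on z W"
  proof (rule inj_onI)
    fix p q assume "p \<in> W" "q \<in> W" "z p = z q"
    then show "p = q" using W(3) chart_inj[OF z0(1)] by (auto simp: z_def dest!: inj_onD)
  qed
  then have lc: "local_coord A x W z"
    using W(1,2) hz by (simp add: local_coord_def z_def)
  have div: "\<exists>g\<in>holfun A W'. f = fmul z g"
    if a: "open W'" "W' \<subseteq> W" "f \<in> holfun A W'" "x \<in> W' \<longrightarrow> f x = 0" for W' f
  proof -
    have "W' \<subseteq> U0" using a W by auto
    then obtain g where g: "g \<in> holfun A W'" "\<And>y. f y = (z0 y - z0 x) * g y"
      using hol_divide_chart[OF z0(1) a(1) _ z0(2) a(3)] a(4) by blast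
    have "f = fmul z g"
    proof
      fix y show "f y = fmul z g y"
        using g(2)[of y] a(2) holfun_out[OF a(3), of y] holfun_out[OF g(1), of y]
        by (cases "y \<in> W'") (auto simp: fmul_def z_def)
    qed
    then show ?thesis using g(1) by blast
  qed
  have "coord x W z d"
    unfolding coord_def
  proof (intro conjI ballI allI impI; (elim conjE)?)
    show "local_coord A x W z" by (rule lc)
    show "d \<in> hsec (tangent_bundle A) W" by (rule d)
    show "d y z = 1" if "y \<in> W" for y by (rule dz[OF that])
    show "v = v z *\<^sub>C d y" if "y \<in> W" "v \<in> tangent_space A y" for y v by (rule span[OF that])
    show "\<exists>g\<in>holfun A W'. f = fmul z g"
      if "open W'" "W' \<subseteq> W" "f \<in> holfun A W'" "x \<in> W' \<longrightarrow> f x = 0" for W' f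
      by (rule div[OF that])
  qed
  then show ?thesis using W_def by blast
qed

lemma coordD:
  assumes "coord x W z d"
  shows coord_open: "open W" and coord_mem: "x \<in> W" and coord_hol: "z \<in> holfun A W"
    and coord_center: "z x = 0" and coord_zero: "y \<in> W \<Longrightarrow> z y = 0 \<Longrightarrow> y = x"
    and coord_field: "d \<in> hsec (tangent_bundle A) W"
    and coord_vec: "y \<in> W \<Longrightarrow> d y \<in> tangent_space A y"
    and coord_deriv: "y \<in> W \<Longrightarrow> d y z = 1"
    and coord_span: "y \<in> W \<Longrightarrow> v \<in> tangent_space A y \<Longrightarrow> v = v z *\<^sub>C d y"
    and coord_div: "open W' \<Longrightarrow> W' \<subseteq> W \<Longrightarrow> f \<in> holfun A W' \<Longrightarrow> (x \<in> W' \<Longrightarrow> f x = 0) \<Longrightarrow>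
       \<exists>g\<in>holfun A W'. f = fmul z g"
    and coord_local: "local_coord A x W z"
proof -
  note D = assms[unfolded coord_def]
  note lc = D[THEN conjunct1] and df = D[THEN conjunct2, THEN conjunct1]
    and D3 = D[THEN conjunct2, THEN conjunct2]
  show "open W" "x \<in> W" "z \<in> holfun A W" "z x = 0" "local_coord A x W z"
    using lc by (auto simp: local_coord_def)
  show "y \<in> W \<Longrightarrow> z y = 0 \<Longrightarrow> y = x"
    using lc inj_onD[of z W y x] by (auto simp: local_coord_def)
  show "d \<in> hsec (tangent_bundle A) W" by (rule df)
  show "y \<in> W \<Longrightarrow> d y \<in> tangent_space A y" by (rule tangent_hsecD(1)[OF df])
  show "y \<in> W \<Longrightarrow> d y z = 1" by (rule D3[THEN conjunct1, THEN bspec])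
  show "y \<in> W \<Longrightarrow> v \<in> tangent_space A y \<Longrightarrow> v = v z *\<^sub>C d y"
    by (rule D3[THEN conjunct2, THEN conjunct1, THEN bspec, THEN bspec])
  show "open W' \<Longrightarrow> W' \<subseteq> W \<Longrightarrow> f \<in> holfun A W' \<Longrightarrow> (x \<in> W' \<Longrightarrow> f x = 0) \<Longrightarrow>
       \<exists>g\<in>holfun A W'. f = fmul z g"
    by (rule D3[THEN conjunct2, THEN conjunct2, THEN spec, THEN spec, THEN mp]) (intro conjI impI)
qed

text \<open>Tangent vectors depend on germs only, so the normalisation of \<open>d\<close> and the
  spanning property survive shrinking.\<close>

lemma coord_restr:
  assumes c: "coord x W z d" and W': "open W'" "x \<in> W'" "W' \<subseteq> W"
  shows "coord x W' (restr W' z) (restr W' d)"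
  unfolding coord_def
proof (intro conjI ballI allI impI; (elim conjE)?)
  show "local_coord A x W' (restr W' z)"
    using coord_local[OF c] W' hol_restr[OF coord_hol[OF c] W'(3)]
    by (auto simp: local_coord_def inj_on_def subset_iff)
  show "restr W' d \<in> hsec (tangent_bundle A) W'"
    by (rule tangent_hsec_restr[OF coord_field[OF c] W'(3)])
  have r: "v (restr W' z) = v z" if "y \<in> W'" "v \<in> tangent_space A y" for v y
    by (rule tangent_restr[OF that(2) coord_open[OF c] _ coord_hol[OF c] W'(1) that(1) W'(3)])
      (use that W' in auto)
  show "restr W' d y (restr W' z) = 1" if "y \<in> W'" for y
    using that W' r[OF that coord_vec[OF c]] coord_deriv[OF c] by auto
  show "v = v (restr W' z) *\<^sub>C restr W' d y" if "y \<in> W'" "v \<in> tangent_space A y" for y v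
    using that W' r[OF that] coord_span[OF c _ that(2)] by auto
  fix W'' f assume a: "open W''" "W'' \<subseteq> W'" "f \<in> holfun A W''" "x \<in> W'' \<longrightarrow> f x = 0"
  then obtain g where g: "g \<in> holfun A W''" "f = fmul z g"
    using coord_div[OF c a(1) _ a(3)] W' by auto
  have "f = fmul (restr W' z) g"
    using holfun_out[OF g(1)] a(2) unfolding g(2)
    by (intro ext) (auto simp: fmul_def restr_apply)
  then show "\<exists>g\<in>holfun A W''. f = fmul (restr W' z) g" using g by blast
qed

text \<open>The point that makes residues independent of the coordinate: two coordinates at x differ
  by a factor whose value at x is this derivative. In a chart z' is an injective holomorphic
  function, and such a function has no critical point.\<close>

lemma local_coord_deriv_nonzero:
  assumes c: "coord x W z d" and l: "local_coord A x W' z'"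
  shows "d x z' \<noteq> 0"
proof
  assume d0: "d x z' = 0"
  have l': "open W'" "x \<in> W'" "z' \<in> holfun A W'" "inj_on z' W'" "z' x = 0"
    using l by (auto simp: local_coord_def)
  define h where "h = restr (W \<inter> W') z'"
  have oW: "open (W \<inter> W')" "x \<in> W \<inter> W'" using coord_open[OF c] coord_mem[OF c] l' by auto
  have h: "h \<in> holfun A (W \<inter> W')" unfolding h_def by (rule hol_restr[OF l'(3)]) auto
  obtain U0 z0 where z0: "(U0, z0) \<in> A" "x \<in> U0" using chartE .
  have inv: "inv_into U0 z0 (z0 y) = y" if "y \<in> U0" for y using that chart_inv[OF z0(1)] by simp
  define T where "T = z0 ` (W \<inter> W' \<inter> U0)"
  have T: "open T" unfolding T_def
    by (rule chart_image_subset_open[OF z0(1)]) (use oW chart_open[OF z0(1)] in auto)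
  define H where "H = h \<circ> inv_into U0 z0"
  have "H holomorphic_on T" unfolding H_def T_def by (rule holfunD[OF h z0(1)])
  moreover have "inj_on H T"
  proof (rule inj_onI)
    fix p q assume "p \<in> T" "q \<in> T" and e: "H p = H q"
    then obtain p' q' where *: "p = z0 p'" "q = z0 q'" "p' \<in> W \<inter> W' \<inter> U0" "q' \<in> W \<inter> W' \<inter> U0"
      unfolding T_def by blast
    then have "z' p' = z' q'" using e by (simp add: H_def h_def inv)
    then show "p = q" using *(3,4) inj_onD[OF l'(4)] by (auto simp: *(1,2))
  qed
  ultimately have ne: "deriv H (z0 x) \<noteq> 0"
    using holomorphic_injective_imp_regular[OF _ T] oW z0(2) by (auto simp: T_def)
  \<comment> \<open>If the derivative vanished, then \<open>h\<close> would be divisible by \<open>z\<close> twice, against its injectivity.\<close>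
  obtain g where g: "g \<in> holfun A (W \<inter> W')" "h = fmul z g"
    using coord_div[OF c oW(1) _ h] l'(5) oW(2) by (auto simp: h_def)
  have dT: "d x \<in> tangent_space A x" by (rule coord_vec[OF c coord_mem[OF c]])
  have z'': "restr (W \<inter> W') z \<in> holfun A (W \<inter> W')" by (rule hol_restr[OF coord_hol[OF c]]) auto
  have hg: "h = fmul (restr (W \<inter> W') z) g"
    unfolding g(2) using holfun_out[OF g(1)] by (intro ext) (auto simp: fmul_def restr_apply)
  have "d x z' = d x h" unfolding h_def
    using tangent_restr[OF dT l'(1,2,3) oW] by simp
  \<comment> \<open>Leibniz rule for h = z g at x, where z vanishes and d takes the value 1 on
    z.\<close>
  also have "\<dots> = g x"
    unfolding hg using tangent_mult[OF dT oW z'' g(1)] coord_center[OF c]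
      tangent_restr[OF dT coord_open[OF c] coord_mem[OF c] coord_hol[OF c] oW]
      coord_deriv[OF c coord_mem[OF c]] oW(2) by simp
  finally have g0: "g x = 0" using d0 by simp
  obtain k where k: "k \<in> holfun A (W \<inter> W')" "g = fmul z k"
    using coord_div[OF c oW(1) _ g(1)] g0 by auto
  define Z where "Z = z \<circ> inv_into U0 z0"
  define K where "K = k \<circ> inv_into U0 z0"
  have Z: "Z holomorphic_on T" unfolding Z_def T_def
    by (rule holomorphic_on_subset[OF holfunD[OF coord_hol[OF c] z0(1)]]) auto
  have K: "K holomorphic_on T" unfolding K_def T_def by (rule holfunD[OF k(1) z0(1)])
  have xT: "z0 x \<in> T" using oW z0 by (auto simp: T_def)
  have "H = (\<lambda>q. Z q * (Z q * K q))"
    by (rule ext) (simp add: H_def Z_def K_def g(2) k(2) fmul_def)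
  moreover have Z0: "Z (z0 x) = 0" by (simp add: Z_def inv[OF z0(2)] coord_center[OF c])
  ultimately have "deriv H (z0 x) = 0"
    using Z K T xT by (simp add: deriv_mult holomorphic_on_imp_differentiable_at[of _ T] field_differentiable_mult)
  then show False using ne by simp
qed

end

section \<open>Bundles and frames\<close>

lemma subspaceD:
  assumes "complex_vector.subspace G"
  shows subspace_0: "0 \<in> G" and subspace_add: "u \<in> G \<Longrightarrow> v \<in> G \<Longrightarrow> u + v \<in> G"
    and subspace_scale: "u \<in> G \<Longrightarrow> c *\<^sub>C u \<in> G"
    and subspace_diff: "u \<in> G \<Longrightarrow> v \<in> G \<Longrightarrow> u - v \<in> G"
    and subspace_sum: "(\<And>i. i \<in> I \<Longrightarrow> g i \<in> G) \<Longrightarrow> sum g I \<in> G"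
  using assms
  by (auto intro: complex_vector.subspace_0 complex_vector.subspace_add complex_vector.subspace_scale
      complex_vector.subspace_diff complex_vector.subspace_sum)

lemma linear_mapsI:
  assumes "\<And>u. u \<in> F \<Longrightarrow> T u \<in> G" "\<And>u. u \<notin> F \<Longrightarrow> T u = 0"
    "\<And>u v. u \<in> F \<Longrightarrow> v \<in> F \<Longrightarrow> T (u + v) = T u + T v" "\<And>u c. u \<in> F \<Longrightarrow> T (c *\<^sub>C u) = c *\<^sub>C T u"
  shows "T \<in> linear_maps F G"
  using assms unfolding linear_maps_def by simp

lemma linear_mapsD:
  assumes "T \<in> linear_maps F G"
  shows linear_maps_mem: "u \<in> F \<Longrightarrow> T u \<in> G" and linear_maps_out: "u \<notin> F \<Longrightarrow> T u = 0"
    and linear_maps_add: "u \<in> F \<Longrightarrow> v \<in> F \<Longrightarrow> T (u + v) = T u + T v"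
    and linear_maps_scale: "u \<in> F \<Longrightarrow> T (c *\<^sub>C u) = c *\<^sub>C T u"
  using assms unfolding linear_maps_def by simp_all

lemma linear_maps_0:
  assumes "T \<in> linear_maps F G" shows "T 0 = 0"
proof (cases "0 \<in> F")
  case True
  then show ?thesis using linear_maps_scale[OF assms, of 0 0] by simp
qed (rule linear_maps_out[OF assms])

lemma linear_maps_sum:
  assumes T: "T \<in> linear_maps F G" and F: "complex_vector.subspace F" and v: "\<And>i. i \<in> I \<Longrightarrow> v i \<in> F"
  shows "T (\<Sum>i\<in>I. c i *\<^sub>C v i) = (\<Sum>i\<in>I. c i *\<^sub>C T (v i))"
  using v
proof (induction I rule: infinite_finite_induct)
  case (insert i I)
  then have "c i *\<^sub>C v i \<in> F" "(\<Sum>i\<in>I. c i *\<^sub>C v i) \<in> F"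
    by (auto intro!: subspace_sum[OF F] subspace_scale[OF F])
  then show ?case using insert by (simp add: linear_maps_add[OF T] linear_maps_scale[OF T])
qed (simp_all add: linear_maps_0[OF T])

lemma subspace_linear_maps:
  assumes "complex_vector.subspace G"
  shows "complex_vector.subspace (linear_maps F G)"
  unfolding complex_vector.subspace_def
  by (intro conjI ballI allI linear_mapsI)
    (auto simp: linear_maps_mem linear_maps_out linear_maps_add linear_maps_scale scaleC_add_right
      subspace_0[OF assms] intro!: subspace_add[OF assms] subspace_scale[OF assms] complex_vector.scale_left_commute)

section \<open>Bundles of homomorphisms and dual bundles\<close>

lemma fib_hom [simp]: "fib (hom_bundle V E) y = linear_maps (fib V y) (fib E y)"
  by (simp add: hom_bundle_def)

lemma fib_trivial [simp]: "fib (trivial_line A) y = UNIV"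
  by (simp add: trivial_line_def)

lemma hsec_trivial [simp]: "hsec (trivial_line A) = holfun A"
  by (simp add: trivial_line_def)

lemma fib_dual [simp]: "fib (dual_bundle A V) y = linear_maps (fib V y) UNIV"
  by (simp add: dual_bundle_def)

lemma hom_hsecI:
  assumes "\<And>y. y \<in> U \<Longrightarrow> T y \<in> linear_maps (fib V y) (fib E y)" "\<And>y. y \<notin> U \<Longrightarrow> T y = 0"
    "\<And>W s. open W \<Longrightarrow> W \<subseteq> U \<Longrightarrow> s \<in> hsec V W \<Longrightarrow> (\<lambda>y. T y (s y)) \<in> hsec E W"
  shows "T \<in> hsec (hom_bundle V E) U"
  using assms unfolding hom_bundle_def by simp

lemma hom_hsecD:
  assumes "T \<in> hsec (hom_bundle V E) U"
  shows hom_hsec_lin: "y \<in> U \<Longrightarrow> T y \<in> linear_maps (fib V y) (fib E y)"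
    and hom_hsec_out: "y \<notin> U \<Longrightarrow> T y = 0"
    and hom_hsec_app: "s \<in> hsec V W \<Longrightarrow> open W \<Longrightarrow> W \<subseteq> U \<Longrightarrow> (\<lambda>y. T y (s y)) \<in> hsec E W"
  using assms unfolding hom_bundle_def by simp_all

lemma dual_hsecI:
  assumes "\<And>y. y \<in> U \<Longrightarrow> T y \<in> linear_maps (fib V y) UNIV" "\<And>y. y \<notin> U \<Longrightarrow> T y = 0"
    "\<And>W s. open W \<Longrightarrow> W \<subseteq> U \<Longrightarrow> s \<in> hsec V W \<Longrightarrow> (\<lambda>y. T y (s y)) \<in> holfun A W"
  shows "T \<in> hsec (dual_bundle A V) U"
  unfolding dual_bundle_def by (rule hom_hsecI) (use assms in simp_all)

lemma dual_hsecD: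
  assumes "T \<in> hsec (dual_bundle A V) U"
  shows dual_hsec_lin: "y \<in> U \<Longrightarrow> T y \<in> linear_maps (fib V y) UNIV"
    and dual_hsec_out: "y \<notin> U \<Longrightarrow> T y = 0"
    and dual_hsec_app: "s \<in> hsec V W \<Longrightarrow> open W \<Longrightarrow> W \<subseteq> U \<Longrightarrow> (\<lambda>y. T y (s y)) \<in> holfun A W"
  using hom_hsecD[OF assms[unfolded dual_bundle_def]] by simp_all

text \<open>Of the source V only restriction of sections and vanishing outside the domain are
  required, not \<open>holomorphic_bundle\<close>. In this form the lemma also applies to the
  tangent bundle, whose sections are described directly by derivations.\<close>

lemma fsheaf_hom:
  assumes V: "\<And>U W s. s \<in> hsec V U \<Longrightarrow> open U \<Longrightarrow> open W \<Longrightarrow> W \<subseteq> U \<Longrightarrow> restr W s \<in> hsec V W"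
    and E: "fsheaf A (hsec E)" and sub: "\<And>y. complex_vector.subspace (fib E y)"
    and rh: "\<And>f U W. f \<in> holfun A U \<Longrightarrow> W \<subseteq> U \<Longrightarrow> restr W f \<in> holfun A W"
    and Vout: "\<And>U s y. s \<in> hsec V U \<Longrightarrow> open U \<Longrightarrow> y \<notin> U \<Longrightarrow> s y = 0"
  shows "fsheaf A (hsec (hom_bundle V E))"
proof (rule fsheafI)
  note subL = subspace_linear_maps[OF sub]
  fix U :: "'a set" assume U: "open U"
  show "0 \<in> hsec (hom_bundle V E) U"
  proof (rule hom_hsecI)
    show "(\<lambda>y. (0 :: 'a \<Rightarrow> 'b \<Rightarrow> 'c) y (s y)) \<in> hsec E W" if "open W" for W s
      using fsheaf_0[OF E that] by (simp add: zero_fun_def)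
  qed (simp_all add: subspace_0[OF subL])
  fix T assume T: "T \<in> hsec (hom_bundle V E) U"
  show "T y = 0" if "y \<notin> U" for y using hom_hsec_out[OF T that] .
  show "T - T' \<in> hsec (hom_bundle V E) U" if T': "T' \<in> hsec (hom_bundle V E) U" for T'
  proof (rule hom_hsecI)
    show "(\<lambda>y. (T - T') y (s y)) \<in> hsec E W" if "open W" "W \<subseteq> U" "s \<in> hsec V W" for W s
      using fsheaf_diff[OF E that(1) hom_hsec_app[OF T that(3,1,2)] hom_hsec_app[OF T' that(3,1,2)]]
      by (simp add: fun_diff_def)
  qed (auto simp: hom_hsec_out[OF T] hom_hsec_out[OF T'] intro!: subspace_diff[OF subL] hom_hsec_lin[OF T]
      hom_hsec_lin[OF T'])
  show "fmul f T \<in> hsec (hom_bundle V E) U" if f: "f \<in> holfun A U" for f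
  proof (rule hom_hsecI)
    show "(\<lambda>y. fmul f T y (s y)) \<in> hsec E W" if W: "open W" "W \<subseteq> U" "s \<in> hsec V W" for W s
    proof -
      have "(\<lambda>y. fmul f T y (s y)) = fmul (restr W f) (\<lambda>y. T y (s y))"
        using fsheaf_out[OF E hom_hsec_app[OF T W(3,1,2)] W(1)]
        by (intro ext) (auto simp: fmul_def restr_apply)
      then show ?thesis
        using fsheaf_fmul[OF E W(1) rh[OF f W(2)] hom_hsec_app[OF T W(3,1,2)]] by simp
    qed
  qed (auto simp: hom_hsec_out[OF T] fmul_def intro!: subspace_scale[OF subL] hom_hsec_lin[OF T])
  show "restr W T \<in> hsec (hom_bundle V E) W" if W: "open W" "W \<subseteq> U" for W
  proof (rule hom_hsecI)
    show "(\<lambda>y. restr W T y (s y)) \<in> hsec E W'" if W': "open W'" "W' \<subseteq> W" "s \<in> hsec V W'" for W' s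
    proof -
      have "(\<lambda>y. restr W T y (s y)) = (\<lambda>y. T y (s y))"
      proof
        fix y show "restr W T y (s y) = T y (s y)"
          using fsheaf_out[OF E hom_hsec_app[OF T W'(3,1)] W'(1), of y] W W'(2)
          by (cases "y \<in> W") auto
      qed
      then show ?thesis using hom_hsec_app[OF T W'(3,1)] W W' by auto
    qed
  qed (use W hom_hsec_lin[OF T] in auto)
next
  fix U :: "'a set" and T assume U: "open U" and out: "\<And>y. y \<notin> U \<Longrightarrow> T y = 0"
    and loc: "\<And>x. x \<in> U \<Longrightarrow> \<exists>W. open W \<and> x \<in> W \<and> W \<subseteq> U \<and> restr W T \<in> hsec (hom_bundle V E) W"
  show "T \<in> hsec (hom_bundle V E) U"
  proof (rule hom_hsecI)
    show lin: "T y \<in> linear_maps (fib V y) (fib E y)" if "y \<in> U" for y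
    proof -
      from loc[OF that] obtain W where W: "y \<in> W" "restr W T \<in> hsec (hom_bundle V E) W" by blast
      show ?thesis using hom_hsec_lin[OF W(2,1)] W(1) by simp
    qed
    show "T y = 0" if "y \<notin> U" for y using out that .
    fix W s assume W: "open W" "W \<subseteq> U" and s: "s \<in> hsec V W"
    show "(\<lambda>y. T y (s y)) \<in> hsec E W"
    proof (rule fsheaf_local[OF E W(1)])
      show "T y (s y) = 0" if "y \<notin> W" for y
        using that Vout[OF s W(1) that] linear_maps_0[OF lin, of y] out[of y] by (cases "y \<in> U") auto
      fix x assume "x \<in> W"
      then obtain W1 where W1: "open W1" "x \<in> W1" "W1 \<subseteq> U" "restr W1 T \<in> hsec (hom_bundle V E) W1"
        using loc W by blast
      let ?W = "W \<inter> W1"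
      have o: "open ?W" using W W1 by auto
      \<comment> \<open>Outside \<open>?W\<close> the right-hand side is 0 because the maps T y send
        0 to 0.\<close>
      have "restr ?W (\<lambda>y. T y (s y)) = (\<lambda>y. restr W1 T y (restr ?W s y))"
      proof
        fix y show "restr ?W (\<lambda>y. T y (s y)) y = restr W1 T y (restr ?W s y)"
          using linear_maps_0[OF lin, of y] W1(3) by (auto simp: restr_apply)
      qed
      then have "restr ?W (\<lambda>y. T y (s y)) \<in> hsec E ?W"
        using hom_hsec_app[OF W1(4) V[OF s W(1) o] o] by simp
      then show "\<exists>W'. open W' \<and> x \<in> W' \<and> W' \<subseteq> W \<and> restr W' (\<lambda>y. T y (s y)) \<in> hsec E W'"
        using o \<open>x \<in> W\<close> W1 by (intro exI[of _ ?W]) auto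
    qed
  qed
qed

text \<open>A frame together with its dual frame. The index set is an arbitrary finite set, so that
  a frame adapted to a filtration can be indexed by vectors of a fibre.\<close>

definition coframe :: "'x::t2_space chart set \<Rightarrow> ('x, 'b::complex_vector) vbundle \<Rightarrow> 'x set \<Rightarrow>
    'i set \<Rightarrow> ('i \<Rightarrow> 'x \<Rightarrow> 'b) \<Rightarrow> ('i \<Rightarrow> 'x \<Rightarrow> 'b \<Rightarrow> complex) \<Rightarrow> bool" where
  "coframe A E U I e \<kappa> \<longleftrightarrow> open U \<and> finite I \<and> (\<forall>i\<in>I. e i \<in> hsec E U) \<and>
     (\<forall>i\<in>I. \<kappa> i \<in> hsec (dual_bundle A E) U) \<and>
     (\<forall>y\<in>U. \<forall>i\<in>I. \<forall>j\<in>I. \<kappa> i y (e j y) = of_bool (i = j)) \<and>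
     (\<forall>y\<in>U. \<forall>v\<in>fib E y. v = (\<Sum>i\<in>I. \<kappa> i y v *\<^sub>C e i y))"

lemma coframeD:
  assumes "coframe A E U I e \<kappa>"
  shows coframe_open: "open U" and coframe_finite: "finite I"
    and coframe_sec: "\<And>i. i \<in> I \<Longrightarrow> e i \<in> hsec E U"
    and coframe_dual: "\<And>i. i \<in> I \<Longrightarrow> \<kappa> i \<in> hsec (dual_bundle A E) U"
    and coframe_delta: "\<And>y i j. y \<in> U \<Longrightarrow> i \<in> I \<Longrightarrow> j \<in> I \<Longrightarrow> \<kappa> i y (e j y) = of_bool (i = j)"
    and coframe_expand: "\<And>y v. y \<in> U \<Longrightarrow> v \<in> fib E y \<Longrightarrow> v = (\<Sum>i\<in>I. \<kappa> i y v *\<^sub>C e i y)"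
  using assms unfolding coframe_def by blast+

section \<open>Holomorphic bundles through frames and dual frames\<close>

locale hol_bundle = riemann A for A :: "'x::t2_space chart set" +
  fixes E :: "('x, 'b::complex_vector) vbundle"
  assumes is_bundle: "holomorphic_bundle A E"
begin

lemma fsheaf: "fsheaf A (hsec E)"
  using is_bundle is_omod_fsheaf unfolding holomorphic_bundle_def by blast

lemma frameE:
  obtains U r e where "x \<in> U" "local_frame A E U r e"
  using is_bundle unfolding holomorphic_bundle_def by blast

lemma frame_fib:
  assumes "local_frame A E U r e" "y \<in> U"
  shows "v \<in> fib E y \<longleftrightarrow> (\<exists>c. v = (\<Sum>i<r. c i *\<^sub>C e i y))"
proof -
  have "bij_betw (\<lambda>c. \<Sum>i<r. c i *\<^sub>C e i y) ({..<r} \<rightarrow>\<^sub>E UNIV) (fib E y)"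
    using assms unfolding local_frame_def by blast
  then have fib: "fib E y = (\<lambda>c. \<Sum>i<r. c i *\<^sub>C e i y) ` ({..<r} \<rightarrow>\<^sub>E UNIV)"
    by (simp add: bij_betw_def)
  have "v \<in> fib E y" if "v = (\<Sum>i<r. c i *\<^sub>C e i y)" for c
    unfolding fib that by (rule image_eqI[of _ _ "restrict c {..<r}"]) auto
  then show ?thesis unfolding fib by auto
qed

lemma fib_subspace: "complex_vector.subspace (fib E y)"
proof -
  obtain U r e where f: "y \<in> U" "local_frame A E U r e" using frameE .
  note fib = frame_fib[OF f(2,1)]
  show ?thesis unfolding complex_vector.subspace_def
  proof (intro conjI ballI allI)
    show "0 \<in> fib E y" unfolding fib by (rule exI[of _ "\<lambda>_. 0"]) simp
    fix u v k assume "u \<in> fib E y"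
    then obtain a where a: "u = (\<Sum>i<r. a i *\<^sub>C e i y)" unfolding fib by blast
    show "k *\<^sub>C u \<in> fib E y" unfolding fib a
      by (rule exI[of _ "\<lambda>i. k * a i"]) (simp add: scaleC_sum_right)
    assume "v \<in> fib E y"
    then obtain b where b: "v = (\<Sum>i<r. b i *\<^sub>C e i y)" unfolding fib by blast
    show "u + v \<in> fib E y" unfolding fib a b
      by (rule exI[of _ "\<lambda>i. a i + b i"]) (simp add: scaleC_add_left sum.distrib)
  qed
qed

text \<open>\<open>holomorphic_bundle\<close> relates sections to fibres only through local frames,
  so membership of the values is read off from an expansion near y.\<close>

lemma hsec_fib:
  assumes s: "s \<in> hsec E W" "open W" and y: "y \<in> W"
  shows "s y \<in> fib E y"
proof -
  obtain U r e where f: "y \<in> U" "local_frame A E U r e" using frameE .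
  have U: "open U" using f(2) by (simp add: local_frame_def)
  have r: "restr (U \<inter> W) s \<in> hsec E (U \<inter> W)" using fsheaf_restr[OF fsheaf s] U s by auto
  have "hsec E (U \<inter> W) = {s. \<exists>c. (\<forall>i<r. c i \<in> holfun A (U \<inter> W)) \<and> s = (\<lambda>y. \<Sum>i<r. c i y *\<^sub>C e i y)}"
    using f(2) U s(2) unfolding local_frame_def by blast
  with r obtain c where c: "restr (U \<inter> W) s = (\<lambda>y. \<Sum>i<r. c i y *\<^sub>C e i y)" by blast
  have "s y = restr (U \<inter> W) s y" using f y by simp
  then have "s y = (\<Sum>i<r. c i y *\<^sub>C e i y)" using c by simp
  then show ?thesis unfolding frame_fib[OF f(2,1)] by (rule exI[of _ "\<lambda>i. c i y"])
qed

text \<open>The dual frame consists of the coefficient functions of a local frame. They are linear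
  by uniqueness of coefficients, and holomorphic because sections over open subsets of U are exactly
  the combinations with holomorphic coefficients.\<close>

lemma coframe_exists: "\<exists>U r e \<kappa>. x \<in> U \<and> coframe A E U {..<r::nat} e \<kappa>"
proof -
  obtain U r e where f: "x \<in> U" "local_frame A E U r e" using frameE .
  note F = f(2)[unfolded local_frame_def]
  have U: "open U" and es: "\<And>i. i < r \<Longrightarrow> e i \<in> hsec E U" using F by auto
  define \<Psi> where "\<Psi> y = (\<lambda>c. \<Sum>i<r. c i *\<^sub>C e i y)" for y
  have bij: "bij_betw (\<Psi> y) ({..<r} \<rightarrow>\<^sub>E UNIV) (fib E y)" if "y \<in> U" for y
    using F that unfolding \<Psi>_def by blast
  \<comment> \<open>The value 0 off U and off the fibre follows the conventions for sections and for
    \<open>linear_maps\<close>.\<close>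
  define \<kappa> where "\<kappa> i y v = (if y \<in> U \<and> v \<in> fib E y then inv_into ({..<r} \<rightarrow>\<^sub>E UNIV) (\<Psi> y) v i else 0)"
    for i y v
  have eq: "\<kappa> i y (\<Sum>i<r. c i *\<^sub>C e i y) = c i" if y: "y \<in> U" and i: "i < r" for i y c
  proof -
    have 1: "(\<Sum>i<r. c i *\<^sub>C e i y) = \<Psi> y (restrict c {..<r})" by (simp add: \<Psi>_def)
    have "inv_into ({..<r} \<rightarrow>\<^sub>E UNIV) (\<Psi> y) (\<Psi> y (restrict c {..<r})) = restrict c {..<r}"
      using bij[OF y] by (intro inv_into_f_f) (auto simp: bij_betw_def)
    moreover have "(\<Sum>i<r. c i *\<^sub>C e i y) \<in> fib E y" unfolding frame_fib[OF f(2) y] by blast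
    ultimately show ?thesis using y i by (simp add: \<kappa>_def 1)
  qed
  have ex: "v = (\<Sum>i<r. \<kappa> i y v *\<^sub>C e i y)" if y: "y \<in> U" and v: "v \<in> fib E y" for y v
  proof -
    obtain c where c: "v = (\<Sum>i<r. c i *\<^sub>C e i y)" using v unfolding frame_fib[OF f(2) y] by blast
    show ?thesis unfolding c using eq[OF y] by (intro sum.cong) auto
  qed
  have lin: "\<kappa> i y \<in> linear_maps (fib E y) UNIV" if y: "y \<in> U" and i: "i < r" for i y
  proof (rule linear_mapsI)
    fix u v c assume u: "u \<in> fib E y"
    have "c *\<^sub>C u = (\<Sum>i<r. (c * \<kappa> i y u) *\<^sub>C e i y)"
      by (subst ex[OF y u]) (simp add: scaleC_sum_right)
    then show "\<kappa> i y (c *\<^sub>C u) = c *\<^sub>C \<kappa> i y u" using eq[OF y i, of "\<lambda>i. c * \<kappa> i y u"] by simp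
    assume v: "v \<in> fib E y"
    have "u + v = (\<Sum>i<r. (\<kappa> i y u + \<kappa> i y v) *\<^sub>C e i y)"
      by (subst ex[OF y u], subst ex[OF y v]) (simp add: scaleC_add_left sum.distrib)
    then show "\<kappa> i y (u + v) = \<kappa> i y u + \<kappa> i y v" using eq[OF y i, of "\<lambda>i. \<kappa> i y u + \<kappa> i y v"] by simp
  qed (simp_all add: \<kappa>_def)
  have dual: "\<kappa> i \<in> hsec (dual_bundle A E) U" if i: "i < r" for i
  proof (rule dual_hsecI)
    show "\<kappa> i y = 0" if "y \<notin> U" for y using that by (auto simp: \<kappa>_def)
    fix W s assume W: "open W" "W \<subseteq> U" and s: "s \<in> hsec E W"
    obtain c where c: "\<forall>i<r. c i \<in> holfun A W" "s = (\<lambda>y. \<Sum>i<r. c i y *\<^sub>C e i y)"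
      using F W s by blast
    have "(\<lambda>y. \<kappa> i y (s y)) = c i"
    proof
      fix y show "\<kappa> i y (s y) = c i y"
      proof (cases "y \<in> W")
        case True then show ?thesis using eq[OF _ i, of y "\<lambda>i. c i y"] W by (auto simp: c(2))
      next
        case False
        then have "s y = 0" using fsheaf_out[OF fsheaf s W(1)] by blast
        moreover have "\<kappa> i y 0 = 0" using linear_maps_0[OF lin[OF _ i], of y] by (cases "y \<in> U") (auto simp: \<kappa>_def)
        ultimately show ?thesis using False c(1) i holfun_out by auto
      qed
    qed
    then show "(\<lambda>y. \<kappa> i y (s y)) \<in> holfun A W" using c(1) i by simp
  qed (rule lin[OF _ i])
  have "coframe A E U {..<r} e \<kappa>"
    unfolding coframe_def
  proof (intro conjI ballI)
    show "\<kappa> i y (e j y) = of_bool (i = j)" if "y \<in> U" "i \<in> {..<r}" "j \<in> {..<r}" for y i j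
    proof -
      have "e j y = (\<Sum>k<r. of_bool (k = j) *\<^sub>C e k y)"
        using that(3) by (simp add: if_distrib[of "\<lambda>c. c *\<^sub>C _"] of_bool_def cong: if_cong)
      then show ?thesis using eq[OF that(1), of i "\<lambda>k. of_bool (k = j)"] that(2) by simp
    qed
  qed (use U es dual ex in auto)
  then show ?thesis using f(1) by blast
qed

context
  fixes U and I :: "'i set" and e \<kappa>
  assumes cf: "coframe A E U I e \<kappa>"
begin

lemma coframe_fib: "y \<in> U \<Longrightarrow> i \<in> I \<Longrightarrow> e i y \<in> fib E y"
  using hsec_fib coframe_sec[OF cf] coframe_open[OF cf] by blast

lemma coframe_lin: "y \<in> U \<Longrightarrow> i \<in> I \<Longrightarrow> \<kappa> i y \<in> linear_maps (fib E y) UNIV"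
  using dual_hsec_lin[OF coframe_dual[OF cf]] by blast

lemma coframe_coord: "y \<in> U \<Longrightarrow> i \<in> I \<Longrightarrow> \<kappa> i y (\<Sum>j\<in>I. c j *\<^sub>C e j y) = c i"
  by (subst linear_maps_sum[OF coframe_lin fib_subspace])
    (auto simp: coframe_fib coframe_delta[OF cf] coframe_finite[OF cf] sum.delta of_bool_def
      if_distrib[of "\<lambda>x. _ * x"] cong: if_cong)

lemma coframe_lincomb:
  assumes W: "open W" "W \<subseteq> U" and c: "\<And>i. i \<in> I \<Longrightarrow> c i \<in> holfun A W"
  shows "(\<lambda>y. \<Sum>i\<in>I. c i y *\<^sub>C e i y) \<in> hsec E W"
proof -
  have "(\<lambda>y. \<Sum>i\<in>I. c i y *\<^sub>C e i y) = (\<lambda>y. \<Sum>i\<in>I. c i y *\<^sub>C restr W (e i) y)"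
    using holfun_out[OF c] by (intro ext sum.cong) (auto simp: restr_apply)
  also have "\<dots> \<in> hsec E W"
    by (rule fsheaf_lincomb[OF fsheaf W(1) c])
      (use fsheaf_restr[OF fsheaf coframe_sec[OF cf] coframe_open[OF cf] W] in auto)
  finally show ?thesis .
qed

lemma coframe_expand_sec:
  assumes W: "open W" "W \<subseteq> U" and s: "s \<in> hsec E W"
  shows "s = (\<lambda>y. \<Sum>i\<in>I. \<kappa> i y (s y) *\<^sub>C e i y)"
proof
  fix y show "s y = (\<Sum>i\<in>I. \<kappa> i y (s y) *\<^sub>C e i y)"
  proof (cases "y \<in> W")
    case True then show ?thesis using coframe_expand[OF cf] hsec_fib[OF s W(1)] W(2) by blast
  next
    case False
    have "\<kappa> i y 0 = 0" if "i \<in> I" for i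
      using linear_maps_0[OF coframe_lin[OF _ that], of y] dual_hsec_out[OF coframe_dual[OF cf that], of y]
      by (cases "y \<in> U") auto
    then show ?thesis using fsheaf_out[OF fsheaf s W(1) False] by simp
  qed
qed

lemma coframe_restr:
  assumes W: "open W" "W \<subseteq> U"
  shows "coframe A E W I (\<lambda>i. restr W (e i)) (\<lambda>i. restr W (\<kappa> i))"
  unfolding coframe_def
proof (intro conjI ballI)
  show "restr W (e i) \<in> hsec E W" if "i \<in> I" for i
    by (rule fsheaf_restr[OF fsheaf coframe_sec[OF cf that] coframe_open[OF cf] W])
  show "restr W (\<kappa> i) \<in> hsec (dual_bundle A E) W" if i: "i \<in> I" for i
  proof (rule dual_hsecI)
    fix W' s assume W': "open W'" "W' \<subseteq> W" and s: "s \<in> hsec E W'"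
    have k: "\<kappa> i y 0 = 0" if "y \<in> U" for y
      using linear_maps_0[OF coframe_lin[OF that i]] .
    have "(\<lambda>y. restr W (\<kappa> i) y (s y)) = (\<lambda>y. \<kappa> i y (s y))"
    proof
      fix y show "restr W (\<kappa> i) y (s y) = \<kappa> i y (s y)"
        using k[of y] fsheaf_out[OF fsheaf s W'(1), of y] subsetD[OF W'(2), of y] subsetD[OF W(2), of y]
          dual_hsec_out[OF coframe_dual[OF cf i], of y]
        by (cases "y \<in> W"; cases "y \<in> U"; cases "y \<in> W'") auto
    qed
    then show "(\<lambda>y. restr W (\<kappa> i) y (s y)) \<in> holfun A W'"
      using dual_hsec_app[OF coframe_dual[OF cf i] s W'(1)] W W' by auto
  qed (use coframe_lin[OF _ i] W in auto)
  show "v = (\<Sum>i\<in>I. restr W (\<kappa> i) y v *\<^sub>C restr W (e i) y)" if "y \<in> W" "v \<in> fib E y" for y v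
    using coframe_expand[OF cf _ that(2)] that(1) W(2) by auto
qed (use W coframe_delta[OF cf] coframe_finite[OF cf] in auto)

text \<open>A constant change of frame: the matrix m expressing the vectors of B in the frame at x,
  and its inverse n, are used at every point of U. Constant entries keep everything holomorphic on
  all of U, and at x the new frame consists of the vectors of B themselves.\<close>

lemma coframe_recenter:
  assumes x: "x \<in> U" and B: "finite B" "complex_vector.independent B" "complex_vector.span B = fib E x"
  shows "\<exists>e' \<kappa>'. coframe A E U B e' \<kappa>' \<and> (\<forall>b\<in>B. e' b x = b)"
proof -
  define m where "m b k = \<kappa> k x b" for b k
  define n where "n k b = complex_vector.representation B (e k x) b" for k b
  note U = coframe_open[OF cf] and I = coframe_finite[OF cf]
  have bm: "b = (\<Sum>k\<in>I. m b k *\<^sub>C e k x)" if "b \<in> B" for b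
    unfolding m_def by (rule coframe_expand[OF cf x]) (use B(3) that complex_vector.span_base in blast)
  have en: "e k x = (\<Sum>b\<in>B. n k b *\<^sub>C b)" if "k \<in> I" for k
    unfolding n_def using complex_vector.sum_representation_eq[OF B(2) _ B(1) order_refl, of "e k x"]
      coframe_fib[OF x that] B(3) by simp
  \<comment> \<open>Both products of m and n are needed: this one gives duality of the new frames,
    the other one the expansion of vectors.\<close>
  have mn: "(\<Sum>k\<in>I. m b k * n k b') = of_bool (b = b')" if b: "b \<in> B" "b' \<in> B" for b b'
  proof -
    have "complex_vector.representation B (\<Sum>k\<in>I. m b k *\<^sub>C e k x) = (\<lambda>b'. \<Sum>k\<in>I. m b k * n k b')"
      using coframe_fib[OF x] B(3) fib_subspace[of x]
      by (subst complex_vector.representation_sum[OF B(2)])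
        (auto simp: complex_vector.representation_scale[OF B(2)] n_def intro!: subspace_scale)
    then have "complex_vector.representation B b = (\<lambda>b'. \<Sum>k\<in>I. m b k * n k b')"
      using bm[OF b(1)] by simp
    then show ?thesis using fun_cong[OF complex_vector.representation_basis[OF B(2) b(1)], of b'] by simp
  qed
  have nm: "(\<Sum>b\<in>B. n k b * m b k') = of_bool (k = k')" if k: "k \<in> I" "k' \<in> I" for k k'
  proof -
    have "(\<Sum>b\<in>B. n k b * m b k') = \<kappa> k' x (\<Sum>b\<in>B. n k b *\<^sub>C b)"
      by (subst linear_maps_sum[OF coframe_lin[OF x k(2)] fib_subspace])
        (use B(3) complex_vector.span_base in \<open>auto simp: m_def\<close>)
    also have "\<dots> = of_bool (k = k')" using coframe_delta[OF cf x k(2,1)] en[OF k(1)] by auto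
    finally show ?thesis .
  qed
  define e' where "e' b = (\<lambda>y. \<Sum>k\<in>I. m b k *\<^sub>C e k y)" for b
  define \<kappa>' where "\<kappa>' b = (\<lambda>y v. \<Sum>k\<in>I. n k b * \<kappa> k y v)" for b
  have "coframe A E U B e' \<kappa>'"
    unfolding coframe_def
  proof (intro conjI ballI)
    show "e' b \<in> hsec E U" if "b \<in> B" for b
    proof -
      have "e' b = (\<lambda>y. \<Sum>k\<in>I. restr U (\<lambda>_. m b k) y *\<^sub>C e k y)"
        using fsheaf_out[OF fsheaf coframe_sec[OF cf] U]
        by (intro ext) (auto simp: e'_def restr_apply intro!: sum.cong)
      then show ?thesis using coframe_lincomb[OF U order_refl hol_const] by simp
    qed
    show "\<kappa>' b \<in> hsec (dual_bundle A E) U" if "b \<in> B" for b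
    proof (rule dual_hsecI)
      show "\<kappa>' b y \<in> linear_maps (fib E y) UNIV" if y: "y \<in> U" for y
      proof -
        have "\<kappa>' b y = (\<Sum>k\<in>I. n k b *\<^sub>C \<kappa> k y)" by (rule ext) (simp add: \<kappa>'_def fun_sum_apply)
        then show ?thesis
          using coframe_lin[OF y] by (auto intro!: subspace_sum subspace_scale subspace_linear_maps)
      qed
      show "\<kappa>' b y = 0" if "y \<notin> U" for y
        using dual_hsec_out[OF coframe_dual[OF cf] that] by (auto simp: \<kappa>'_def)
      fix W s assume W: "open W" "W \<subseteq> U" and s: "s \<in> hsec E W"
      have "(\<lambda>y. \<kappa>' b y (s y)) = (\<lambda>y. \<Sum>k\<in>I. restr W (\<lambda>_. n k b) y *\<^sub>C \<kappa> k y (s y))"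
      proof
        fix y
        have "\<kappa> k y (s y) = 0" if "y \<notin> W" "k \<in> I" for k
          using holfun_out[OF dual_hsec_app[OF coframe_dual[OF cf that(2)] s W] that(1)] .
        then show "\<kappa>' b y (s y) = (\<Sum>k\<in>I. restr W (\<lambda>_. n k b) y *\<^sub>C \<kappa> k y (s y))"
          by (auto simp: \<kappa>'_def restr_apply intro!: sum.cong)
      qed
      also have "\<dots> \<in> holfun A W"
        by (rule fsheaf_lincomb[OF fsheaf_holfun W(1) hol_const])
          (rule dual_hsec_app[OF coframe_dual[OF cf] s W])
      finally show "(\<lambda>y. \<kappa>' b y (s y)) \<in> holfun A W" .
    qed
    show "\<kappa>' b y (e' b' y) = of_bool (b = b')" if "y \<in> U" "b \<in> B" "b' \<in> B" for y b b'
      using mn[OF that(3,2)] coframe_coord[OF that(1)]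
      by (simp add: \<kappa>'_def e'_def mult.commute)
    fix y v assume y: "y \<in> U" and v: "v \<in> fib E y"
    have "(\<Sum>b\<in>B. \<kappa>' b y v *\<^sub>C e' b y) =
      (\<Sum>b\<in>B. \<Sum>k'\<in>I. \<Sum>k\<in>I. (\<kappa> k y v * (n k b * m b k')) *\<^sub>C e k' y)"
      by (simp add: \<kappa>'_def e'_def scaleC_sum_right scaleC_sum_left sum_distrib_left mult_ac)
    also have "\<dots> = (\<Sum>k'\<in>I. \<Sum>k\<in>I. \<Sum>b\<in>B. (\<kappa> k y v * (n k b * m b k')) *\<^sub>C e k' y)"
      by (subst sum.swap) (intro sum.cong refl sum.swap)
    also have "\<dots> = (\<Sum>k'\<in>I. \<Sum>k\<in>I. (\<kappa> k y v * of_bool (k = k')) *\<^sub>C e k' y)"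
      by (intro sum.cong refl) (simp add: scaleC_sum_left[symmetric] sum_distrib_left[symmetric] nm)
    also have "\<dots> = (\<Sum>k'\<in>I. \<kappa> k' y v *\<^sub>C e k' y)"
      using I by (intro sum.cong refl)
        (simp add: scaleC_sum_left[symmetric] of_bool_def if_distrib[of "\<lambda>x. _ * x"] cong: if_cong)
    also have "\<dots> = v" using coframe_expand[OF cf y v] by simp
    finally show "v = (\<Sum>b\<in>B. \<kappa>' b y v *\<^sub>C e' b y)" ..
  qed (use U B(1) in auto)
  moreover have "\<forall>b\<in>B. e' b x = b" using bm by (simp add: e'_def)
  ultimately show ?thesis by blast
qed

end

text \<open>Freezing the frame coefficients of v at x gives a local section with this value. It is
  the device by which conditions on sheaves of sections become conditions on fibres.\<close>

lemma section_through:
  assumes "open N" "x \<in> N" "v \<in> fib E x"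
  obtains N' s where "s \<in> hsec E N'" "open N'" "x \<in> N'" "N' \<subseteq> N" "s x = v"
proof -
  obtain U r e \<kappa> where f: "x \<in> U" "coframe A E U {..<r::nat} e \<kappa>" using coframe_exists[of x] by blast
  let ?N = "U \<inter> N"
  have N: "open ?N" "?N \<subseteq> U" using coframe_open[OF f(2)] assms by auto
  let ?s = "\<lambda>y. \<Sum>i<r. restr ?N (\<lambda>_. \<kappa> i x v) y *\<^sub>C e i y"
  have "?s \<in> hsec E ?N" by (rule coframe_lincomb[OF f(2) N hol_const])
  moreover have "?s x = v" using coframe_expand[OF f(2,1) assms(3)] f(1) assms(2) by simp
  ultimately show thesis using that[of ?s ?N] N f(1) assms(2) by auto
qed

lemma fsheaf_dual: "fsheaf A (hsec (dual_bundle A E))"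
  unfolding dual_bundle_def
  by (rule fsheaf_hom) (auto simp: fsheaf_holfun hol_restr complex_vector.subspace_UNIV
      fsheaf_out[OF fsheaf] fsheaf_restr[OF fsheaf])

text \<open>Pairing with a local section through a given vector reduces the claim to holomorphic
  functions that agree off a finite set. This is what makes the logarithmic extension
  unique.\<close>

lemma dual_eq_off_finite:
  assumes s: "\<sigma> \<in> hsec (dual_bundle A E) U" and t: "\<tau> \<in> hsec (dual_bundle A E) U" and U: "open U"
    and S: "finite S" and eq: "\<And>y. y \<in> U - S \<Longrightarrow> \<sigma> y = \<tau> y"
  shows "\<sigma> = \<tau>"
proof (intro ext)
  fix y v show "\<sigma> y v = \<tau> y v"
  proof (cases "y \<in> U \<and> v \<in> fib E y")
    case True
    then obtain N u where u: "u \<in> hsec E N" "open N" "y \<in> N" "N \<subseteq> U" "u y = v"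
      using section_through[OF U] by blast
    have "(\<lambda>y. \<sigma> y (u y)) = (\<lambda>y. \<tau> y (u y))"
      by (rule hol_eq_off_finite[OF dual_hsec_app[OF s u(1,2,4)] dual_hsec_app[OF t u(1,2,4)] u(2) S])
        (use eq u(4) in auto)
    then show ?thesis using u(5) by metis
  next
    case False
    then show ?thesis
      using dual_hsec_out[OF s, of y] dual_hsec_out[OF t, of y] linear_maps_out[OF dual_hsec_lin[OF s, of y], of v]
        linear_maps_out[OF dual_hsec_lin[OF t, of y], of v] by (cases "y \<in> U") auto
  qed
qed

end

section \<open>Residues and the logarithmic extension of the dual anchor\<close>

lemma finite_open_Diff: "open U \<Longrightarrow> finite S \<Longrightarrow> open (U - S :: 'a::t1_space set)"
  by (simp add: open_Diff finite_imp_closed)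

lemma some_eq_spec: "c = (SOME x. P x) \<Longrightarrow> P x \<Longrightarrow> P c"
  by (simp add: someI)

section \<open>Cotangent sections, logarithmic forms and residues\<close>

context riemann
begin

lemma fib_cotangent [simp]: "fib (cotangent_bundle A) y = linear_maps (tangent_space A y) UNIV"
  by (simp add: cotangent_bundle_def)

lemma fsheaf_cotangent: "fsheaf A (hsec (cotangent_bundle A))"
  unfolding cotangent_bundle_def dual_bundle_def
  by (rule fsheaf_hom) (auto simp: fsheaf_holfun hol_restr complex_vector.subspace_UNIV
      tangent_hsecD tangent_hsec_restr)

lemma differential_lin: "differential A f y \<in> linear_maps (tangent_space A y) UNIV"
  by (rule linear_mapsI)
    (auto simp: differential_def intro: subspace_add[OF subspace_tangent] subspace_scale[OF subspace_tangent])

text \<open>A derivation at y sees f only near y, so f may be replaced by its restriction to the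
  open set on which the vector field lives.\<close>

lemma differential_sec:
  assumes f: "f \<in> holfun A U" and U: "open U"
  shows "restr U (differential A f) \<in> hsec (cotangent_bundle A) U"
  unfolding cotangent_bundle_def
proof (rule dual_hsecI)
  fix W \<xi> assume W: "open W" "W \<subseteq> U" and x: "\<xi> \<in> hsec (tangent_bundle A) W"
  have "(\<lambda>y. restr U (differential A f) y (\<xi> y)) = restr W (\<lambda>y. \<xi> y (restr W f))"
  proof
    fix y show "restr U (differential A f) y (\<xi> y) = restr W (\<lambda>y. \<xi> y (restr W f)) y"
    proof (cases "y \<in> W")
      case True
      note v = tangent_hsecD(1)[OF x True]
      show ?thesis using True W v tangent_restr[OF v U _ f W(1) True W(2)] by (auto simp: differential_def)
    next
      case False
      then show ?thesis using tangent_hsecD(2)[OF x False] by (auto simp: differential_def restr_apply)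
    qed
  qed
  then show "(\<lambda>y. restr U (differential A f) y (\<xi> y)) \<in> holfun A W"
    using tangent_hsecD(3)[OF x W(1) order_refl hol_restr[OF f W(2)]] by simp
qed (auto simp: differential_lin)

lemma cotangentD:
  assumes "\<eta> \<in> hsec (cotangent_bundle A) U"
  shows cotangent_lin: "y \<in> U \<Longrightarrow> \<eta> y \<in> linear_maps (tangent_space A y) UNIV"
    and cotangent_out: "y \<notin> U \<Longrightarrow> \<eta> y = 0"
    and cotangent_app: "\<xi> \<in> hsec (tangent_bundle A) W \<Longrightarrow> open W \<Longrightarrow> W \<subseteq> U \<Longrightarrow> (\<lambda>y. \<eta> y (\<xi> y)) \<in> holfun A W"
  using dual_hsecD[OF assms[unfolded cotangent_bundle_def]] by simp_all

text \<open>Tangent spaces are spanned by \<open>d\<close>, so a form is e = e(d) dz.\<close>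

lemma coord_form:
  assumes c: "coord x W z d" and y: "y \<in> W" and e: "e \<in> linear_maps (tangent_space A y) UNIV"
    and v: "v \<in> tangent_space A y"
  shows "e v = v z * e (d y)"
  using coord_span[OF c y v] linear_maps_scale[OF e coord_vec[OF c y], of "v z"] by simp

lemma coord_avoiding:
  assumes "finite S" "open N" "x \<in> N"
  shows "\<exists>W z d. coord x W z d \<and> W \<subseteq> N \<and> W \<inter> S \<subseteq> {x}"
proof -
  have "open (N - (S - {x}))" using assms by (intro finite_open_Diff) auto
  from coord_exists[OF this, of x] obtain W z d where "coord x W z d" "W \<subseteq> N - (S - {x})"
    using assms by blast
  then show ?thesis by blast
qed

lemma log_formsD:
  assumes "\<omega> \<in> log_forms A S U"
  shows log_form_sec: "\<omega> \<in> hsec (cotangent_bundle A) (U - S)"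
    and log_form_mult: "open W \<Longrightarrow> W \<subseteq> U \<Longrightarrow> f \<in> holfun A W \<Longrightarrow> (\<And>x. x \<in> W \<Longrightarrow> x \<in> S \<Longrightarrow> f x = 0) \<Longrightarrow>
       \<exists>\<eta>\<in>hsec (cotangent_bundle A) W. \<forall>y\<in>W - S. \<eta> y = f y *\<^sub>C \<omega> y"
proof -
  note D = assms[unfolded log_forms_def mem_Collect_eq]
  show "\<omega> \<in> hsec (cotangent_bundle A) (U - S)" by (rule conjunct1[OF D])
  show "open W \<Longrightarrow> W \<subseteq> U \<Longrightarrow> f \<in> holfun A W \<Longrightarrow> (\<And>x. x \<in> W \<Longrightarrow> x \<in> S \<Longrightarrow> f x = 0) \<Longrightarrow>
       \<exists>\<eta>\<in>hsec (cotangent_bundle A) W. \<forall>y\<in>W - S. \<eta> y = f y *\<^sub>C \<omega> y"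
    by (rule D[THEN conjunct2, THEN spec, THEN spec, THEN mp]) (intro conjI ballI; simp)
qed

lemma log_forms_restr:
  assumes w: "\<omega> \<in> log_forms A S U" and U: "open U" and W: "open W" "W \<subseteq> U" and S: "finite S"
  shows "restr W \<omega> \<in> log_forms A S W"
  unfolding log_forms_def mem_Collect_eq
proof (intro conjI allI impI; (elim conjE)?)
  have "restr W \<omega> = restr (W - S) \<omega>"
    using cotangent_out[OF log_form_sec[OF w]] by (intro ext) (auto simp: restr_apply)
  moreover have "restr (W - S) \<omega> \<in> hsec (cotangent_bundle A) (W - S)"
    by (rule fsheaf_restr[OF fsheaf_cotangent log_form_sec[OF w]])
      (use U W S in \<open>auto intro!: finite_open_Diff\<close>)
  ultimately show "restr W \<omega> \<in> hsec (cotangent_bundle A) (W - S)" by simp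
  fix W' f assume a: "open W'" "W' \<subseteq> W" "f \<in> holfun A W'" "\<forall>x\<in>W' \<inter> S. f x = 0"
  then obtain \<eta> where "\<eta> \<in> hsec (cotangent_bundle A) W'" "\<forall>y\<in>W' - S. \<eta> y = f y *\<^sub>C \<omega> y"
    using log_form_mult[OF w a(1) _ a(3)] W(2) by blast
  then show "\<exists>\<eta>\<in>hsec (cotangent_bundle A) W'. \<forall>y\<in>W' - S. \<eta> y = f y *\<^sub>C restr W \<omega> y"
    using a(2) by (intro bexI[of _ \<eta>]) auto
qed

text \<open>For \<omega> = h dz/z the form \<eta> = z \<omega> extends as h dz, so its value on d at
  x is the residue. The definition admits every local coordinate z'. With z' = z g the form z'
  \<omega> extends as g \<eta>, while dz' = g(x) dz at x; the common factor g(x) is nonzero and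
  cancels.\<close>

lemma residue_eq:
  assumes c: "coord x W z d" and x: "x \<in> S" and S: "finite S"
    and W: "W \<subseteq> U"
    and \<eta>: "\<eta> \<in> hsec (cotangent_bundle A) W" "\<And>y. y \<in> W - S \<Longrightarrow> \<eta> y = z y *\<^sub>C \<omega> y"
  shows "residue_at A S x U \<omega> = \<eta> x (d x)"
  unfolding residue_at_def
proof (rule the_equality)
  note xW = coord_mem[OF c] and oW = coord_open[OF c]
  note dT = coord_vec[OF c xW]
  have "\<eta> x = \<eta> x (d x) *\<^sub>C differential A z x"
  proof
    fix v show "\<eta> x v = (\<eta> x (d x) *\<^sub>C differential A z x) v"
      using coord_form[OF c xW cotangent_lin[OF \<eta>(1) xW], of v]
        linear_maps_out[OF cotangent_lin[OF \<eta>(1) xW], of v] by (auto simp: differential_def)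
  qed
  then show "\<exists>W z \<eta>'. local_coord A x W z \<and> W \<subseteq> U \<and> \<eta>' \<in> hsec (cotangent_bundle A) W \<and>
      (\<forall>y\<in>W - S. \<eta>' y = z y *\<^sub>C \<omega> y) \<and> \<eta>' x = \<eta> x (d x) *\<^sub>C differential A z x"
    using coord_local[OF c] W \<eta> by blast
  fix c' assume "\<exists>W z \<eta>. local_coord A x W z \<and> W \<subseteq> U \<and> \<eta> \<in> hsec (cotangent_bundle A) W \<and>
      (\<forall>y\<in>W - S. \<eta> y = z y *\<^sub>C \<omega> y) \<and> \<eta> x = c' *\<^sub>C differential A z x"
  then obtain W' z' \<eta>' where l: "local_coord A x W' z'" and \<eta>': "\<eta>' \<in> hsec (cotangent_bundle A) W'"
      "\<forall>y\<in>W' - S. \<eta>' y = z' y *\<^sub>C \<omega> y" "\<eta>' x = c' *\<^sub>C differential A z' x" by blast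
  have l': "open W'" "x \<in> W'" "z' \<in> holfun A W'" "z' x = 0" using l by (auto simp: local_coord_def)
  let ?W = "W \<inter> W'"
  have o: "open ?W" "x \<in> ?W" "?W \<subseteq> W" "?W \<subseteq> W'" using oW xW l' by auto
  have r: "restr ?W z' \<in> holfun A ?W" by (rule hol_restr[OF l'(3) o(4)])
  obtain g where g: "g \<in> holfun A ?W" "restr ?W z' = fmul z g"
    using coord_div[OF c o(1,3) r] l'(4) o(2) by auto
  have zg: "z' y = z y * g y" if "y \<in> ?W" for y
    using fun_cong[OF g(2), of y] that by (simp add: fmul_def)
  have d: "restr ?W d \<in> hsec (tangent_bundle A) ?W" by (rule tangent_hsec_restr[OF coord_field[OF c] o(3)])
  \<comment> \<open>Off S both forms are known multiples of \<omega>. The identity reaches x because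
    holomorphic functions that agree off a finite set are equal.\<close>
  have "(\<lambda>y. \<eta>' y (restr ?W d y)) = fmul g (\<lambda>y. \<eta> y (restr ?W d y))"
  proof (rule hol_eq_off_finite[OF cotangent_app[OF \<eta>'(1) d o(1,4)] hol_fmul[OF g(1) cotangent_app[OF \<eta>(1) d o(1,3)]]
      o(1) S])
    fix y assume y: "y \<in> ?W - S"
    then have "\<eta>' y = (z y * g y) *\<^sub>C \<omega> y" "\<eta> y = z y *\<^sub>C \<omega> y" using \<eta>' \<eta> zg by auto
    then show "\<eta>' y (restr ?W d y) = fmul g (\<lambda>y. \<eta> y (restr ?W d y)) y"
      using y by (simp add: fmul_def)
  qed
  from fun_cong[OF this, of x] have 1: "\<eta>' x (d x) = g x * \<eta> x (d x)" using o by (simp add: fmul_def)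
  have rz: "restr ?W z \<in> holfun A ?W" by (rule hol_restr[OF coord_hol[OF c] o(3)])
  have "restr ?W z' = fmul (restr ?W z) g"
    unfolding g(2) using holfun_out[OF g(1)] by (intro ext) (auto simp: fmul_def restr_apply)
  then have "d x z' = d x (fmul (restr ?W z) g)"
    using tangent_restr[OF dT l'(1,2,3) o(1,2,4)] by simp
  also have "\<dots> = g x"
    using tangent_mult[OF dT o(1,2) rz g(1)] tangent_restr[OF dT oW xW coord_hol[OF c] o(1-3)] o(2)
      coord_deriv[OF c xW] coord_center[OF c] by simp
  finally have gx: "d x z' = g x" .
  have "\<eta>' x (d x) = c' * g x" using \<eta>'(3) dT gx by (simp add: differential_def)
  with 1 have "c' * g x = \<eta> x (d x) * g x" by simp
  moreover have "g x \<noteq> 0" using local_coord_deriv_nonzero[OF c l] gx by simp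
  ultimately show "c' = \<eta> x (d x)" by simp
qed

end

section \<open>The dual anchor and its extension to simple poles\<close>

locale anchored = hol_bundle A V for A :: "'x::t2_space chart set" and V :: "('x, 'v::complex_vector) vbundle" +
  fixes S :: "'x set" and \<phi> :: "'x \<Rightarrow> 'v \<Rightarrow> 'x tvec"
  assumes S: "finite S"
    and anchor: "\<phi> \<in> hsec (hom_bundle V (tangent_bundle A)) UNIV"
    and vanish: "\<forall>x\<in>S. \<forall>\<kappa>\<in>fib (cotangent_bundle A) x. anchor_dual \<phi> x \<kappa> = 0"
begin

lemma anchor_lin: "\<phi> y \<in> linear_maps (fib V y) (tangent_space A y)"
  using hom_hsec_lin[OF anchor] by simp

lemma anchor_tangent: "\<phi> y u \<in> tangent_space A y"
  using linear_maps_mem[OF anchor_lin] linear_maps_out[OF anchor_lin] subspace_0[OF subspace_tangent]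
  by (cases "u \<in> fib V y") auto

lemma anchor_0 [simp]: "\<phi> y 0 = 0"
  by (rule linear_maps_0[OF anchor_lin])

lemma anchor_differential: "anchor_dual \<phi> y (differential A f y) = (\<lambda>u. \<phi> y u f)"
  by (rule ext) (simp add: anchor_dual_def differential_def anchor_tangent)

lemma anchor_vanish: "x \<in> S \<Longrightarrow> \<phi> x u f = 0"
  using vanish differential_lin[of f x] anchor_differential[of x f] by (auto dest: fun_cong)

lemma conormal_zero: "x \<in> S \<Longrightarrow> conormal A \<phi> x = {0}"
  unfolding conormal_def using vanish subspace_0[OF subspace_linear_maps[OF complex_vector.subspace_UNIV]] by force

lemma anchor_hol:
  assumes t: "t \<in> hsec V W" and W: "open W" "W \<subseteq> U" and U: "open U" and f: "f \<in> holfun A U"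
  shows "(\<lambda>y. \<phi> y (t y) f) \<in> holfun A W"
proof -
  have s: "(\<lambda>y. \<phi> y (t y)) \<in> hsec (tangent_bundle A) W" using hom_hsec_app[OF anchor t W(1)] by simp
  have "(\<lambda>y. \<phi> y (t y) f) = restr W (\<lambda>y. \<phi> y (t y) (restr W f))"
  proof
    fix y show "\<phi> y (t y) f = restr W (\<lambda>y. \<phi> y (t y) (restr W f)) y"
      using fsheaf_out[OF fsheaf t W(1), of y] tangent_restr[OF anchor_tangent U _ f W(1) _ W(2), of y] W(2)
      by (cases "y \<in> W") auto
  qed
  then show ?thesis using tangent_hsecD(3)[OF s W(1) order_refl hol_restr[OF f W(2)]] by simp
qed

lemma pullback:
  assumes e: "\<eta> \<in> hsec (cotangent_bundle A) U"
  shows "(\<lambda>y. anchor_dual \<phi> y (\<eta> y)) \<in> hsec (dual_bundle A V) U"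
proof (rule dual_hsecI)
  show "anchor_dual \<phi> y (\<eta> y) \<in> linear_maps (fib V y) UNIV" if y: "y \<in> U" for y
    by (rule linear_mapsI)
      (use cotangent_lin[OF e y] anchor_lin[of y] linear_maps_0[OF cotangent_lin[OF e y]] in
       \<open>auto simp: anchor_dual_def linear_maps_out[OF anchor_lin] linear_maps_add[OF anchor_lin] anchor_tangent
         linear_maps_scale[OF anchor_lin] linear_maps_add[OF cotangent_lin[OF e y]]
         linear_maps_scale[OF cotangent_lin[OF e y]]\<close>)
  show "anchor_dual \<phi> y (\<eta> y) = 0" if "y \<notin> U" for y
    using cotangent_out[OF e that] by (auto simp: anchor_dual_def)
  fix W s assume W: "open W" "W \<subseteq> U" and s: "s \<in> hsec V W"
  have "(\<lambda>y. \<phi> y (s y)) \<in> hsec (tangent_bundle A) W" using hom_hsec_app[OF anchor s W(1)] by simp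
  from cotangent_app[OF e this W] show "(\<lambda>y. anchor_dual \<phi> y (\<eta> y) (s y)) \<in> holfun A W"
    by (simp add: anchor_dual_def)
qed

text \<open>\<open>\<phi> y u z\<close> is the dual anchor of dz evaluated on u, so the last clause
  reads \<phi>*(dz) = z \<Psi>. The section \<Psi> is the image that dz/z must have.\<close>

definition log_pull :: "'x \<Rightarrow> 'x set \<Rightarrow> ('x \<Rightarrow> complex) \<Rightarrow> ('x \<Rightarrow> 'x tvec) \<Rightarrow> ('x \<Rightarrow> 'v \<Rightarrow> complex) \<Rightarrow> bool" where
  "log_pull x W z d \<Psi> \<longleftrightarrow> x \<in> S \<and> coord x W z d \<and> W \<inter> S \<subseteq> {x} \<and> \<Psi> \<in> hsec (dual_bundle A V) W \<and>
     (\<forall>y\<in>W. \<forall>u. \<phi> y u z = z y * \<Psi> y u)"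

text \<open>In the coframe the dual anchor of dz has the coefficients \<phi>(e i)(z). They vanish at
  x because the anchor does, hence are divisible by z, and the quotients are the coefficients of
  \<Psi>.\<close>

lemma log_pull_coframe:
  assumes c: "coord x W z d" and x: "x \<in> S" and W: "W \<inter> S \<subseteq> {x}"
    and cf: "coframe A V W I e \<nu>"
  shows "\<exists>\<Psi>. log_pull x W z d \<Psi>"
proof -
  note oW = coord_open[OF c]
  have "\<exists>g. g \<in> holfun A W \<and> (\<lambda>y. \<phi> y (e i y) z) = fmul z g" if "i \<in> I" for i
    using coord_div[OF c oW order_refl anchor_hol[OF coframe_sec[OF cf that] oW order_refl oW coord_hol[OF c]]]
      anchor_vanish[OF x] by blast
  then obtain g where g: "\<And>i. i \<in> I \<Longrightarrow> g i \<in> holfun A W \<and> (\<lambda>y. \<phi> y (e i y) z) = fmul z (g i)" by metis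
  define \<Psi> where "\<Psi> = (\<lambda>y. \<Sum>i\<in>I. g i y *\<^sub>C \<nu> i y)"
  have \<Psi>: "\<Psi> \<in> hsec (dual_bundle A V) W" unfolding \<Psi>_def
    by (rule fsheaf_lincomb[OF fsheaf_dual oW]) (use g coframe_dual[OF cf] in auto)
  have "\<phi> y u z = z y * \<Psi> y u" if y: "y \<in> W" for y u
  proof (cases "u \<in> fib V y")
    case True
    have "\<phi> y u = \<phi> y (\<Sum>i\<in>I. \<nu> i y u *\<^sub>C e i y)" using coframe_expand[OF cf y True] by simp
    also have "\<dots> = (\<Sum>i\<in>I. \<nu> i y u *\<^sub>C \<phi> y (e i y))"
      by (rule linear_maps_sum[OF anchor_lin fib_subspace coframe_fib[OF cf y]])
    finally have "\<phi> y u z = (\<Sum>i\<in>I. \<nu> i y u * \<phi> y (e i y) z)" by (simp add: fun_sum_apply)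
    also have "\<dots> = (\<Sum>i\<in>I. \<nu> i y u * (z y * g i y))"
      using g by (intro sum.cong refl) (auto dest: fun_cong[of _ _ y] simp: fmul_def)
    also have "\<dots> = z y * \<Psi> y u" by (simp add: \<Psi>_def fun_sum_apply sum_distrib_left mult_ac)
    finally show ?thesis .
  next
    case False
    then show ?thesis using linear_maps_out[OF anchor_lin False] linear_maps_out[OF dual_hsec_lin[OF \<Psi> y] False] by simp
  qed
  then show ?thesis using c x W \<Psi> unfolding log_pull_def by blast
qed

lemma log_pull_exists:
  assumes x: "x \<in> S" and N: "open N" "x \<in> N"
  shows "\<exists>W z d \<Psi>. log_pull x W z d \<Psi> \<and> W \<subseteq> N"
proof -
  obtain U and r :: nat and e \<kappa> where cf: "x \<in> U" "coframe A V U {..<r} e \<kappa>" using coframe_exists by blast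
  have "open (N \<inter> U)" "x \<in> N \<inter> U" using N cf coframe_open[OF cf(2)] by auto
  from coord_avoiding[OF S this] obtain W z d where c: "coord x W z d" "W \<subseteq> N \<inter> U" "W \<inter> S \<subseteq> {x}" by blast
  then show ?thesis
    using log_pull_coframe[OF c(1) x c(3) coframe_restr[OF cf(2) coord_open[OF c(1)]]] by blast
qed

lemma log_pull_restr:
  assumes p: "log_pull x W z d \<Psi>" and N: "open N" "x \<in> N" "N \<subseteq> W"
  shows "log_pull x N (restr N z) (restr N d) (restr N \<Psi>)"
proof -
  have c: "coord x W z d" and \<Psi>: "\<Psi> \<in> hsec (dual_bundle A V) W" using p by (auto simp: log_pull_def)
  have "restr N \<Psi> \<in> hsec (dual_bundle A V) N"
    by (rule fsheaf_restr[OF fsheaf_dual \<Psi> coord_open[OF c] N(1,3)])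
  moreover have "\<phi> y u (restr N z) = restr N z y * restr N \<Psi> y u" if "y \<in> N" for y u
    using p that N tangent_restr[OF anchor_tangent coord_open[OF c] _ coord_hol[OF c] N(1) that N(3)]
    by (auto simp: log_pull_def)
  ultimately show ?thesis using p N coord_restr[OF c N] by (auto simp: log_pull_def)
qed

text \<open>Since W meets S only in x, the function z is an admissible multiplier: \<eta> = z
  \<omega> is holomorphic on W and equals h dz with h = \<eta>(d). Applying the dual anchor and
  dividing by z off x gives h \<Psi>, and h(x) is the residue.\<close>

lemma log_form_local:
  assumes p: "log_pull x W z d \<Psi>" and w: "\<omega> \<in> log_forms A S U" and W: "W \<subseteq> U"
  shows "\<exists>h \<eta>. h \<in> holfun A W \<and> (\<forall>y\<in>W - S. anchor_dual \<phi> y (\<omega> y) = h y *\<^sub>C \<Psi> y) \<and>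
    residue_at A S x U \<omega> = h x \<and> \<eta> \<in> hsec (cotangent_bundle A) W \<and>
    (\<forall>y\<in>W - S. \<eta> y = z y *\<^sub>C \<omega> y)"
proof -
  have x: "x \<in> S" and c: "coord x W z d" and WS: "W \<inter> S \<subseteq> {x}" and \<Psi>: "\<Psi> \<in> hsec (dual_bundle A V) W"
    and eq: "\<And>y u. y \<in> W \<Longrightarrow> \<phi> y u z = z y * \<Psi> y u" using p by (auto simp: log_pull_def)
  have z0: "z y = 0" if "y \<in> W" "y \<in> S" for y using that WS coord_center[OF c] by auto
  obtain \<eta> where \<eta>: "\<eta> \<in> hsec (cotangent_bundle A) W" "\<And>y. y \<in> W - S \<Longrightarrow> \<eta> y = z y *\<^sub>C \<omega> y"
    using log_form_mult[OF w coord_open[OF c] W coord_hol[OF c] z0] by blast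
  show ?thesis
  proof (intro exI conjI ballI)
    show "(\<lambda>y. \<eta> y (d y)) \<in> holfun A W"
      by (rule cotangent_app[OF \<eta>(1) coord_field[OF c] coord_open[OF c] order_refl])
    show "residue_at A S x U \<omega> = \<eta> x (d x)" by (rule residue_eq[OF c x S W \<eta>])
    show "\<eta> \<in> hsec (cotangent_bundle A) W" by (rule \<eta>(1))
    fix y assume y: "y \<in> W - S"
    show "\<eta> y = z y *\<^sub>C \<omega> y" by (rule \<eta>(2)[OF y])
    have zy: "z y \<noteq> 0" using coord_zero[OF c] x y by blast
    show "anchor_dual \<phi> y (\<omega> y) = \<eta> y (d y) *\<^sub>C \<Psi> y"
    proof
      fix u
      have "z y * \<omega> y (\<phi> y u) = \<eta> y (\<phi> y u)" using \<eta>(2)[OF y] by simp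
      also have "\<dots> = z y * \<Psi> y u * \<eta> y (d y)"
        using coord_form[OF c _ cotangent_lin[OF \<eta>(1)] anchor_tangent] y eq by auto
      finally show "anchor_dual \<phi> y (\<omega> y) u = (\<eta> y (d y) *\<^sub>C \<Psi> y) u"
        using zy by (simp add: anchor_dual_def)
    qed
  qed
qed

text \<open>Near a point of S the extension is h \<Psi>; elsewhere it is the pullback
  itself.\<close>

lemma log_form_extends:
  assumes w: "\<omega> \<in> log_forms A S U" and U: "open U"
  shows "\<exists>\<tau>\<in>hsec (dual_bundle A V) U. \<forall>y\<in>U - S. \<tau> y = anchor_dual \<phi> y (\<omega> y)"
proof -
  have ex: "\<exists>W \<sigma>. open W \<and> x \<in> W \<and> W \<subseteq> U \<and> W \<inter> S \<subseteq> {x} \<and> \<sigma> \<in> hsec (dual_bundle A V) W \<and>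
     (\<forall>y\<in>W - S. \<sigma> y = anchor_dual \<phi> y (\<omega> y))" if x: "x \<in> U \<inter> S" for x
  proof -
    obtain W z d \<Psi> where p: "log_pull x W z d \<Psi>" "W \<subseteq> U" using log_pull_exists U x by blast
    obtain h where h: "h \<in> holfun A W" "\<forall>y\<in>W - S. anchor_dual \<phi> y (\<omega> y) = h y *\<^sub>C \<Psi> y"
      using log_form_local[OF p(1) w p(2)] by blast
    have c: "coord x W z d" "W \<inter> S \<subseteq> {x}" "\<Psi> \<in> hsec (dual_bundle A V) W" using p(1) by (auto simp: log_pull_def)
    have "fmul h \<Psi> \<in> hsec (dual_bundle A V) W" by (rule fsheaf_fmul[OF fsheaf_dual coord_open[OF c(1)] h(1) c(3)])
    then show ?thesis using p(2) c coord_open[OF c(1)] coord_mem[OF c(1)] h(2)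
      by (intro exI[of _ W] exI[of _ "fmul h \<Psi>"]) (auto simp: fmul_def)
  qed
  then obtain N \<sigma> where N: "\<And>x. x \<in> U \<inter> S \<Longrightarrow> open (N x) \<and> x \<in> N x \<and> N x \<subseteq> U \<and> N x \<inter> S \<subseteq> {x} \<and>
     \<sigma> x \<in> hsec (dual_bundle A V) (N x) \<and> (\<forall>y\<in>N x - S. \<sigma> x y = anchor_dual \<phi> y (\<omega> y))" by metis
  note ws = log_form_sec[OF w]
  \<comment> \<open>Each point of S uses the section of its own patch, and a patch contains no other
    point of S. Hence this mixed definition agrees with the patch section on the whole
    patch.\<close>
  define \<tau> where "\<tau> y = (if y \<in> U \<inter> S then \<sigma> y y else anchor_dual \<phi> y (\<omega> y))" for y
  have "\<tau> \<in> hsec (dual_bundle A V) U"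
  proof (rule fsheaf_local[OF fsheaf_dual U])
    show "\<tau> y = 0" if "y \<notin> U" for y
      using that cotangent_out[OF ws, of y] by (auto simp: \<tau>_def anchor_dual_def)
    fix x assume xU: "x \<in> U"
    show "\<exists>W. open W \<and> x \<in> W \<and> W \<subseteq> U \<and> restr W \<tau> \<in> hsec (dual_bundle A V) W"
    proof (cases "x \<in> S")
      case True
      note Nx = N[OF IntI[OF xU True]]
      have "restr (N x) \<tau> y = \<sigma> x y" for y
      proof (cases "y \<in> N x")
        case True
        then show ?thesis using Nx by (cases "y \<in> S") (auto simp: \<tau>_def)
      next
        case False
        then show ?thesis using dual_hsec_out[of "\<sigma> x" A V "N x" y] Nx by simp
      qed
      then have "restr (N x) \<tau> = \<sigma> x" by blast
      then show ?thesis using Nx by (intro exI[of _ "N x"]) auto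
    next
      case False
      have "restr (U - S) \<tau> = (\<lambda>y. anchor_dual \<phi> y (\<omega> y))"
        using cotangent_out[OF ws] by (intro ext) (auto simp: restr_apply \<tau>_def anchor_dual_def)
      then show ?thesis using pullback[OF ws] False xU finite_open_Diff[OF U S]
        by (intro exI[of _ "U - S"]) auto
    qed
  qed
  then show ?thesis by (rule bexI[rotated]) (auto simp: \<tau>_def)
qed

text \<open>\<open>log_anchor_dual\<close> is a \<open>SOME\<close>, so a witness is required: the
  section of the dual that extends the pullback across S. It is unique because such sections are
  determined off S, and for the same reason the homomorphism laws need checking only there.\<close>

lemma log_anchor_dual_spec:
  "omod_hom A (section_sheaf (log_forms A S)) (section_sheaf (hsec (dual_bundle A V))) (log_anchor_dual A S V \<phi>) \<and>
   (\<forall>U \<omega>. open U \<and> \<omega> \<in> hsec (cotangent_bundle A) U \<longrightarrow>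
      log_anchor_dual A S V \<phi> U (restr (U - S) \<omega>) = (\<lambda>y. anchor_dual \<phi> y (\<omega> y)))"
proof -
  define \<Phi> where "\<Phi> U \<omega> = (THE \<tau>. \<tau> \<in> hsec (dual_bundle A V) U \<and> (\<forall>y\<in>U - S. \<tau> y = anchor_dual \<phi> y (\<omega> y)))" for U \<omega>
  have eq: "\<Phi> U \<omega> = \<tau>" if "open U" "\<tau> \<in> hsec (dual_bundle A V) U" "\<And>y. y \<in> U - S \<Longrightarrow> \<tau> y = anchor_dual \<phi> y (\<omega> y)"
    for U \<omega> \<tau>
    unfolding \<Phi>_def
  proof (rule the_equality)
    show "\<tau>' = \<tau>" if "\<tau>' \<in> hsec (dual_bundle A V) U \<and> (\<forall>y\<in>U - S. \<tau>' y = anchor_dual \<phi> y (\<omega> y))" for \<tau>'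
      using dual_eq_off_finite[OF _ \<open>\<tau> \<in> _\<close> \<open>open U\<close> S, of \<tau>'] that \<open>\<And>y. y \<in> U - S \<Longrightarrow> \<tau> y = _\<close> by simp
  qed (use that in auto)
  have \<Phi>: "\<Phi> U \<omega> \<in> hsec (dual_bundle A V) U" "\<And>y. y \<in> U - S \<Longrightarrow> \<Phi> U \<omega> y = anchor_dual \<phi> y (\<omega> y)"
    if "open U" "\<omega> \<in> log_forms A S U" for U \<omega>
    using log_form_extends[OF that(2,1)] eq[OF that(1)] by metis+
  have "omod_hom A (section_sheaf (log_forms A S)) (section_sheaf (hsec (dual_bundle A V))) \<Phi> \<and>
   (\<forall>U \<omega>. open U \<and> \<omega> \<in> hsec (cotangent_bundle A) U \<longrightarrow>
      \<Phi> U (restr (U - S) \<omega>) = (\<lambda>y. anchor_dual \<phi> y (\<omega> y)))"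
    unfolding omod_hom_def section_sheaf_def omod.simps
  proof (intro conjI allI impI ballI; (elim conjE)?)
    fix U s assume U: "open U" and s: "s \<in> log_forms A S U"
    show "\<Phi> U s \<in> hsec (dual_bundle A V) U" by (rule \<Phi>(1)[OF U s])
    show "\<Phi> U (s + t) = \<Phi> U s + \<Phi> U t" if t: "t \<in> log_forms A S U" for t
      by (rule eq[OF U fsheaf_add[OF fsheaf_dual U \<Phi>(1)[OF U s] \<Phi>(1)[OF U t]]])
        (auto simp: \<Phi>(2)[OF U s] \<Phi>(2)[OF U t] anchor_dual_def)
    show "\<Phi> U (fmul f s) = fmul f (\<Phi> U s)" if f: "f \<in> holfun A U" for f
      by (rule eq[OF U fsheaf_fmul[OF fsheaf_dual U f \<Phi>(1)[OF U s]]])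
        (auto simp: \<Phi>(2)[OF U s] anchor_dual_def fmul_def)
    show "\<Phi> W (restr W s) = restr W (\<Phi> U s)" if W: "open W" "W \<subseteq> U" for W
      by (rule eq[OF W(1) fsheaf_restr[OF fsheaf_dual \<Phi>(1)[OF U s] U W]])
        (use W \<Phi>(2)[OF U s] in auto)
  next
    fix U \<omega> assume U: "open U" "\<omega> \<in> hsec (cotangent_bundle A) U"
    show "\<Phi> U (restr (U - S) \<omega>) = (\<lambda>y. anchor_dual \<phi> y (\<omega> y))"
      by (rule eq[OF U(1) pullback[OF U(2)]]) auto
  qed
  then show ?thesis by (rule some_eq_spec[OF log_anchor_dual_def])
qed

lemma log_anchor_dual_hom:
  assumes "open U" "\<omega> \<in> log_forms A S U"
  shows log_anchor_dual_sec: "log_anchor_dual A S V \<phi> U \<omega> \<in> hsec (dual_bundle A V) U"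
    and log_anchor_dual_fmul: "f \<in> holfun A U \<Longrightarrow>
      log_anchor_dual A S V \<phi> U (fmul f \<omega>) = fmul f (log_anchor_dual A S V \<phi> U \<omega>)"
    and log_anchor_dual_restr: "open W \<Longrightarrow> W \<subseteq> U \<Longrightarrow>
      log_anchor_dual A S V \<phi> W (restr W \<omega>) = restr W (log_anchor_dual A S V \<phi> U \<omega>)"
  using log_anchor_dual_spec[THEN conjunct1, unfolded omod_hom_def section_sheaf_def omod.simps, THEN spec, THEN mp, OF assms(1)]
    assms(2) by simp_all

text \<open>
  With \<open>z\<close> a coordinate and \<open>\<phi>\<^sup>* dz = z \<Psi>\<close>, the extension maps \<open>h dz/z\<close> to \<open>h \<Psi>\<close>: multiply by \<open>z\<close> and
  divide again off the centre.
\<close>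

lemma log_anchor_dual_value:
  assumes p: "log_pull x W z d \<Psi>" and w: "\<omega> \<in> log_forms A S U" and U: "open U" and W: "W \<subseteq> U"
  shows "log_anchor_dual A S V \<phi> U \<omega> x = residue_at A S x U \<omega> *\<^sub>C \<Psi> x"
proof -
  have x: "x \<in> S" and c: "coord x W z d" and \<Psi>: "\<Psi> \<in> hsec (dual_bundle A V) W" using p by (auto simp: log_pull_def)
  note oW = coord_open[OF c]
  obtain h \<eta> where D: "h \<in> holfun A W \<and> (\<forall>y\<in>W - S. anchor_dual \<phi> y (\<omega> y) = h y *\<^sub>C \<Psi> y) \<and>
    residue_at A S x U \<omega> = h x \<and> \<eta> \<in> hsec (cotangent_bundle A) W \<and>
    (\<forall>y\<in>W - S. \<eta> y = z y *\<^sub>C \<omega> y)" using log_form_local[OF p w W] by blast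
  then have h: "h \<in> holfun A W" "\<And>y. y \<in> W - S \<Longrightarrow> anchor_dual \<phi> y (\<omega> y) = h y *\<^sub>C \<Psi> y"
    "residue_at A S x U \<omega> = h x" and \<eta>: "\<eta> \<in> hsec (cotangent_bundle A) W"
    "\<And>y. y \<in> W - S \<Longrightarrow> \<eta> y = z y *\<^sub>C \<omega> y" by simp_all
  note wW = log_forms_restr[OF w U oW W S]
  let ?\<tau> = "log_anchor_dual A S V \<phi> W (restr W \<omega>)"
  have "fmul z (restr W \<omega>) = restr (W - S) \<eta>"
    using \<eta>(2) cotangent_out[OF log_form_sec[OF wW]]
    by (intro ext) (auto simp: fmul_def restr_apply fun_eq_iff)
  then have z\<tau>: "fmul z ?\<tau> = (\<lambda>y. anchor_dual \<phi> y (\<eta> y))"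
    using log_anchor_dual_fmul[OF oW wW coord_hol[OF c]] log_anchor_dual_spec oW \<eta>(1) by metis
  have "?\<tau> = fmul h \<Psi>"
  proof (rule dual_eq_off_finite[OF log_anchor_dual_sec[OF oW wW] fsheaf_fmul[OF fsheaf_dual oW h(1) \<Psi>] oW S])
    fix y assume y: "y \<in> W - S"
    then have zy: "z y \<noteq> 0" using coord_zero[OF c] x by blast
    show "?\<tau> y = fmul h \<Psi> y"
    proof
      fix u
      have "z y * ?\<tau> y u = \<eta> y (\<phi> y u)"
        using fun_cong[OF fun_cong[OF z\<tau>, of y], of u] by (simp add: fmul_def anchor_dual_def)
      also have "\<dots> = z y * anchor_dual \<phi> y (\<omega> y) u" using \<eta>(2)[OF y] by (simp add: anchor_dual_def)
      finally show "?\<tau> y u = fmul h \<Psi> y u" using zy h(2)[OF y] by (simp add: fmul_def)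
    qed
  qed
  then have "?\<tau> x = h x *\<^sub>C \<Psi> x" by (simp add: fmul_def)
  then show ?thesis using log_anchor_dual_restr[OF U w oW W] coord_mem[OF c] h(3) by simp
qed

text \<open>The form is a dz/z. A function that vanishes at x, if x is in its domain, is z g, and
  its product with the form is a g dz, which has no pole.\<close>

lemma log_form_with_residue:
  assumes c: "coord x W z d" and x: "x \<in> S" and WS: "W \<inter> S \<subseteq> {x}"
  shows "\<exists>\<omega>\<in>log_forms A S W. residue_at A S x W \<omega> = a"
proof -
  note oW = coord_open[OF c]
  have nz: "z y \<noteq> 0" if "y \<in> W - S" for y using that coord_zero[OF c] x by blast
  have oWS: "open (W - S)" by (rule finite_open_Diff[OF oW S])
  define dz where "dz = restr W (differential A z)"
  have dz: "dz \<in> hsec (cotangent_bundle A) W" unfolding dz_def by (rule differential_sec[OF coord_hol[OF c] oW])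
  define iz where "iz = restr (W - S) (\<lambda>y. inverse (restr (W - S) z y))"
  have iz: "iz \<in> holfun A (W - S)" unfolding iz_def
    by (rule hol_inverse[OF hol_restr[OF coord_hol[OF c]]]) (use nz in auto)
  define \<omega> where "\<omega> = fmul (a *\<^sub>C iz) (restr (W - S) dz)"
  have w0: "\<omega> \<in> hsec (cotangent_bundle A) (W - S)" unfolding \<omega>_def
    by (rule fsheaf_fmul[OF fsheaf_cotangent oWS hol_scale[OF iz] fsheaf_restr[OF fsheaf_cotangent dz oW oWS]]) auto
  have wz: "z y *\<^sub>C \<omega> y = a *\<^sub>C dz y" if "y \<in> W - S" for y
    using that nz[OF that] by (simp add: \<omega>_def fmul_def iz_def)
  have w: "\<omega> \<in> log_forms A S W"
    unfolding log_forms_def mem_Collect_eq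
  proof (intro conjI allI impI; (elim conjE)?)
    fix W' f assume W': "open W'" "W' \<subseteq> W" and f: "f \<in> holfun A W'" "\<forall>x\<in>W' \<inter> S. f x = 0"
    obtain g where g: "g \<in> holfun A W'" "f = fmul z g" using coord_div[OF c W' f(1)] f(2) x by auto
    let ?\<eta> = "fmul (a *\<^sub>C g) (restr W' dz)"
    have "?\<eta> \<in> hsec (cotangent_bundle A) W'"
      by (rule fsheaf_fmul[OF fsheaf_cotangent W'(1) hol_scale[OF g(1)] fsheaf_restr[OF fsheaf_cotangent dz oW W']])
    moreover have "?\<eta> y = f y *\<^sub>C \<omega> y" if "y \<in> W' - S" for y
    proof -
      have "f y *\<^sub>C \<omega> y = g y *\<^sub>C (z y *\<^sub>C \<omega> y)" by (simp add: g(2) fmul_def mult.commute)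
      also have "z y *\<^sub>C \<omega> y = a *\<^sub>C dz y" by (rule wz) (use that W' in auto)
      finally have e: "f y *\<^sub>C \<omega> y = g y *\<^sub>C (a *\<^sub>C dz y)" .
      show ?thesis unfolding e using that by (simp add: fmul_def mult.commute)
    qed
    ultimately show "\<exists>\<eta>\<in>hsec (cotangent_bundle A) W'. \<forall>y\<in>W' - S. \<eta> y = f y *\<^sub>C \<omega> y" by blast
  qed (rule w0)
  have "fmul (restr W (\<lambda>_. a)) dz \<in> hsec (cotangent_bundle A) W"
    by (rule fsheaf_fmul[OF fsheaf_cotangent oW hol_const dz])
  from residue_eq[OF c x S order_refl this, of \<omega>]
  have "residue_at A S x W \<omega> = a"
    using wz coord_mem[OF c] coord_deriv[OF c] coord_vec[OF c]
    by (auto simp: fmul_def dz_def differential_def)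
  then show ?thesis using w by blast
qed

text \<open>The \<open>THE\<close> ranges over all local forms with residue a. One of them exists,
  and they all have the same image at x because the extension depends there on the residue
  alone.\<close>

lemma log_anchor_dual_at_eq:
  assumes p: "log_pull x W z d \<Psi>"
  shows "log_anchor_dual_at A S V \<phi> x a = a *\<^sub>C \<Psi> x"
  unfolding log_anchor_dual_at_def
proof (rule the_equality)
  have x: "x \<in> S" and c: "coord x W z d" and WS: "W \<inter> S \<subseteq> {x}" using p by (auto simp: log_pull_def)
  obtain \<omega> where "\<omega> \<in> log_forms A S W" "residue_at A S x W \<omega> = a"
    using log_form_with_residue[OF c x WS] by blast
  then show "\<exists>W \<omega>. open W \<and> x \<in> W \<and> \<omega> \<in> log_forms A S W \<and> residue_at A S x W \<omega> = a \<and>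
      a *\<^sub>C \<Psi> x = log_anchor_dual A S V \<phi> W \<omega> x"
    using log_anchor_dual_value[OF p _ coord_open[OF c] order_refl] coord_open[OF c] coord_mem[OF c] by metis
  fix \<theta> assume "\<exists>W \<omega>. open W \<and> x \<in> W \<and> \<omega> \<in> log_forms A S W \<and> residue_at A S x W \<omega> = a \<and>
      \<theta> = log_anchor_dual A S V \<phi> W \<omega> x"
  then obtain U \<omega> where U: "open U" "x \<in> U" "\<omega> \<in> log_forms A S U" "residue_at A S x U \<omega> = a"
      "\<theta> = log_anchor_dual A S V \<phi> U \<omega> x" by blast
  \<comment> \<open>The coordinate neighbourhood is shrunk into the domain of the competing form;
    this does not change the value of \<Psi> at x.\<close>
  have o: "open (W \<inter> U)" "x \<in> W \<inter> U" using U coord_open[OF c] coord_mem[OF c] by auto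
  show "\<theta> = a *\<^sub>C \<Psi> x"
    using log_anchor_dual_value[OF log_pull_restr[OF p o] U(3,1)] U(4,5) o(2) by auto
qed

end

section \<open>Generalized parabolic connections, pointwise\<close>

lemma coset_zero: "coset {0} a = {a}"
  by (simp add: coset_def)

lemma coset_eq_iff:
  assumes "complex_vector.subspace N"
  shows "coset N a = coset N b \<longleftrightarrow> a - b \<in> N"
proof
  assume "coset N a = coset N b"
  then have "a + 0 \<in> coset N b" using subspace_0[OF assms] unfolding coset_def by blast
  then obtain n where "a = b + n" "n \<in> N" unfolding coset_def by auto
  then show "a - b \<in> N" by simp
next
  assume ab: "a - b \<in> N"
  have "coset N a \<subseteq> coset N b" if "a - b \<in> N" for a b
  proof
    fix p assume "p \<in> coset N a"
    then obtain n where "p = a + n" "n \<in> N" unfolding coset_def by blast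
    then have "p = b + ((a - b) + n)" "(a - b) + n \<in> N" using that subspace_add[OF assms] by auto
    then show "p \<in> coset N b" unfolding coset_def by blast
  qed
  moreover have "b - a \<in> N" using subspace_diff[OF assms subspace_0[OF assms] ab] by simp
  ultimately show "coset N a = coset N b" using ab by blast
qed

lemma tensor_space_zero: "tensor_space F {0} = {0 :: 'v \<Rightarrow> 'e::complex_vector}"
proof -
  have "{tens e \<theta> | e \<theta>. e \<in> F \<and> \<theta> \<in> {0}} \<subseteq> {0 :: 'v \<Rightarrow> 'e}"
    by (auto simp: tens_def zero_fun_def)
  then have "tensor_space F {0} \<subseteq> complex_vector.span {0 :: 'v \<Rightarrow> 'e}"
    unfolding tensor_space_def by (rule complex_vector.span_mono)
  also have "\<dots> = {0}" by (simp add: complex_vector.span_insert_0)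
  finally show ?thesis unfolding tensor_space_def using complex_vector.span_zero by blast
qed

lemma tens_linear:
  assumes "\<theta> \<in> linear_maps F UNIV" "e \<in> G" "complex_vector.subspace G"
  shows "tens e \<theta> \<in> linear_maps F G"
  by (rule linear_mapsI)
    (auto simp: tens_def linear_maps_out[OF assms(1)] linear_maps_add[OF assms(1)] linear_maps_scale[OF assms(1)]
      scaleC_add_left intro: subspace_scale[OF assms(3)] assms(2))

text \<open>Fibres have finite dimension, so a linear map T into G is the finite sum of the rank one
  maps with vector T(e i) and functional \<kappa> i. All tensor products with a dual fibre can thus
  be handled as spaces of linear maps.\<close>

lemma (in hol_bundle) tensor_space_dual:
  assumes G: "complex_vector.subspace G"
  shows "tensor_space G (fib (dual_bundle A E) x) = linear_maps (fib E x) G"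
proof
  show "tensor_space G (fib (dual_bundle A E) x) \<subseteq> linear_maps (fib E x) G"
    unfolding tensor_space_def
    by (rule complex_vector.span_minimal[OF _ subspace_linear_maps[OF G]]) (auto intro: tens_linear G)
next
  obtain U and r :: nat and e \<kappa> where cf: "x \<in> U" "coframe A E U {..<r} e \<kappa>" using coframe_exists by blast
  show "linear_maps (fib E x) G \<subseteq> tensor_space G (fib (dual_bundle A E) x)"
  proof
    fix T assume T: "T \<in> linear_maps (fib E x) G"
    have "T = (\<Sum>i<r. tens (T (e i x)) (\<kappa> i x))"
    proof
      fix u show "T u = (\<Sum>i<r. tens (T (e i x)) (\<kappa> i x)) u"
      proof (cases "u \<in> fib E x")
        case True
        have "T u = T (\<Sum>i<r. \<kappa> i x u *\<^sub>C e i x)" using coframe_expand[OF cf(2,1) True] by simp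
        also have "\<dots> = (\<Sum>i<r. \<kappa> i x u *\<^sub>C T (e i x))"
          by (rule linear_maps_sum[OF T fib_subspace]) (use coframe_fib[OF cf(2,1)] in auto)
        finally show ?thesis by (simp add: fun_sum_apply tens_def)
      next
        case False
        then show ?thesis
          using linear_maps_out[OF T] linear_maps_out[OF coframe_lin[OF cf(2,1)]] by (simp add: fun_sum_apply tens_def)
      qed
    qed
    also have "\<dots> \<in> tensor_space G (fib (dual_bundle A E) x)"
      unfolding tensor_space_def
    proof (rule complex_vector.span_sum[OF complex_vector.span_base])
      fix i assume "i \<in> {..<r}"
      then show "tens (T (e i x)) (\<kappa> i x) \<in> {tens e \<theta> | e \<theta>. e \<in> G \<and> \<theta> \<in> fib (dual_bundle A E) x}"
        using coframe_lin[OF cf(2,1)] linear_maps_mem[OF T coframe_fib[OF cf(2,1)]] by auto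
    qed
    finally show "T \<in> tensor_space G (fib (dual_bundle A E) x)" .
  qed
qed

section \<open>Connections and their values at the points of S\<close>

locale parabolic_setup = anchored A V S \<phi> for A :: "'x::t2_space chart set" and V :: "('x, 'v::complex_vector) vbundle"
    and S :: "'x set" and \<phi> :: "'x \<Rightarrow> 'v \<Rightarrow> 'x tvec" +
  fixes P :: "('x, 'e::complex_vector) parabolic"
  assumes parabolic: "parabolic_bundle A S P"
begin

sublocale E: hol_bundle A "pbun P"
  by unfold_locales (use parabolic in \<open>simp add: parabolic_bundle_def\<close>)

lemma filtration:
  assumes "x \<in> S"
  shows fil_1: "pfil P x (Suc 0) = fib (pbun P) x" and fil_last: "pfil P x (Suc (plen P x)) = {0}"
    and fil_subspace: "i \<in> {1..Suc (plen P x)} \<Longrightarrow> complex_vector.subspace (pfil P x i)"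
    and fil_Suc: "i \<in> {1..plen P x} \<Longrightarrow> pfil P x (Suc i) \<subset> pfil P x i"
proof -
  note D = bspec[OF conjunct2[OF parabolic[unfolded parabolic_bundle_def]] assms]
  show "pfil P x (Suc 0) = fib (pbun P) x" using D[THEN conjunct1] by simp
  note D = D[THEN conjunct2]
  show "pfil P x (Suc (plen P x)) = {0}" using D[THEN conjunct1] by simp
  note D = D[THEN conjunct2]
  show "i \<in> {1..Suc (plen P x)} \<Longrightarrow> complex_vector.subspace (pfil P x i)"
    using D[THEN conjunct1, THEN bspec, of i] by simp
  note D = D[THEN conjunct2]
  show "i \<in> {1..plen P x} \<Longrightarrow> pfil P x (Suc i) \<subset> pfil P x i"
    using D[THEN conjunct1, THEN bspec, of i] by simp
qed

lemma fil_antimono: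
  assumes x: "x \<in> S" and "1 \<le> i" "i \<le> j" "j \<le> Suc (plen P x)"
  shows "pfil P x j \<subseteq> pfil P x i"
  using assms(3,4)
proof (induction j rule: dec_induct)
  case (step n)
  then show ?case using fil_Suc[OF x, of n] \<open>1 \<le> i\<close> by auto
qed simp

lemma fil_fib: "x \<in> S \<Longrightarrow> i \<in> {1..Suc (plen P x)} \<Longrightarrow> pfil P x i \<subseteq> fib (pbun P) x"
  using fil_antimono[of x 1 i] fil_1[of x] by simp

lemma fsheaf_homVE: "fsheaf A (hsec (hom_bundle V (pbun P)))"
  by (rule fsheaf_hom)
    (auto intro: fsheaf_restr[OF fsheaf] E.fsheaf E.fib_subspace hol_restr dest: fsheaf_out[OF fsheaf])

text \<open>
  The term \<open>\<phi> y u f\<close> is the dual anchor applied to the differential of \<open>f\<close>.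
\<close>

definition conn :: "'x set \<Rightarrow> ('x \<Rightarrow> complex) \<Rightarrow> ('x, 'v, 'e) operator \<Rightarrow> bool" where
  "conn U w D \<longleftrightarrow> w \<in> holfun A U \<and> sheaf_operator (pbun P) (hom_bundle V (pbun P)) U D \<and>
     (\<forall>W s. \<not> (open W \<and> W \<subseteq> U \<and> s \<in> hsec (pbun P) W) \<longrightarrow> D W s = 0) \<and>
     (\<forall>W f s. open W \<and> W \<subseteq> U \<and> f \<in> holfun A W \<and> s \<in> hsec (pbun P) W \<longrightarrow>
        D W (fmul f s) = fmul f (D W s) + (\<lambda>y u. \<phi> y u f *\<^sub>C (w y *\<^sub>C s y)))"

text \<open>Complex homogeneity of D is derived here: for constant f the Leibniz rule has no
  derivative term, because tangent vectors kill constants.\<close>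

lemma connI:
  assumes "w \<in> holfun A U"
    and "\<And>W s. open W \<Longrightarrow> W \<subseteq> U \<Longrightarrow> s \<in> hsec (pbun P) W \<Longrightarrow> D W s \<in> hsec (hom_bundle V (pbun P)) W"
    and "\<And>W s t. open W \<Longrightarrow> W \<subseteq> U \<Longrightarrow> s \<in> hsec (pbun P) W \<Longrightarrow> t \<in> hsec (pbun P) W \<Longrightarrow> D W (s + t) = D W s + D W t"
    and "\<And>W W' s. open W \<Longrightarrow> W \<subseteq> U \<Longrightarrow> s \<in> hsec (pbun P) W \<Longrightarrow> open W' \<Longrightarrow> W' \<subseteq> W \<Longrightarrow>
       D W' (restr W' s) = restr W' (D W s)"
    and "\<And>W s. \<not> (open W \<and> W \<subseteq> U \<and> s \<in> hsec (pbun P) W) \<Longrightarrow> D W s = 0"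
    and leib: "\<And>W f s. open W \<Longrightarrow> W \<subseteq> U \<Longrightarrow> f \<in> holfun A W \<Longrightarrow> s \<in> hsec (pbun P) W \<Longrightarrow>
        D W (fmul f s) = fmul f (D W s) + (\<lambda>y u. \<phi> y u f *\<^sub>C (w y *\<^sub>C s y))"
  shows "conn U w D"
  unfolding conn_def sheaf_operator_def
proof (intro conjI allI impI ballI; (elim conjE)?)
  fix W s c assume W: "open W" "W \<subseteq> U" and s: "s \<in> hsec (pbun P) W"
  have "c *\<^sub>C s = fmul (restr W (\<lambda>_. c)) s"
    using fsheaf_out[OF E.fsheaf s W(1)] by (intro ext) (auto simp: fmul_def restr_apply)
  moreover have "D W (fmul (restr W (\<lambda>_. c)) s) = c *\<^sub>C D W s"
  proof (intro ext)
    fix y u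
    show "D W (fmul (restr W (\<lambda>_. c)) s) y u = (c *\<^sub>C D W s) y u"
      using tangent_const[OF anchor_tangent W(1)] fsheaf_out[OF E.fsheaf s W(1), of y]
        hom_hsec_out[OF assms(2)[OF W s], of y]
      unfolding leib[OF W hol_const s] by (cases "y \<in> W") (simp_all add: fmul_apply)
  qed
  ultimately show "D W (c *\<^sub>C s) = c *\<^sub>C D W s" by simp
next
  fix W s assume "\<not> (open W \<and> W \<subseteq> U \<and> s \<in> hsec (pbun P) W)"
  then show "D W s = 0" by (rule assms(5))
qed (simp_all add: assms(1-4) leib)

lemma connD:
  assumes "conn U w D"
  shows conn_weight: "w \<in> holfun A U"
    and conn_sec: "s \<in> hsec (pbun P) W \<Longrightarrow> open W \<Longrightarrow> W \<subseteq> U \<Longrightarrow> D W s \<in> hsec (hom_bundle V (pbun P)) W"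
    and conn_add: "s \<in> hsec (pbun P) W \<Longrightarrow> t \<in> hsec (pbun P) W \<Longrightarrow> open W \<Longrightarrow> W \<subseteq> U \<Longrightarrow> D W (s + t) = D W s + D W t"
    and conn_restr: "s \<in> hsec (pbun P) W \<Longrightarrow> open W \<Longrightarrow> W \<subseteq> U \<Longrightarrow> open W' \<Longrightarrow> W' \<subseteq> W \<Longrightarrow>
       D W' (restr W' s) = restr W' (D W s)"
    and conn_out: "\<not> (open W \<and> W \<subseteq> U \<and> s \<in> hsec (pbun P) W) \<Longrightarrow> D W s = 0"
    and conn_leibniz: "f \<in> holfun A W \<Longrightarrow> s \<in> hsec (pbun P) W \<Longrightarrow> open W \<Longrightarrow> W \<subseteq> U \<Longrightarrow>
        D W (fmul f s) = fmul f (D W s) + (\<lambda>y u. \<phi> y u f *\<^sub>C (w y *\<^sub>C s y))"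
proof -
  note D = assms[unfolded conn_def]
  show "w \<in> holfun A U" by (rule D[THEN conjunct1])
  note Dop = D[THEN conjunct2, THEN conjunct1, unfolded sheaf_operator_def, THEN spec, THEN mp, OF conjI, of W]
  show "s \<in> hsec (pbun P) W \<Longrightarrow> open W \<Longrightarrow> W \<subseteq> U \<Longrightarrow> D W s \<in> hsec (hom_bundle V (pbun P)) W"
    by (rule Dop[THEN conjunct1, THEN bspec])
  show "s \<in> hsec (pbun P) W \<Longrightarrow> t \<in> hsec (pbun P) W \<Longrightarrow> open W \<Longrightarrow> W \<subseteq> U \<Longrightarrow> D W (s + t) = D W s + D W t"
    by (rule Dop[THEN conjunct2, THEN conjunct1, THEN bspec, THEN bspec])
  show "s \<in> hsec (pbun P) W \<Longrightarrow> open W \<Longrightarrow> W \<subseteq> U \<Longrightarrow> open W' \<Longrightarrow> W' \<subseteq> W \<Longrightarrow>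
       D W' (restr W' s) = restr W' (D W s)"
    by (rule Dop[THEN conjunct2, THEN conjunct2, THEN conjunct2, THEN spec, THEN mp, OF _ _ conjI, THEN bspec])
  show "\<not> (open W \<and> W \<subseteq> U \<and> s \<in> hsec (pbun P) W) \<Longrightarrow> D W s = 0"
    by (rule D[THEN conjunct2, THEN conjunct2, THEN conjunct1, THEN spec, THEN spec, THEN mp])
  show "f \<in> holfun A W \<Longrightarrow> s \<in> hsec (pbun P) W \<Longrightarrow> open W \<Longrightarrow> W \<subseteq> U \<Longrightarrow>
        D W (fmul f s) = fmul f (D W s) + (\<lambda>y u. \<phi> y u f *\<^sub>C (w y *\<^sub>C s y))"
    by (rule D[THEN conjunct2, THEN conjunct2, THEN conjunct2, THEN spec, THEN spec, THEN spec, THEN mp])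
      (intro conjI)
qed

lemma conn_leibniz_at:
  "conn U w D \<Longrightarrow> f \<in> holfun A W \<Longrightarrow> s \<in> hsec (pbun P) W \<Longrightarrow> open W \<Longrightarrow> W \<subseteq> U \<Longrightarrow>
    D W (fmul f s) y u = f y *\<^sub>C D W s y u + \<phi> y u f *\<^sub>C (w y *\<^sub>C s y)"
  by (simp only: conn_leibniz) (simp add: fmul_def)

text \<open>By the Leibniz rule the commutator with f is multiplication by w \<phi>*(df), which is
  linear over the functions.\<close>

lemma conn_order:
  assumes D: "conn U w D"
  shows "order_le A (pbun P) (Suc 0) U D"
  unfolding order_le.simps
proof (intro allI impI; elim conjE)
  fix W f W' g s
  assume W: "open W" "W \<subseteq> U" and f: "f \<in> holfun A W" and W': "open W'" "W' \<subseteq> W"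
    and g: "g \<in> holfun A W'" and s: "s \<in> hsec (pbun P) W'"
  have WU: "W' \<subseteq> U" using W W' by auto
  let ?f = "restr W' f"
  have f': "?f \<in> holfun A W'" by (rule hol_restr[OF f W'(2)])
  \<comment> \<open>f is defined on the larger set W, while the Leibniz rule on W' accepts only
    functions that vanish off W'.\<close>
  have fs: "fmul f s = fmul ?f s" if "s \<in> hsec (pbun P) W'" for s
    using fsheaf_out[OF E.fsheaf that W'(1)] by (intro ext) (auto simp: fmul_def restr_apply)
  have gs: "fmul g s \<in> hsec (pbun P) W'" by (rule fsheaf_fmul[OF E.fsheaf W'(1) g s])
  have comm: "D W' (fmul f t) y u - f y *\<^sub>C D W' t y u = \<phi> y u ?f *\<^sub>C (w y *\<^sub>C t y)"
    if t: "t \<in> hsec (pbun P) W'" for t y u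
    using conn_leibniz_at[OF D f' t W'(1) WU, of y u] hom_hsec_out[OF conn_sec[OF D t W'(1) WU], of y]
    by (cases "y \<in> W'") (simp_all add: fs[OF t])
  have gD: "fmul g t y u = g y *\<^sub>C t y u" for t :: "'x \<Rightarrow> 'v \<Rightarrow> 'e" and y u by (simp add: fmul_def)
  show "D W' (fmul f (fmul g s)) - fmul f (D W' (fmul g s)) = fmul g (D W' (fmul f s) - fmul f (D W' s))"
  proof (intro ext)
    fix y u
    show "(D W' (fmul f (fmul g s)) - fmul f (D W' (fmul g s))) y u =
      fmul g (D W' (fmul f s) - fmul f (D W' s)) y u"
      using comm[OF gs, of y u] comm[OF s, of y u] by (simp add: fmul_apply mult_ac)
  qed
qed

lemma gen_connection_iff: "gen_connection A V \<phi> (pbun P) U w D \<longleftrightarrow> conn U w D"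
proof -
  have e: "(\<lambda>y. tens (w y *\<^sub>C s y) (anchor_dual \<phi> y (differential A f y))) = (\<lambda>y u. \<phi> y u f *\<^sub>C (w y *\<^sub>C s y))"
    for f and s :: "'x \<Rightarrow> 'e"
    by (rule ext) (simp add: tens_def anchor_differential)
  have "gen_connection A V \<phi> (pbun P) U w D \<longleftrightarrow> conn U w D \<and> (\<exists>n. order_le A (pbun P) n U D)"
    unfolding gen_connection_def conn_def diff_operator_def e
    by (intro iffI; elim conjE; intro conjI; assumption)
  then show ?thesis using conn_order by blast
qed

lemma conn_0: "conn U w D \<Longrightarrow> open W \<Longrightarrow> W \<subseteq> U \<Longrightarrow> D W 0 = 0"
  using conn_add[of U w D 0 W 0] fsheaf_0[OF E.fsheaf, of W] by simp

lemma conn_sum: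
  assumes D: "conn U w D" and W: "open W" "W \<subseteq> U" and s: "\<And>i. i \<in> I \<Longrightarrow> s i \<in> hsec (pbun P) W"
  shows "D W (\<Sum>i\<in>I. s i) = (\<Sum>i\<in>I. D W (s i))"
  using s
  by (induction I rule: infinite_finite_induct)
    (auto simp: conn_0[OF D W] conn_add[OF D _ _ W] fsheaf_sum[OF E.fsheaf W(1)])

text \<open>The Leibniz rule on each term of the frame expansion. It separates the coefficients from
  their derivatives, which vanish for different reasons when this is evaluated at a point.\<close>

lemma conn_expand:
  assumes D: "conn U w D" and cf: "coframe A (pbun P) N I e \<kappa>" and W: "open W" "W \<subseteq> U" "W \<subseteq> N"
    and s: "s \<in> hsec (pbun P) W" and y: "y \<in> W"
  shows "D W s y u = (\<Sum>i\<in>I. \<kappa> i y (s y) *\<^sub>C D W (restr W (e i)) y u + \<phi> y u (\<lambda>y. \<kappa> i y (s y)) *\<^sub>C (w y *\<^sub>C e i y))"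
proof -
  have e: "restr W (e i) \<in> hsec (pbun P) W" if "i \<in> I" for i
    by (rule fsheaf_restr[OF E.fsheaf coframe_sec[OF cf that] coframe_open[OF cf] W(1,3)])
  have c: "(\<lambda>y. \<kappa> i y (s y)) \<in> holfun A W" if "i \<in> I" for i
    by (rule dual_hsec_app[OF coframe_dual[OF cf that] s W(1,3)])
  have "s = (\<Sum>i\<in>I. fmul (\<lambda>y. \<kappa> i y (s y)) (restr W (e i)))"
  proof
    fix y show "s y = (\<Sum>i\<in>I. fmul (\<lambda>y. \<kappa> i y (s y)) (restr W (e i))) y"
      using fun_cong[OF E.coframe_expand_sec[OF cf W(1,3) s], of y] fsheaf_out[OF E.fsheaf s W(1), of y]
      by (cases "y \<in> W") (auto simp: fun_sum_apply fmul_def)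
  qed
  then have "D W s = (\<Sum>i\<in>I. D W (fmul (\<lambda>y. \<kappa> i y (s y)) (restr W (e i))))"
    using conn_sum[OF D W(1,2), of I "\<lambda>i. fmul (\<lambda>y. \<kappa> i y (s y)) (restr W (e i))"]
      fsheaf_fmul[OF E.fsheaf W(1) c e] by simp
  then show ?thesis using y by (simp add: fun_sum_apply conn_leibniz_at[OF D c e W(1,2)])
qed

text \<open>
  At the points of \<open>S\<close> and at the zeros of the weight, the derivative term of the Leibniz rule drops out,
  so that a connection acts there on the values of sections.
\<close>

lemma conn_vanish:
  assumes D: "conn U w D" and W: "open W" "W \<subseteq> U" and s: "s \<in> hsec (pbun P) W"
    and x: "x \<in> S \<or> w x = 0" "x \<in> W" and 0: "s x = 0"
  shows "D W s x = 0"
proof -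
  obtain N and r :: nat and e \<kappa> where cf: "x \<in> N" "coframe A (pbun P) N {..<r} e \<kappa>"
    using E.coframe_exists by blast
  let ?W = "N \<inter> W"
  have W': "open ?W" "?W \<subseteq> U" "?W \<subseteq> N" using W coframe_open[OF cf(2)] by auto
  have s': "restr ?W s \<in> hsec (pbun P) ?W" by (rule fsheaf_restr[OF E.fsheaf s W(1) W'(1)]) auto
  have k: "\<kappa> i x 0 = 0" if "i < r" for i
    using linear_maps_0[OF E.coframe_lin[OF cf(2,1)], of i] that by simp
  have "D ?W (restr ?W s) x = 0"
  proof
    fix u show "D ?W (restr ?W s) x u = 0 u"
      using cf(1) x 0 by (auto simp: conn_expand[OF D cf(2) W' s'] k anchor_vanish)
  qed
  then show ?thesis using conn_restr[OF D s W W'(1)] cf(1) x by simp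
qed

text \<open>On the overlap the difference of the two sections vanishes at x, so its image does. The
  first alternative serves the points of S, the second one operators of weight 0 at every
  point.\<close>

lemma conn_value:
  assumes D: "conn U w D" and W: "open W" "W \<subseteq> U" and s: "s \<in> hsec (pbun P) W"
    and W': "open W'" "W' \<subseteq> U" and s': "s' \<in> hsec (pbun P) W'"
    and x: "x \<in> S \<or> w x = 0" "x \<in> W" "x \<in> W'" and eq: "s x = s' x"
  shows "D W s x = D W' s' x"
proof -
  let ?W = "W \<inter> W'"
  have o: "open ?W" "?W \<subseteq> U" "?W \<subseteq> W" "?W \<subseteq> W'" using W W' by auto
  let ?s = "restr ?W s" and ?s' = "restr ?W s'"
  have r: "?s \<in> hsec (pbun P) ?W" "?s' \<in> hsec (pbun P) ?W"
    by (rule fsheaf_restr[OF E.fsheaf s W(1) o(1,3)], rule fsheaf_restr[OF E.fsheaf s' W'(1) o(1,4)])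
  have d: "?s - ?s' \<in> hsec (pbun P) ?W" by (rule fsheaf_diff[OF E.fsheaf o(1) r])
  have "D ?W (?s - ?s') x = 0"
    by (rule conn_vanish[OF D o(1,2) d x(1)]) (use x eq in auto)
  moreover have "D ?W ?s = D ?W (?s - ?s') + D ?W ?s'"
    using conn_add[OF D d r(2) o(1,2)] by simp
  ultimately have "D ?W ?s x = D ?W ?s' x" by simp
  then show ?thesis using conn_restr[OF D s W o(1,3)] conn_restr[OF D s' W' o(1,4)] x by simp
qed

text \<open>The representative of the class \<open>psi\<close> at the i-th weight. At points of S it
  is the only one, since the conormal space is zero there.\<close>

definition \<theta> :: "'x \<Rightarrow> nat \<Rightarrow> 'v \<Rightarrow> complex" where
  "\<theta> x i = log_anchor_dual_at A S V \<phi> x (complex_of_real (pwt P x i))"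

text \<open>The parabolic condition with its quotients unfolded and evaluated on u: on the i-th
  graded piece the connection acts as w(x) \<theta>. Stability of step i under D is contained in it,
  since the subtracted vector lies in step i and the difference in a smaller step.\<close>

definition par :: "'x set \<Rightarrow> ('x \<Rightarrow> complex) \<Rightarrow> ('x, 'v, 'e) operator \<Rightarrow> bool" where
  "par U w D \<longleftrightarrow> (\<forall>x\<in>S \<inter> U. \<forall>i\<in>{1..plen P x}. \<forall>W s u. open W \<and> W \<subseteq> U \<and> x \<in> W \<and>
     s \<in> hsec (pbun P) W \<and> s x \<in> pfil P x i \<and> u \<in> fib V x \<longrightarrow>
     D W s x u - \<theta> x i u *\<^sub>C (w x *\<^sub>C s x) \<in> pfil P x (Suc i))"

lemma parI:
  "(\<And>x i W s u. x \<in> S \<Longrightarrow> x \<in> U \<Longrightarrow> i \<in> {1..plen P x} \<Longrightarrow> open W \<Longrightarrow> W \<subseteq> U \<Longrightarrow> x \<in> W \<Longrightarrow>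
     s \<in> hsec (pbun P) W \<Longrightarrow> s x \<in> pfil P x i \<Longrightarrow> u \<in> fib V x \<Longrightarrow>
     D W s x u - \<theta> x i u *\<^sub>C (w x *\<^sub>C s x) \<in> pfil P x (Suc i)) \<Longrightarrow> par U w D"
  unfolding par_def by simp

lemma parD:
  "par U w D \<Longrightarrow> x \<in> S \<Longrightarrow> x \<in> W \<Longrightarrow> i \<in> {1..plen P x} \<Longrightarrow> open W \<Longrightarrow> W \<subseteq> U \<Longrightarrow>
     s \<in> hsec (pbun P) W \<Longrightarrow> s x \<in> pfil P x i \<Longrightarrow> u \<in> fib V x \<Longrightarrow>
     D W s x u - \<theta> x i u *\<^sub>C (w x *\<^sub>C s x) \<in> pfil P x (Suc i)"
  unfolding par_def by blast

lemma theta_lin: "x \<in> S \<Longrightarrow> \<theta> x i \<in> linear_maps (fib V x) UNIV"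
proof -
  assume x: "x \<in> S"
  obtain W z d \<Psi> where p: "log_pull x W z d \<Psi>" using log_pull_exists[OF x, of UNIV] by auto
  then have "coord x W z d" "\<Psi> \<in> hsec (dual_bundle A V) W" by (auto simp: log_pull_def)
  then have "\<Psi> x \<in> linear_maps (fib V x) UNIV" using dual_hsec_lin coord_mem by blast
  then show ?thesis unfolding \<theta>_def log_anchor_dual_at_eq[OF p]
    by (rule subspace_scale[OF subspace_linear_maps[OF complex_vector.subspace_UNIV]])
qed

lemma psi_eq: "x \<in> S \<Longrightarrow> psi A S V \<phi> x (complex_of_real (pwt P x i)) = {\<theta> x i}"
  by (simp add: psi_def quot_q_def conormal_zero coset_zero \<theta>_def)

text \<open>The summand with the conormal space vanishes, and the other one is a space of linear
  maps.\<close>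

lemma gr_denom_eq:
  assumes "x \<in> S" "complex_vector.subspace G"
  shows "gr_denom A V \<phi> x F G = linear_maps (fib V x) G"
  unfolding gr_denom_def conormal_zero[OF assms(1)] tensor_space_zero tensor_space_dual[OF assms(2)] by simp

text \<open>Modulo a zero conormal space a coset is a point, and \<open>conn_value\<close> makes
  this point independent of the section chosen through s x.\<close>

lemma residual_map_eq:
  assumes D: "conn U w D" and W: "open W" "W \<subseteq> U" and s: "s \<in> hsec (pbun P) W"
    and x: "x \<in> S" "x \<in> W"
  shows "residual_map A \<phi> (pbun P) U D x (s x) = {D W s x}"
  unfolding residual_map_def conormal_zero[OF x(1)] tensor_space_zero coset_zero
proof (rule the_equality)
  show "\<exists>W' s'. open W' \<and> W' \<subseteq> U \<and> x \<in> W' \<and> s' \<in> hsec (pbun P) W' \<and> s' x = s x \<and> {D W s x} = {D W' s' x}"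
    using W s x by blast
  fix C assume "\<exists>W' s'. open W' \<and> W' \<subseteq> U \<and> x \<in> W' \<and> s' \<in> hsec (pbun P) W' \<and> s' x = s x \<and> C = {D W' s' x}"
  then obtain W' s' where "open W'" "W' \<subseteq> U" "x \<in> W'" "s' \<in> hsec (pbun P) W'" "s' x = s x" "C = {D W' s' x}"
    by blast
  then show "C = {D W s x}" using conn_value[OF D W s _ _ _ disjI1[OF x(1)] x(2), of W' s'] by simp
qed

text \<open>The sheaf condition is tested on local sections of V, but it constrains only values at
  x. Extending a vector u of the fibre to a local section gives the fibrewise form, and evaluation
  gives the converse.\<close>

lemma gen_quasi_parabolic_iff:
  "gen_quasi_parabolic A S V \<phi> P U w D \<longleftrightarrow> conn U w D \<and>
    (\<forall>x\<in>S \<inter> U. \<forall>i\<in>{1..Suc (plen P x)}. \<forall>W s. open W \<and> W \<subseteq> U \<and> x \<in> W \<and> s \<in> hsec (pbun P) W \<and> s x \<in> pfil P x i \<longrightarrow>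
       D W s x \<in> linear_maps (fib V x) (pfil P x i))"
proof -
  have "D W ` fil_sheaf P x i W \<subseteq> twist V (pbun P) (fil_sheaf P x i) W \<longleftrightarrow>
     (\<forall>s. x \<in> W \<and> s \<in> hsec (pbun P) W \<and> s x \<in> pfil P x i \<longrightarrow> D W s x \<in> linear_maps (fib V x) (pfil P x i))"
    (is "?l \<longleftrightarrow> ?r") if D: "conn U w D" and x: "x \<in> S" "i \<in> {1..Suc (plen P x)}" and W: "open W" "W \<subseteq> U" for x i W
  proof
    assume l: ?l
    show ?r
    proof (intro allI impI; elim conjE)
      fix s assume xW: "x \<in> W" and s: "s \<in> hsec (pbun P) W" "s x \<in> pfil P x i"
      have t: "D W s \<in> twist V (pbun P) (fil_sheaf P x i) W" using l s by (auto simp: fil_sheaf_def)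
      then have lin: "D W s x \<in> linear_maps (fib V x) (fib (pbun P) x)"
        using hom_hsec_lin xW by (fastforce simp: twist_def)
      show "D W s x \<in> linear_maps (fib V x) (pfil P x i)"
      proof (rule linear_mapsI)
        fix u assume u: "u \<in> fib V x"
        obtain N t' where t': "t' \<in> hsec V N" "open N" "x \<in> N" "N \<subseteq> W" "t' x = u"
          by (rule section_through[OF W(1) xW u])
        have "(\<lambda>y. D W s y (t' y)) \<in> fil_sheaf P x i N"
          using t[unfolded twist_def mem_Collect_eq, THEN conjunct2, THEN spec, THEN spec, THEN mp] t' by simp
        then show "D W s x u \<in> pfil P x i" using t' by (auto simp: fil_sheaf_def)
      qed (use linear_mapsD[OF lin] in auto)
    qed
  next
    assume r: ?r
    show ?l
    proof (rule image_subsetI)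
      fix s assume "s \<in> fil_sheaf P x i W"
      then have s: "s \<in> hsec (pbun P) W" "x \<in> W \<Longrightarrow> s x \<in> pfil P x i" by (auto simp: fil_sheaf_def)
      have Ds: "D W s \<in> hsec (hom_bundle V (pbun P)) W" by (rule conn_sec[OF D s(1) W])
      have "(\<lambda>y. D W s y (t y)) \<in> fil_sheaf P x i W'" if W': "open W'" "W' \<subseteq> W" and t: "t \<in> hsec V W'" for W' t
      proof -
        have "D W s x (t x) \<in> pfil P x i" if "x \<in> W'"
          using r s W' that hsec_fib[OF t W'(1) that] by (meson linear_maps_mem subsetD)
        then show ?thesis using hom_hsec_app[OF Ds t W'] by (simp add: fil_sheaf_def)
      qed
      then show "D W s \<in> twist V (pbun P) (fil_sheaf P x i) W" using Ds by (simp add: twist_def)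
    qed
  qed
  then show ?thesis unfolding gen_quasi_parabolic_def gen_connection_iff by (simp cong: conj_cong) blast
qed

text \<open>After the identifications above, equality of the graded maps says that D s minus the
  tensor of w s with \<theta> sends the fibre of V into step i + 1, which is \<open>par\<close>. In
  the converse direction the quasi-parabolic condition has to be recovered, including the zero step,
  which \<open>par\<close> does not address.\<close>

lemma gen_parabolic_iff:
  assumes U: "open U"
  shows "gen_parabolic A S V \<phi> P U w D \<longleftrightarrow> conn U w D \<and> par U w D"
proof
  have graded: "graded_map A V \<phi> P U D x i (s x) =
      gr_tens A V \<phi> x (pfil P x i) (pfil P x (i + 1)) (w x *\<^sub>C s x) (psi A S V \<phi> x (complex_of_real (pwt P x i))) \<longleftrightarrow>
      D W s x - tens (w x *\<^sub>C s x) (\<theta> x i) \<in> linear_maps (fib V x) (pfil P x (Suc i))"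
    if D: "conn U w D" and x: "x \<in> S" "x \<in> W" "i \<in> {1..plen P x}" and W: "open W" "W \<subseteq> U"
      and s: "s \<in> hsec (pbun P) W" "D W s x \<in> linear_maps (fib V x) (pfil P x i)" for x i W s
  proof -
    have sub: "complex_vector.subspace (pfil P x (Suc i))" "complex_vector.subspace (pfil P x i)"
      using fil_subspace[OF x(1)] x(3) by auto
    \<comment> \<open>The choices by \<open>SOME\<close> become determined: the residual value is a
      singleton whose element already takes values in step i, and below the class \<open>psi\<close>
      is a singleton as well.\<close>
    have "graded_map A V \<phi> P U D x i (s x) = coset (linear_maps (fib V x) (pfil P x (Suc i))) (D W s x)"
      unfolding graded_map_def residual_map_eq[OF D W s(1) x(1,2)] tensor_space_dual[OF sub(2)]
      using s(2) sub(1) by (simp add: gr_denom_eq[OF x(1)] conj_commute cong: conj_cong)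
    moreover have "gr_tens A V \<phi> x (pfil P x i) (pfil P x (i + 1)) (w x *\<^sub>C s x)
        (psi A S V \<phi> x (complex_of_real (pwt P x i))) =
      coset (linear_maps (fib V x) (pfil P x (Suc i))) (tens (w x *\<^sub>C s x) (\<theta> x i))"
      using sub(1) by (simp add: gr_tens_def gr_denom_eq[OF x(1)] psi_eq[OF x(1)])
    ultimately show ?thesis using coset_eq_iff[OF subspace_linear_maps[OF sub(1)]] by metis
  qed
  show "conn U w D \<and> par U w D" if g: "gen_parabolic A S V \<phi> P U w D"
  proof
    note q = g[unfolded gen_parabolic_def, THEN conjunct1, unfolded gen_quasi_parabolic_iff]
    show D: "conn U w D" by (rule q[THEN conjunct1])
    show "par U w D"
    proof (rule parI)
      fix x i W s u
      assume x: "x \<in> S" "x \<in> U" and i: "i \<in> {1..plen P x}" and W: "open W" "W \<subseteq> U" "x \<in> W"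
        and s: "s \<in> hsec (pbun P) W" "s x \<in> pfil P x i" and u: "u \<in> fib V x"
      have i': "i \<in> {1..Suc (plen P x)}" using i by simp
      have l: "D W s x \<in> linear_maps (fib V x) (pfil P x i)"
        using q[THEN conjunct2, THEN bspec, OF IntI[OF x], THEN bspec, OF i'] W s by blast
      have "graded_map A V \<phi> P U D x i (s x) =
        gr_tens A V \<phi> x (pfil P x i) (pfil P x (i + 1)) (w x *\<^sub>C s x) (psi A S V \<phi> x (complex_of_real (pwt P x i)))"
        using g[unfolded gen_parabolic_def, THEN conjunct2] x i s(2) by simp
      then have "D W s x - tens (w x *\<^sub>C s x) (\<theta> x i) \<in> linear_maps (fib V x) (pfil P x (Suc i))"
        using graded[OF D x(1) W(3) i W(1,2) s(1) l] by simp
      from linear_maps_mem[OF this u] show "D W s x u - \<theta> x i u *\<^sub>C (w x *\<^sub>C s x) \<in> pfil P x (Suc i)"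
        by (simp add: tens_def)
    qed
  qed
  show "gen_parabolic A S V \<phi> P U w D" if c: "conn U w D \<and> par U w D"
  proof -
    have D: "conn U w D" and p: "par U w D" using c by auto
    have ED: "D W s x \<in> linear_maps (fib V x) (fib (pbun P) x)"
      if "open W" "W \<subseteq> U" "x \<in> W" "s \<in> hsec (pbun P) W" for W s x
      using hom_hsec_lin[OF conn_sec[OF D that(4,1,2)] that(3)] .
    have mem: "D W s x \<in> linear_maps (fib V x) (pfil P x i)"
      if x: "x \<in> S" "i \<in> {1..Suc (plen P x)}" and W: "open W" "W \<subseteq> U" "x \<in> W"
        and s: "s \<in> hsec (pbun P) W" "s x \<in> pfil P x i" for W s x i
    proof (rule linear_mapsI)
      fix u assume u: "u \<in> fib V x"
      note sub = fil_subspace[OF x]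
      show "D W s x u \<in> pfil P x i"
      \<comment> \<open>The index plen + 1 is outside the range of \<open>par\<close>. There the
        step is zero, so s vanishes at x and hence D s does.\<close>
      proof (cases "i = Suc (plen P x)")
        case True
        then have "s x = 0" using s(2) fil_last[OF x(1)] by simp
        then show ?thesis using conn_vanish[OF D W(1,2) s(1) disjI1[OF x(1)] W(3)] subspace_0[OF sub] by simp
      next
        case False
        then have i: "i \<in> {1..plen P x}" using x(2) by auto
        have "D W s x u - \<theta> x i u *\<^sub>C (w x *\<^sub>C s x) \<in> pfil P x i"
          using parD[OF p x(1) W(3) i W(1,2) s u] fil_Suc[OF x(1) i] by blast
        moreover have "\<theta> x i u *\<^sub>C (w x *\<^sub>C s x) \<in> pfil P x i" using s(2) by (intro subspace_scale[OF sub])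
        ultimately show ?thesis using subspace_add[OF sub] by fastforce
      qed
    qed (use linear_mapsD[OF ED[OF W s(1)]] in auto)
    have "gen_quasi_parabolic A S V \<phi> P U w D"
      unfolding gen_quasi_parabolic_iff using D mem by blast
    moreover have "graded_map A V \<phi> P U D x i v =
        gr_tens A V \<phi> x (pfil P x i) (pfil P x (i + 1)) (w x *\<^sub>C v) (psi A S V \<phi> x (complex_of_real (pwt P x i)))"
      if x: "x \<in> S" "x \<in> U" and i: "i \<in> {1..plen P x}" and v: "v \<in> pfil P x i" for x i v
    proof -
      have i': "i \<in> {1..Suc (plen P x)}" using i by simp
      have vf: "v \<in> fib (pbun P) x" using fil_fib[OF x(1) i'] v by blast
      obtain W s where s: "s \<in> hsec (pbun P) W" "open W" "x \<in> W" "W \<subseteq> U" "s x = v"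
        by (rule E.section_through[OF U x(2) vf])
      have l: "D W s x \<in> linear_maps (fib V x) (pfil P x i)"
        using mem[OF x(1) i' s(2,4,3,1)] v s(5) by simp
      have tl: "tens (w x *\<^sub>C s x) (\<theta> x i) \<in> linear_maps (fib V x) (fib (pbun P) x)"
        by (rule tens_linear[OF theta_lin[OF x(1)] _ E.fib_subspace]) (use vf s(5) subspace_scale[OF E.fib_subspace] in auto)
      have dl: "D W s x - tens (w x *\<^sub>C s x) (\<theta> x i) \<in> linear_maps (fib V x) (fib (pbun P) x)"
        by (rule subspace_diff[OF subspace_linear_maps[OF E.fib_subspace] ED[OF s(2,4,3,1)] tl])
      have "D W s x - tens (w x *\<^sub>C s x) (\<theta> x i) \<in> linear_maps (fib V x) (pfil P x (Suc i))"
      proof (rule linear_mapsI)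
        fix u assume u: "u \<in> fib V x"
        show "(D W s x - tens (w x *\<^sub>C s x) (\<theta> x i)) u \<in> pfil P x (Suc i)"
          using parD[OF p x(1) s(3) i s(2,4,1) _ u] v s(5) by (simp add: tens_def)
      qed (use linear_mapsD[OF dl] in auto)
      then show ?thesis using graded[OF D x(1) s(3) i s(2,4,1) l] s(5) by simp
    qed
    ultimately show ?thesis unfolding gen_parabolic_def by simp
  qed
qed

end

section \<open>The sheaf of generalized parabolic connections\<close>

lemma is_omodI:
  fixes M :: "('x::t2_space, 's::ab_group_add) omod"
  assumes "\<And>U. open U \<Longrightarrow> 0 \<in> sec M U"
    and "\<And>U s t. open U \<Longrightarrow> s \<in> sec M U \<Longrightarrow> t \<in> sec M U \<Longrightarrow> s - t \<in> sec M U"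
    and "\<And>U f s. open U \<Longrightarrow> f \<in> holfun A U \<Longrightarrow> s \<in> sec M U \<Longrightarrow> smul M f s \<in> sec M U"
    and "\<And>f s t. smul M f (s + t) = smul M f s + smul M f t"
    and "\<And>f g s. smul M (f + g) s = smul M f s + smul M g s"
    and "\<And>f g s. smul M (fmul f g) s = smul M f (smul M g s)"
    and "\<And>U s. open U \<Longrightarrow> s \<in> sec M U \<Longrightarrow> smul M (restr U (\<lambda>_. 1)) s = s"
    and "\<And>U s. open U \<Longrightarrow> s \<in> sec M U \<Longrightarrow> res M U s = s"
    and "\<And>U W s. open U \<Longrightarrow> open W \<Longrightarrow> W \<subseteq> U \<Longrightarrow> s \<in> sec M U \<Longrightarrow> res M W s \<in> sec M W"
    and "\<And>W s t. res M W (s + t) = res M W s + res M W t"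
    and "\<And>U W f s. open U \<Longrightarrow> open W \<Longrightarrow> W \<subseteq> U \<Longrightarrow> s \<in> sec M U \<Longrightarrow>
      res M W (smul M f s) = smul M (restr W f) (res M W s)"
    and "\<And>W W' s. W' \<subseteq> W \<Longrightarrow> res M W' (res M W s) = res M W' s"
    and "\<And>\<U> t. (\<And>W. W \<in> \<U> \<Longrightarrow> open W) \<Longrightarrow> (\<And>W. W \<in> \<U> \<Longrightarrow> t W \<in> sec M W) \<Longrightarrow>
      (\<And>W W'. W \<in> \<U> \<Longrightarrow> W' \<in> \<U> \<Longrightarrow> res M (W \<inter> W') (t W) = res M (W \<inter> W') (t W')) \<Longrightarrow>
      \<exists>!s. s \<in> sec M (\<Union>\<U>) \<and> (\<forall>W\<in>\<U>. res M W s = t W)"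
  shows "is_omod A M"
  unfolding is_omod_def
proof (intro conjI allI impI ballI; (elim conjE)?)
  fix \<U> :: "'x set set" and t :: "'x set \<Rightarrow> 's"
  assume "\<forall>W\<in>\<U>. open W \<and> t W \<in> sec M W"
    "\<forall>W\<in>\<U>. \<forall>W'\<in>\<U>. res M (W \<inter> W') (t W) = res M (W \<inter> W') (t W')"
  then show "\<exists>!s. s \<in> sec M (\<Union>\<U>) \<and> (\<forall>W\<in>\<U>. res M W s = t W)"
    by (intro assms(13)) blast+
qed (simp_all add: assms(1-12))

section \<open>Module operations, restriction and gluing of connections\<close>

context parabolic_setup
begin

abbreviation "C \<equiv> conn_sheaf A S V \<phi> P"

lemma C_sec: "open U \<Longrightarrow> (w, D) \<in> sec C U \<longleftrightarrow> conn U w D \<and> par U w D"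
  by (simp add: conn_sheaf_def gen_parabolic_iff)

lemma C_res: "res C U (w, D) = (restr U w, \<lambda>W. if W \<subseteq> U then D W else 0)"
  by (simp add: conn_sheaf_def)

lemma C_smul: "smul C f (w, D) = (fmul f w, \<lambda>W s. fmul f (D W s))"
  by (simp add: conn_sheaf_def)

lemma conn_outside:
  assumes D: "conn U w D" and y: "y \<notin> W"
  shows "D W s y = 0"
proof (cases "open W \<and> W \<subseteq> U \<and> s \<in> hsec (pbun P) W")
  case True
  then show ?thesis using hom_hsec_out[OF conn_sec[OF D] y] by simp
qed (simp add: conn_out[OF D])

lemma conn_zero_pair: "open U \<Longrightarrow> conn U 0 0 \<and> par U 0 0"
  by (intro conjI connI parI)
    (auto simp: hol_0 fsheaf_0[OF fsheaf_homVE] fmul_def fun_eq_iff subspace_0[OF fil_subspace])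

lemma conn_diff:
  assumes D: "conn U w D" and D': "conn U w' D'"
  shows "conn U (w - w') (D - D')"
proof (rule connI)
  fix W s assume W: "open W" "W \<subseteq> U" and s: "s \<in> hsec (pbun P) W"
  show "(D - D') W s \<in> hsec (hom_bundle V (pbun P)) W"
    using fsheaf_diff[OF fsheaf_homVE W(1) conn_sec[OF D s W] conn_sec[OF D' s W]] by simp
  show "(D - D') W (s + t) = (D - D') W s + (D - D') W t" if t: "t \<in> hsec (pbun P) W" for t
    by (simp add: conn_add[OF D s t W] conn_add[OF D' s t W])
  show "(D - D') W' (restr W' s) = restr W' ((D - D') W s)" if "open W'" "W' \<subseteq> W" for W'
    by (simp add: conn_restr[OF D s W that] conn_restr[OF D' s W that] restr_diff)
  show "(D - D') W (fmul f s) = fmul f ((D - D') W s) + (\<lambda>y u. \<phi> y u f *\<^sub>C (w - w') y *\<^sub>C s y)"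
    if f: "f \<in> holfun A W" for f
  proof (intro ext)
    fix y u
    show "(D - D') W (fmul f s) y u = (fmul f ((D - D') W s) + (\<lambda>y u. \<phi> y u f *\<^sub>C (w - w') y *\<^sub>C s y)) y u"
      using conn_leibniz_at[OF D f s W, of y u] conn_leibniz_at[OF D' f s W, of y u]
      by (simp add: fmul_apply scaleC_diff_right scaleC_diff_left right_diff_distrib)
  qed
qed (auto simp: conn_out[OF D] conn_out[OF D'] intro: hol_diff conn_weight[OF D] conn_weight[OF D'])

lemma par_diff:
  assumes D: "par U w D" and D': "par U w' D'"
  shows "par U (w - w') (D - D')"
proof (rule parI)
  fix x i W s u
  assume a: "x \<in> S" "x \<in> U" "i \<in> {1..plen P x}" "open W" "W \<subseteq> U" "x \<in> W"
     "s \<in> hsec (pbun P) W" "s x \<in> pfil P x i" "u \<in> fib V x"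
  have sub: "complex_vector.subspace (pfil P x (Suc i))" using fil_subspace a(1,3) by auto
  have "(D W s x u - \<theta> x i u *\<^sub>C (w x *\<^sub>C s x)) - (D' W s x u - \<theta> x i u *\<^sub>C (w' x *\<^sub>C s x)) \<in> pfil P x (Suc i)"
    by (rule subspace_diff[OF sub parD[OF D a(1,6,3,4,5,7,8,9)] parD[OF D' a(1,6,3,4,5,7,8,9)]])
  then show "(D - D') W s x u - \<theta> x i u *\<^sub>C ((w - w') x *\<^sub>C s x) \<in> pfil P x (Suc i)"
    by (simp add: scaleC_diff_left right_diff_distrib algebra_simps)
qed

lemma conn_smul:
  assumes g: "g \<in> holfun A U" and D: "conn U w D"
  shows "conn U (fmul g w) (\<lambda>W s. fmul g (D W s))"
proof (rule connI)
  fix W s assume W: "open W" "W \<subseteq> U" and s: "s \<in> hsec (pbun P) W"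
  \<comment> \<open>g lives on U, but the values of D vanish off W, so g may be cut down to a
    function on W.\<close>
  have "fmul g (D W s) = fmul (restr W g) (D W s)"
    using conn_outside[OF D] by (intro ext) (auto simp: fmul_def restr_apply)
  then show "fmul g (D W s) \<in> hsec (hom_bundle V (pbun P)) W"
    using fsheaf_fmul[OF fsheaf_homVE W(1) hol_restr[OF g W(2)] conn_sec[OF D s W]] by simp
  show "fmul g (D W (s + t)) = fmul g (D W s) + fmul g (D W t)" if t: "t \<in> hsec (pbun P) W" for t
    by (rule ext) (simp add: conn_add[OF D s t W] fmul_def scaleC_add_right)
  show "fmul g (D W' (restr W' s)) = restr W' (fmul g (D W s))" if "open W'" "W' \<subseteq> W" for W'
    by (rule ext) (simp add: conn_restr[OF D s W that] fmul_def restr_apply)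
  show "fmul g (D W (fmul f s)) = fmul f (fmul g (D W s)) + (\<lambda>y u. \<phi> y u f *\<^sub>C fmul g w y *\<^sub>C s y)"
    if f: "f \<in> holfun A W" for f
  proof (intro ext)
    fix y u
    show "fmul g (D W (fmul f s)) y u = (fmul f (fmul g (D W s)) + (\<lambda>y u. \<phi> y u f *\<^sub>C fmul g w y *\<^sub>C s y)) y u"
      using conn_leibniz_at[OF D f s W, of y u] by (simp add: fmul_apply scaleC_add_right mult_ac)
  qed
next
  fix W s assume "\<not> (open W \<and> W \<subseteq> U \<and> s \<in> hsec (pbun P) W)"
  then have "D W s = 0" by (rule conn_out[OF D])
  then show "fmul g (D W s) = 0" by (auto simp: fmul_def fun_eq_iff)
qed (rule hol_fmul[OF g conn_weight[OF D]])

lemma par_smul: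
  assumes D: "par U w D"
  shows "par U (fmul g w) (\<lambda>W s. fmul g (D W s))"
proof (rule parI)
  fix x i W s u
  assume a: "x \<in> S" "x \<in> U" "i \<in> {1..plen P x}" "open W" "W \<subseteq> U" "x \<in> W"
     "s \<in> hsec (pbun P) W" "s x \<in> pfil P x i" "u \<in> fib V x"
  have sub: "complex_vector.subspace (pfil P x (Suc i))" using fil_subspace a(1,3) by auto
  show "fmul g (D W s) x u - \<theta> x i u *\<^sub>C (fmul g w x *\<^sub>C s x) \<in> pfil P x (Suc i)"
    using subspace_scale[OF sub parD[OF D a(1,6,3,4,5,7,8,9)], of "g x"]
    by (simp add: fmul_def scaleC_diff_right mult_ac)
qed

lemma conn_restrict:
  assumes D: "conn U w D" and N: "N \<subseteq> U"
  shows "conn N (restr N w) (\<lambda>W. if W \<subseteq> N then D W else 0)"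
proof (rule connI)
  fix W s assume W: "open W" "W \<subseteq> N" and s: "s \<in> hsec (pbun P) W"
  have WU: "W \<subseteq> U" using W N by auto
  show "(if W \<subseteq> N then D W else 0) s \<in> hsec (hom_bundle V (pbun P)) W"
    using conn_sec[OF D s W(1) WU] W by simp
  show "(if W \<subseteq> N then D W else 0) (s + t) = (if W \<subseteq> N then D W else 0) s + (if W \<subseteq> N then D W else 0) t"
    if t: "t \<in> hsec (pbun P) W" for t
    using conn_add[OF D s t W(1) WU] W by simp
  show "(if W' \<subseteq> N then D W' else 0) (restr W' s) = restr W' ((if W \<subseteq> N then D W else 0) s)"
    if W': "open W'" "W' \<subseteq> W" for W'
    using conn_restr[OF D s W(1) WU W'] W W' by auto
  show "(if W \<subseteq> N then D W else 0) (fmul f s) =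
      fmul f ((if W \<subseteq> N then D W else 0) s) + (\<lambda>y u. \<phi> y u f *\<^sub>C restr N w y *\<^sub>C s y)"
    if f: "f \<in> holfun A W" for f
  proof (intro ext)
    fix y u
    show "(if W \<subseteq> N then D W else 0) (fmul f s) y u =
      (fmul f ((if W \<subseteq> N then D W else 0) s) + (\<lambda>y u. \<phi> y u f *\<^sub>C restr N w y *\<^sub>C s y)) y u"
      using W conn_leibniz_at[OF D f s W(1) WU, of y u] fsheaf_out[OF E.fsheaf s W(1), of y]
      by (cases "y \<in> W") (auto simp: fmul_apply subsetD)
  qed
qed (auto simp: conn_out[OF D] intro: hol_restr[OF conn_weight[OF D] N])

lemma par_restrict:
  assumes D: "par U w D" and N: "N \<subseteq> U"
  shows "par N (restr N w) (\<lambda>W. if W \<subseteq> N then D W else 0)"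
proof (rule parI)
  fix x i W s u
  assume a: "x \<in> S" "x \<in> N" "i \<in> {1..plen P x}" "open W" "W \<subseteq> N" "x \<in> W"
     "s \<in> hsec (pbun P) W" "s x \<in> pfil P x i" "u \<in> fib V x"
  have "W \<subseteq> U" using a N by auto
  from parD[OF D a(1,6,3,4) this a(7,8,9)]
  show "(if W \<subseteq> N then D W else 0) s x u - \<theta> x i u *\<^sub>C (restr N w x *\<^sub>C s x) \<in> pfil P x (Suc i)"
    using a by simp
qed

text \<open>A section over W need not live inside a single member of the cover, so the glued
  operator is defined point by point: at y, restrict the section to W \<inter> N y and apply the
  operator of the member N y. Compatibility with restriction makes the choice of the member
  irrelevant.\<close>

lemma conn_glue:
  assumes op: "\<And>W. W \<in> \<U> \<Longrightarrow> open W"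
    and c: "\<And>W. W \<in> \<U> \<Longrightarrow> conn W (w W) (D W)" and p: "\<And>W. W \<in> \<U> \<Longrightarrow> par W (w W) (D W)"
    and eqw: "\<And>W W'. W \<in> \<U> \<Longrightarrow> W' \<in> \<U> \<Longrightarrow> restr (W \<inter> W') (w W) = restr (W \<inter> W') (w W')"
    and eqD: "\<And>W W' N. W \<in> \<U> \<Longrightarrow> W' \<in> \<U> \<Longrightarrow> N \<subseteq> W \<inter> W' \<Longrightarrow> D W N = D W' N"
  shows "\<exists>w' D'. conn (\<Union>\<U>) w' D' \<and> par (\<Union>\<U>) w' D' \<and> (\<forall>W\<in>\<U>. restr W w' = w W \<and>
    (\<lambda>N. if N \<subseteq> W then D' N else 0) = D W)"
proof -
  have "\<forall>y\<in>\<Union>\<U>. \<exists>W. W \<in> \<U> \<and> y \<in> W" by blast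
  then obtain N where N: "\<And>y. y \<in> \<Union>\<U> \<Longrightarrow> N y \<in> \<U> \<and> y \<in> N y" by metis
  define w' where "w' y = (if y \<in> \<Union>\<U> then w (N y) y else 0)" for y
  define D' where "D' W s y = (if open W \<and> W \<subseteq> \<Union>\<U> \<and> s \<in> hsec (pbun P) W \<and> y \<in> W
    then D (N y) (W \<inter> N y) (restr (W \<inter> N y) s) y else 0)" for W s y
  have w'M: "w' y = w M y" if "M \<in> \<U>" "y \<in> M" for M y
  proof -
    have y: "y \<in> \<Union>\<U>" using that by blast
    then have "restr (N y \<inter> M) (w (N y)) y = restr (N y \<inter> M) (w M) y" using eqw N that(1) by simp
    then show ?thesis using N[OF y] that(2) y by (simp add: w'_def)
  qed
  have D'M: "D' W s y = D M (W \<inter> M) (restr (W \<inter> M) s) y"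
    if W: "open W" "W \<subseteq> \<Union>\<U>" and s: "s \<in> hsec (pbun P) W" and M: "M \<in> \<U>" and y: "y \<in> W" "y \<in> M" for W s y M
  proof -
    have Ny: "N y \<in> \<U>" "y \<in> N y" using N[of y] y W by auto
    \<comment> \<open>The operators of two members are compared on this triple intersection, the
      place where the agreement hypothesis on common open subsets applies.\<close>
    let ?O = "W \<inter> M \<inter> N y"
    have step: "D L (W \<inter> L) (restr (W \<inter> L) s) y = D L ?O (restr ?O s) y" if L: "L \<in> \<U>" "?O \<subseteq> L" for L
    proof -
      have o: "open (W \<inter> L)" "open ?O" "?O \<subseteq> W \<inter> L" "W \<inter> L \<subseteq> L" using W op L M Ny by auto
      have "D L ?O (restr ?O (restr (W \<inter> L) s)) = restr ?O (D L (W \<inter> L) (restr (W \<inter> L) s))"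
        by (rule conn_restr[OF c[OF L(1)] fsheaf_restr[OF E.fsheaf s W(1) o(1)] o(1,4) o(2,3)]) auto
      then show ?thesis using y Ny by (simp add: restr_restr_subset[OF o(3)])
    qed
    have OM: "?O \<subseteq> M" by auto
    have "D (N y) ?O = D M ?O" by (rule eqD[OF Ny(1) M]) auto
    then show ?thesis using step[OF Ny(1)] step[OF M OM] W s y by (auto simp: D'_def)
  qed
  have out: "D' W s y = 0" if "y \<notin> W" for W s y using that by (simp add: D'_def)
  have oU: "open (\<Union>\<U>)" using op by blast
  have conn: "conn (\<Union>\<U>) w' D'"
  proof (rule connI)
    show "w' \<in> holfun A (\<Union>\<U>)"
    proof (rule hol_local[OF oU])
      fix x assume "x \<in> \<Union>\<U>"
      then obtain M where M: "M \<in> \<U>" "x \<in> M" by blast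
      have "restr M w' = w M"
        using w'M[OF M(1)] holfun_out[OF conn_weight[OF c[OF M(1)]]] by (intro ext) (auto simp: restr_apply)
      then show "\<exists>W. open W \<and> x \<in> W \<and> W \<subseteq> \<Union>\<U> \<and> restr W w' \<in> holfun A W"
        using M op conn_weight[OF c[OF M(1)]] by (intro exI[of _ M]) auto
    qed (simp add: w'_def)
    show "D' W s = 0" if "\<not> (open W \<and> W \<subseteq> \<Union>\<U> \<and> s \<in> hsec (pbun P) W)" for W s
      using that by (auto simp: D'_def fun_eq_iff)
    fix W s assume W: "open W" "W \<subseteq> \<Union>\<U>" and s: "s \<in> hsec (pbun P) W"
    have M: "\<exists>M. M \<in> \<U> \<and> y \<in> M" if "y \<in> W" for y using that W by blast
    have oM: "open (W \<inter> M)" "W \<inter> M \<subseteq> M" if "M \<in> \<U>" for M using W op that by auto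
    have sM: "restr (W \<inter> M) s \<in> hsec (pbun P) (W \<inter> M)" if "M \<in> \<U>" "s \<in> hsec (pbun P) W" for M s
      by (rule fsheaf_restr[OF E.fsheaf that(2) W(1) oM(1)[OF that(1)]]) auto
    show "D' W s \<in> hsec (hom_bundle V (pbun P)) W"
    proof (rule fsheaf_local[OF fsheaf_homVE W(1)])
      show "D' W s y = 0" if "y \<notin> W" for y by (rule out[OF that])
      fix x assume x: "x \<in> W"
      then obtain M where M: "M \<in> \<U>" "x \<in> M" using M by blast
      have "restr (W \<inter> M) (D' W s) = D M (W \<inter> M) (restr (W \<inter> M) s)"
        using D'M[OF W s M(1)] conn_outside[OF c[OF M(1)]] by (intro ext) (auto simp: restr_apply)
      then show "\<exists>W'. open W' \<and> x \<in> W' \<and> W' \<subseteq> W \<and> restr W' (D' W s) \<in> hsec (hom_bundle V (pbun P)) W'"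
        using conn_sec[OF c[OF M(1)] sM[OF M(1) s] oM[OF M(1)]] oM[OF M(1)] x M
        by (intro exI[of _ "W \<inter> M"]) auto
    qed
    show "D' W (s + t) = D' W s + D' W t" if t: "t \<in> hsec (pbun P) W" for t
    proof
      fix y
      show "D' W (s + t) y = (D' W s + D' W t) y"
      proof (cases "y \<in> W")
        case True
        then obtain M where M: "M \<in> \<U>" "y \<in> M" using M by blast
        show ?thesis
          using D'M[OF W s M(1) True M(2)] D'M[OF W t M(1) True M(2)]
            D'M[OF W fsheaf_add[OF E.fsheaf W(1) s t] M(1) True M(2)]
            conn_add[OF c[OF M(1)] sM[OF M(1) s] sM[OF M(1) t] oM[OF M(1)]]
          by (simp add: restr_add)
      qed (simp add: out)
    qed
    show "D' W (fmul f s) = fmul f (D' W s) + (\<lambda>y u. \<phi> y u f *\<^sub>C w' y *\<^sub>C s y)" if f: "f \<in> holfun A W" for f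
    proof (intro ext)
      fix y u
      show "D' W (fmul f s) y u = (fmul f (D' W s) + (\<lambda>y u. \<phi> y u f *\<^sub>C w' y *\<^sub>C s y)) y u"
      proof (cases "y \<in> W")
        case True
        then obtain M where M: "M \<in> \<U>" "y \<in> M" using M by blast
        have f': "restr (W \<inter> M) f \<in> holfun A (W \<inter> M)" by (rule hol_restr[OF f]) auto
        have "D' W (fmul f s) y u = D M (W \<inter> M) (fmul (restr (W \<inter> M) f) (restr (W \<inter> M) s)) y u"
          using D'M[OF W fsheaf_fmul[OF E.fsheaf W(1) f s] M(1) True M(2)] by (simp add: fmul_restr)
        also have "\<dots> = f y *\<^sub>C D' W s y u + \<phi> y u (restr (W \<inter> M) f) *\<^sub>C w' y *\<^sub>C s y"
          using conn_leibniz_at[OF c[OF M(1)] f' sM[OF M(1) s] oM[OF M(1)], of y u]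
            D'M[OF W s M(1) True M(2)] w'M[OF M] True M(2) by simp
        \<comment> \<open>A tangent vector sees only the germ of f, so cutting f down to a member of
          the cover leaves the Leibniz term unchanged.\<close>
        also have "\<phi> y u (restr (W \<inter> M) f) = \<phi> y u f"
          by (rule tangent_restr[OF anchor_tangent W(1) True f oM(1)[OF M(1)]]) (use True M in auto)
        finally show ?thesis unfolding plus_fun_apply fmul_apply scaleC_fun_apply .
      qed (use fsheaf_out[OF E.fsheaf s W(1)] in \<open>simp add: out fmul_apply\<close>)
    qed
    show "D' W' (restr W' s) = restr W' (D' W s)" if W': "open W'" "W' \<subseteq> W" for W'
    proof
      fix y
      show "D' W' (restr W' s) y = restr W' (D' W s) y"
      proof (cases "y \<in> W'")
        case True
        then obtain M where M: "M \<in> \<U>" "y \<in> M" using M W' by blast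
        have W'U: "W' \<subseteq> \<Union>\<U>" using W W' by blast
        have o: "open (W' \<inter> M)" "W' \<inter> M \<subseteq> W \<inter> M" "W' \<inter> M \<subseteq> W'" using W' op M by auto
        have "D' W' (restr W' s) y = D M (W' \<inter> M) (restr (W' \<inter> M) s) y"
          using D'M[OF W'(1) W'U fsheaf_restr[OF E.fsheaf s W(1) W'] M(1) True M(2)] o(3)
          by (simp add: restr_restr_subset)
        also have "\<dots> = D M (W \<inter> M) (restr (W \<inter> M) s) y"
          using conn_restr[OF c[OF M(1)] sM[OF M(1) s] oM[OF M(1)] o(1,2)] True M(2)
          by (simp add: restr_restr_subset[OF o(2)])
        also have "\<dots> = D' W s y" using D'M[OF W s M(1) _ M(2)] True W' by auto
        finally show ?thesis using True by simp
      qed (simp add: out)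
    qed
  qed
  have par: "par (\<Union>\<U>) w' D'"
  proof (rule parI)
    fix x i W s u
    assume a: "x \<in> S" "x \<in> \<Union>\<U>" "i \<in> {1..plen P x}" "open W" "W \<subseteq> \<Union>\<U>" "x \<in> W"
       "s \<in> hsec (pbun P) W" "s x \<in> pfil P x i" "u \<in> fib V x"
    then obtain M where M: "M \<in> \<U>" "x \<in> M" by blast
    have o: "open (W \<inter> M)" "W \<inter> M \<subseteq> M" "x \<in> W \<inter> M" using a op M by auto
    have "restr (W \<inter> M) s \<in> hsec (pbun P) (W \<inter> M)" by (rule fsheaf_restr[OF E.fsheaf a(7,4) o(1)]) auto
    from parD[OF p[OF M(1)] a(1) o(3) a(3) o(1,2) this _ a(9)]
    show "D' W s x u - \<theta> x i u *\<^sub>C (w' x *\<^sub>C s x) \<in> pfil P x (Suc i)"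
      using D'M[OF a(4,5,7) M(1) a(6) M(2)] w'M[OF M] a(8) o(3) by simp
  qed
  have "restr M w' = w M \<and> (\<lambda>N. if N \<subseteq> M then D' N else 0) = D M" if M: "M \<in> \<U>" for M
  proof (intro conjI ext)
    fix y show "restr M w' y = w M y"
      using w'M[OF M] holfun_out[OF conn_weight[OF c[OF M]]] by (auto simp: restr_apply)
  next
    fix W s y
    show "(if W \<subseteq> M then D' W else 0) s y u = D M W s y u" for u
    proof (cases "open W \<and> W \<subseteq> M \<and> s \<in> hsec (pbun P) W \<and> y \<in> W")
      case True
      then have "D' W s y = D M (W \<inter> M) (restr (W \<inter> M) s) y"
        using M by (intro D'M) auto
      moreover have "W \<inter> M = W" using True by blast
      moreover have "restr W s = s" using fsheaf_restr_self[OF E.fsheaf] True by blast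
      ultimately show ?thesis using True by simp
    next
      case False
      then have "D M W s y = 0" using conn_out[OF c[OF M]] conn_outside[OF c[OF M]] by (metis zero_fun_apply)
      moreover have "(if W \<subseteq> M then D' W else 0) s y = 0" using False M by (auto simp: D'_def)
      ultimately show ?thesis by metis
    qed
  qed
  then show ?thesis using conn par by blast
qed

text \<open>Operators commute with restriction, so the value at y of D on a section over W can be
  computed on W \<inter> M for any member M containing y.\<close>

lemma conn_unique:
  assumes op: "\<And>W. W \<in> \<U> \<Longrightarrow> open W"
    and c: "conn (\<Union>\<U>) w D" "conn (\<Union>\<U>) w' D'"
    and eqw: "\<And>W. W \<in> \<U> \<Longrightarrow> restr W w = restr W w'"
    and eqD: "\<And>W N. W \<in> \<U> \<Longrightarrow> N \<subseteq> W \<Longrightarrow> D N = D' N"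
  shows "w = w' \<and> D = D'"
proof (intro conjI ext)
  fix y show "w y = w' y"
  proof (cases "y \<in> \<Union>\<U>")
    case True
    then show ?thesis using eqw by (metis UnionE restr_in)
  qed (use holfun_out[OF conn_weight[OF c(1)]] holfun_out[OF conn_weight[OF c(2)]] in auto)
next
  fix W s y u
  show "D W s y u = D' W s y u"
  proof (cases "open W \<and> W \<subseteq> \<Union>\<U> \<and> s \<in> hsec (pbun P) W \<and> y \<in> W")
    case True
    then obtain M where M: "M \<in> \<U>" "y \<in> M" by blast
    have W: "open W" "W \<subseteq> \<Union>\<U>" "s \<in> hsec (pbun P) W" using True by auto
    have o: "open (W \<inter> M)" "W \<inter> M \<subseteq> W" using W op M by auto
    have "restr (W \<inter> M) (D W s) = restr (W \<inter> M) (D' W s)"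
      using conn_restr[OF c(1) W(3,1,2) o] conn_restr[OF c(2) W(3,1,2) o] eqD[OF M(1), of "W \<inter> M"] by simp
    from fun_cong[OF this, of y] show ?thesis using True M by simp
  next
    case False
    then show ?thesis
      using conn_out[OF c(1)] conn_out[OF c(2)] conn_outside[OF c(1)] conn_outside[OF c(2)] by (metis zero_fun_apply)
  qed
qed

lemma is_omod_conn: "is_omod A C"
proof (rule is_omodI; (simp only: split_paired_all)?)
  fix U :: "'x set" assume U: "open U"
  show "0 \<in> sec C U" unfolding zero_prod_def C_sec[OF U] by (rule conn_zero_pair[OF U])
  fix w D assume "(w, D) \<in> sec C U"
  then have D: "conn U w D" and p: "par U w D" by (auto simp: C_sec[OF U])
  show "(w, D) - (w', D') \<in> sec C U" if "(w', D') \<in> sec C U" for w' D'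
    using that conn_diff[OF D] par_diff[OF p] by (simp add: C_sec[OF U])
  show "smul C f (w, D) \<in> sec C U" if "f \<in> holfun A U" for f
    using conn_smul[OF that D] par_smul[OF p] by (simp add: C_smul C_sec[OF U])
  show "smul C (restr U (\<lambda>_. 1)) (w, D) = (w, D)"
  proof -
    have "restr U (\<lambda>_. 1) y *\<^sub>C D W s y = D W s y" for W s y
      using conn_outside[OF D, of y W s] conn_out[OF D, of W s]
      by (cases "W \<subseteq> U"; cases "y \<in> W") (auto simp: restr_apply)
    then show ?thesis using holfun_out[OF conn_weight[OF D]]
      by (auto simp: C_smul fmul_def fun_eq_iff restr_apply)
  qed
  show "res C U (w, D) = (w, D)"
    using holfun_out[OF conn_weight[OF D]] conn_out[OF D] by (auto simp: C_res fun_eq_iff restr_apply)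
  fix W :: "'x set" assume W: "open W" "W \<subseteq> U"
  show "res C W (w, D) \<in> sec C W"
    using conn_restrict[OF D W(2)] par_restrict[OF p W(2)] by (simp add: C_res C_sec[OF W(1)])
  show "res C W (smul C f (w, D)) = smul C (restr W f) (res C W (w, D))" for f
  proof -
    have "f y *\<^sub>C D W' s y = restr W f y *\<^sub>C D W' s y" if "W' \<subseteq> W" for W' s y
      using conn_outside[OF D, of y W' s] that by (cases "y \<in> W'") auto
    then show ?thesis by (auto simp: C_res C_smul fmul_restr fun_eq_iff) (auto simp: fmul_def)
  qed
next
  fix W W' :: "'x set" and w :: "'x \<Rightarrow> complex" and D :: "('x, 'v, 'e) operator"
  assume "W' \<subseteq> W"
  then show "res C W' (res C W (w, D)) = res C W' (w, D)"
    by (auto simp: C_res restr_restr_subset fun_eq_iff)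
next
  fix \<U> and t :: "'x set \<Rightarrow> ('x \<Rightarrow> complex) \<times> ('x, 'v, 'e) operator"
  assume op: "\<And>W. W \<in> \<U> \<Longrightarrow> open W" and t: "\<And>W. W \<in> \<U> \<Longrightarrow> t W \<in> sec C W"
    and eq: "\<And>W W'. W \<in> \<U> \<Longrightarrow> W' \<in> \<U> \<Longrightarrow> res C (W \<inter> W') (t W) = res C (W \<inter> W') (t W')"
  define w where "w W = fst (t W)" for W
  define D where "D W = snd (t W)" for W
  have tW: "t W = (w W, D W)" for W by (simp add: w_def D_def)
  have cp: "conn W (w W) (D W)" "par W (w W) (D W)" if "W \<in> \<U>" for W
    using t[OF that] C_sec[OF op[OF that]] by (auto simp: tW)
  have eqw: "restr (W \<inter> W') (w W) = restr (W \<inter> W') (w W')" if "W \<in> \<U>" "W' \<in> \<U>" for W W'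
    using eq[OF that] by (simp add: tW C_res)
  have eqD: "D W N = D W' N" if "W \<in> \<U>" "W' \<in> \<U>" "N \<subseteq> W \<inter> W'" for W W' N
  proof -
    have "(\<lambda>N. if N \<subseteq> W \<inter> W' then D W N else 0) = (\<lambda>N. if N \<subseteq> W \<inter> W' then D W' N else 0)"
      using eq[OF that(1,2)] by (simp add: tW C_res)
    from fun_cong[OF this, of N] show ?thesis using that(3) by simp
  qed
  have "\<exists>w' D'. conn (\<Union>\<U>) w' D' \<and> par (\<Union>\<U>) w' D' \<and> (\<forall>W\<in>\<U>. restr W w' = w W \<and>
    (\<lambda>N. if N \<subseteq> W then D' N else 0) = D W)"
    by (rule conn_glue[OF op cp eqw eqD])
  then obtain w' D' where g': "conn (\<Union>\<U>) w' D' \<and> par (\<Union>\<U>) w' D' \<and> (\<forall>W\<in>\<U>. restr W w' = w W \<and>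
    (\<lambda>N. if N \<subseteq> W then D' N else 0) = D W)" by (elim exE)
  then have g: "conn (\<Union>\<U>) w' D'" "par (\<Union>\<U>) w' D'"
    "\<And>W. W \<in> \<U> \<Longrightarrow> restr W w' = w W \<and> (\<lambda>N. if N \<subseteq> W then D' N else 0) = D W" by simp_all
  have oU: "open (\<Union>\<U>)" using op by blast
  show "\<exists>!s. s \<in> sec C (\<Union>\<U>) \<and> (\<forall>W\<in>\<U>. res C W s = t W)"
  proof (rule ex1I[of _ "(w', D')"])
    show "(w', D') \<in> sec C (\<Union>\<U>) \<and> (\<forall>W\<in>\<U>. res C W (w', D') = t W)"
      using g by (simp add: C_sec[OF oU] C_res tW)
    fix s assume s: "s \<in> sec C (\<Union>\<U>) \<and> (\<forall>W\<in>\<U>. res C W s = t W)"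
    obtain w2 D2 where s2: "s = (w2, D2)" by (cases s)
    have c2: "conn (\<Union>\<U>) w2 D2" using s by (simp add: s2 C_sec[OF oU])
    have r2: "restr W w2 = w W \<and> (\<lambda>N. if N \<subseteq> W then D2 N else 0) = D W" if "W \<in> \<U>" for W
      using s that by (simp add: s2 C_res tW)
    have "w2 = w' \<and> D2 = D'"
    proof (rule conn_unique[OF op c2 g(1)])
      show "restr W w2 = restr W w'" if "W \<in> \<U>" for W using r2[OF that] g(3)[OF that] by simp
      show "D2 N = D' N" if "W \<in> \<U>" "N \<subseteq> W" for W N
      proof -
        have "(\<lambda>N. if N \<subseteq> W then D2 N else 0) = (\<lambda>N. if N \<subseteq> W then D' N else 0)"
          using r2[OF that(1)] g(3)[OF that(1)] by simp
        from fun_cong[OF this, of N] show ?thesis using that(2) by simp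
      qed
    qed
    then show "s = (w', D')" by (simp add: s2)
  qed
qed (auto simp: C_res C_smul restr_add fun_eq_iff fmul_apply scaleC_add_right scaleC_add_left algebra_simps)

end

section \<open>The kernel of the weight map\<close>

context parabolic_setup
begin

abbreviation "EE \<equiv> hom_bundle (pbun P) (pbun P)"
abbreviation "L \<equiv> end_n_dual_sheaf S V P"

lemma fsheaf_EE: "fsheaf A (hsec EE)"
  by (rule fsheaf_hom)
    (auto intro: fsheaf_restr[OF E.fsheaf] E.fsheaf E.fib_subspace hol_restr dest: fsheaf_out[OF E.fsheaf])

lemma fsheaf_homVEE: "fsheaf A (hsec (hom_bundle V EE))"
  by (rule fsheaf_hom)
    (auto intro: fsheaf_restr[OF fsheaf] fsheaf_EE hol_restr subspace_linear_maps E.fib_subspace dest: fsheaf_out[OF fsheaf])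

text \<open>The condition defining \<open>end_n\<close> at the single point x, with the argument
  from V made explicit; it is vacuous off S.\<close>

definition lowering :: "'x \<Rightarrow> ('v \<Rightarrow> 'e \<Rightarrow> 'e) set" where
  "lowering x = {T. x \<in> S \<longrightarrow> (\<forall>u\<in>fib V x. \<forall>i\<in>{1..plen P x}. \<forall>v\<in>pfil P x i. T u v \<in> pfil P x (Suc i))}"

lemma lowering_subspace: "complex_vector.subspace (lowering x)"
  unfolding complex_vector.subspace_def lowering_def mem_Collect_eq
proof (intro conjI ballI allI impI)
  fix u :: 'v and i and v :: 'e assume x: "x \<in> S" and i: "i \<in> {1..plen P x}"
  have sub: "complex_vector.subspace (pfil P x (Suc i))" using fil_subspace[OF x] i by auto
  show "0 u v \<in> pfil P x (Suc i)" using subspace_0[OF sub] by simp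
  assume uv: "u \<in> fib V x" "v \<in> pfil P x i"
  fix T c assume T: "T \<in> {T. x \<in> S \<longrightarrow> (\<forall>u\<in>fib V x. \<forall>i\<in>{1..plen P x}. \<forall>v\<in>pfil P x i. T u v \<in> pfil P x (Suc i))}"
  show "(c *\<^sub>C T) u v \<in> pfil P x (Suc i)" using T x i uv by (auto intro: subspace_scale[OF sub])
  fix T' assume T': "T' \<in> {T. x \<in> S \<longrightarrow> (\<forall>u\<in>fib V x. \<forall>i\<in>{1..plen P x}. \<forall>v\<in>pfil P x i. T u v \<in> pfil P x (Suc i))}"
  show "(T + T') u v \<in> pfil P x (Suc i)" using T T' x i uv by (auto intro: subspace_add[OF sub])
qed

text \<open>\<open>twist\<close> tests a section by applying it to local sections of V. Every vector
  of a fibre of V extends locally, so the test can be made vector by vector.\<close>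

lemma L_sec:
  assumes U: "open U"
  shows "T \<in> sec L U \<longleftrightarrow> T \<in> hsec (hom_bundle V EE) U \<and> (\<forall>x\<in>U. T x \<in> lowering x)"
proof
  assume "T \<in> sec L U"
  then have t: "T \<in> twist V EE (end_n S P) U" by (simp add: end_n_dual_sheaf_def section_sheaf_def)
  have "T x u v \<in> pfil P x (Suc i)"
    if x: "x \<in> U" "x \<in> S" and u: "u \<in> fib V x" and i: "i \<in> {1..plen P x}" and v: "v \<in> pfil P x i" for x u i v
  proof -
    obtain N s where s: "s \<in> hsec V N" "open N" "x \<in> N" "N \<subseteq> U" "s x = u"
      by (rule section_through[OF U x(1) u])
    have "(\<lambda>y. T y (s y)) \<in> end_n S P N"
      using t[unfolded twist_def mem_Collect_eq, THEN conjunct2, THEN spec, THEN spec, THEN mp] s by simp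
    then have "T x (s x) ` pfil P x i \<subseteq> pfil P x (i + 1)"
      using x(2) s(3) i unfolding end_n_def mem_Collect_eq by blast
    then show ?thesis using v s(5) by auto
  qed
  then show "T \<in> hsec (hom_bundle V EE) U \<and> (\<forall>x\<in>U. T x \<in> lowering x)"
    using t by (auto simp: twist_def lowering_def)
next
  assume a: "T \<in> hsec (hom_bundle V EE) U \<and> (\<forall>x\<in>U. T x \<in> lowering x)"
  have "(\<lambda>y. T y (t y)) \<in> end_n S P W" if W: "open W" "W \<subseteq> U" and t: "t \<in> hsec V W" for W t
    unfolding end_n_def mem_Collect_eq
  proof (intro conjI ballI)
    show "(\<lambda>y. T y (t y)) \<in> hsec EE W" using hom_hsec_app[OF conjunct1[OF a] t W] .
    show "T x (t x) ` pfil P x i \<subseteq> pfil P x (i + 1)" if x: "x \<in> S \<inter> W" "i \<in> {1..plen P x}" for x i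
      using a x hsec_fib[OF t W(1)] W(2) by (auto simp: lowering_def)
  qed
  then show "T \<in> sec L U" using a by (auto simp: end_n_dual_sheaf_def section_sheaf_def twist_def)
qed

lemma fsheaf_L: "fsheaf A (sec L)"
proof (rule fsheafI)
  fix U :: "'x set" assume U: "open U"
  show "0 \<in> sec L U" by (simp add: L_sec[OF U] fsheaf_0[OF fsheaf_homVEE U] subspace_0[OF lowering_subspace])
  show "s y = 0" if "s \<in> sec L U" "y \<notin> U" for s y
    using fsheaf_out[OF fsheaf_homVEE _ U that(2)] that(1) L_sec[OF U] by blast
  show "s - t \<in> sec L U" if "s \<in> sec L U" "t \<in> sec L U" for s t
    using that by (auto simp: L_sec[OF U] intro: fsheaf_diff[OF fsheaf_homVEE U] subspace_diff[OF lowering_subspace])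
  show "fmul f s \<in> sec L U" if "f \<in> holfun A U" "s \<in> sec L U" for f s
    using that by (auto simp: L_sec[OF U] fmul_apply intro: fsheaf_fmul[OF fsheaf_homVEE U] subspace_scale[OF lowering_subspace])
  show "restr W s \<in> sec L W" if "open W" "W \<subseteq> U" "s \<in> sec L U" for W s
    using that by (auto simp: L_sec U intro: fsheaf_restr[OF fsheaf_homVEE _ U])
next
  fix U :: "'x set" and s assume U: "open U" and out: "\<And>y. y \<notin> U \<Longrightarrow> s y = 0"
    and loc: "\<And>x. x \<in> U \<Longrightarrow> \<exists>W. open W \<and> x \<in> W \<and> W \<subseteq> U \<and> restr W s \<in> sec L W"
  have "s \<in> hsec (hom_bundle V EE) U"
  proof (rule fsheaf_local[OF fsheaf_homVEE U out])
    fix x assume "x \<in> U"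
    with loc obtain W where "open W" "x \<in> W" "W \<subseteq> U" "restr W s \<in> sec L W" by blast
    then show "\<exists>W. open W \<and> x \<in> W \<and> W \<subseteq> U \<and> restr W s \<in> hsec (hom_bundle V EE) W"
      by (intro exI[of _ W]) (simp add: L_sec)
  qed
  moreover have "s x \<in> lowering x" if x: "x \<in> U" for x
  proof -
    from loc[OF x] obtain W where "open W" "x \<in> W" "restr W s \<in> sec L W" by blast
    then have "restr W s x \<in> lowering x" using L_sec by blast
    then show ?thesis using \<open>x \<in> W\<close> by simp
  qed
  ultimately show "s \<in> sec L U" by (simp add: L_sec[OF U])
qed

lemma L_sheaf: "section_sheaf (sec L) = L"
  by (simp add: end_n_dual_sheaf_def section_sheaf_def)

lemma L_res: "res L = restr" and L_smul: "smul L = fmul"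
  by (simp_all add: end_n_dual_sheaf_def section_sheaf_def)

lemma L_lin: "T \<in> sec L U \<Longrightarrow> open U \<Longrightarrow> y \<in> U \<Longrightarrow> u \<in> fib V y \<Longrightarrow> T y u \<in> linear_maps (fib (pbun P) y) (fib (pbun P) y)"
  using hom_hsec_lin[of T V EE U y] linear_maps_mem by (fastforce simp: L_sec)

lemma L_zero:
  assumes T: "T \<in> sec L U" and U: "open U"
  shows "T y u 0 = 0"
proof (cases "y \<in> U \<and> u \<in> fib V y")
  case True
  then show ?thesis using linear_maps_0[OF L_lin[OF T U]] by blast
next
  case False
  have "T \<in> hsec (hom_bundle V EE) U" using T by (simp add: L_sec[OF U])
  then show ?thesis using False hom_hsec_out[of T V EE U y] linear_maps_out[OF hom_hsec_lin[of T V EE U y], of u]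
    by (cases "y \<in> U") auto
qed

definition op :: "'x set \<Rightarrow> ('x \<Rightarrow> 'v \<Rightarrow> 'e \<Rightarrow> 'e) \<Rightarrow> ('x, 'v, 'e) operator" where
  "op U T = (\<lambda>W s. if open W \<and> W \<subseteq> U \<and> s \<in> hsec (pbun P) W then (\<lambda>y u. T y u (s y)) else 0)"

lemma end_incl_op: "end_incl P U T = (0, op U T)"
  by (simp add: end_incl_def op_def)

text \<open>An operator of order 0 obeys the Leibniz rule with weight 0. With weight 0 the
  \<theta>-term of \<open>par\<close> disappears and the lowering condition remains.\<close>

lemma op_conn:
  assumes T: "T \<in> sec L U" and U: "open U"
  shows "conn U 0 (op U T) \<and> par U 0 (op U T)"
proof
  have T': "T \<in> hsec (hom_bundle V EE) U" using T by (simp add: L_sec[OF U])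
  show "conn U 0 (op U T)"
  proof (rule connI)
    fix W s assume W: "open W" "W \<subseteq> U" and s: "s \<in> hsec (pbun P) W"
    have op: "op U T W s = (\<lambda>y u. T y u (s y))" if "s \<in> hsec (pbun P) W" for s using W that by (simp add: op_def)
    show "op U T W s \<in> hsec (hom_bundle V (pbun P)) W"
      unfolding op[OF s]
    proof (rule hom_hsecI)
      fix y assume y: "y \<in> W"
      then have yU: "y \<in> U" using W by blast
      note l = hom_hsec_lin[OF T' yU]
      show "(\<lambda>u. T y u (s y)) \<in> linear_maps (fib V y) (fib (pbun P) y)"
        by (rule linear_mapsI)
          (use linear_maps_mem[OF L_lin[OF T U yU] E.hsec_fib[OF s W(1) y]] in
            \<open>auto simp: linear_maps_out[OF l] linear_maps_add[OF l] linear_maps_scale[OF l]\<close>)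
    next
      show "(\<lambda>u. T y u (s y)) = 0" if "y \<notin> W" for y
        using fsheaf_out[OF E.fsheaf s W(1) that] L_zero[OF T U] by (auto simp: fun_eq_iff)
      fix W' t assume W': "open W'" "W' \<subseteq> W" and t: "t \<in> hsec V W'"
      have "(\<lambda>y. T y (t y)) \<in> hsec EE W'" using hom_hsec_app[OF T' t W'(1)] W W' by blast
      from hom_hsec_app[OF this fsheaf_restr[OF E.fsheaf s W(1) W'] W'(1) order_refl]
      have "(\<lambda>y. T y (t y) (restr W' s y)) \<in> hsec (pbun P) W'" .
      moreover have "T y (t y) (restr W' s y) = T y (t y) (s y)" for y
        using fsheaf_out[OF fsheaf t W'(1), of y] linear_maps_0[OF hom_hsec_lin[OF T', of y]] hom_hsec_out[OF T', of y]
        by (cases "y \<in> W'"; cases "y \<in> U") auto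
      ultimately show "(\<lambda>y. T y (t y) (s y)) \<in> hsec (pbun P) W'" by simp
    qed
    have lin: "T y u (a + b) = T y u a + T y u b" "T y u (c *\<^sub>C a) = c *\<^sub>C T y u a"
      if "a \<in> fib (pbun P) y" "b \<in> fib (pbun P) y" "y \<in> W" for y u a b c
    proof -
      have yU: "y \<in> U" using that W by blast
      show "T y u (a + b) = T y u a + T y u b" "T y u (c *\<^sub>C a) = c *\<^sub>C T y u a"
        using linear_maps_add[OF L_lin[OF T U yU] that(1,2)] linear_maps_scale[OF L_lin[OF T U yU] that(1)]
          linear_maps_out[OF hom_hsec_lin[OF T' yU], of u] by (cases "u \<in> fib V y"; simp)+
    qed
    show "op U T W (s + t) = op U T W s + op U T W t" if t: "t \<in> hsec (pbun P) W" for t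
    proof (intro ext)
      fix y u
      show "op U T W (s + t) y u = (op U T W s + op U T W t) y u"
        unfolding op[OF fsheaf_add[OF E.fsheaf W(1) s t]] op[OF s] op[OF t]
        using lin(1)[OF E.hsec_fib[OF s W(1)] E.hsec_fib[OF t W(1)], of y u]
          fsheaf_out[OF E.fsheaf s W(1), of y] fsheaf_out[OF E.fsheaf t W(1), of y] L_zero[OF T U, of y u]
        by (cases "y \<in> W") auto
    qed
    show "op U T W' (restr W' s) = restr W' (op U T W s)" if W': "open W'" "W' \<subseteq> W" for W'
    proof -
      have "op U T W' (restr W' s) = (\<lambda>y u. T y u (restr W' s y))"
        using fsheaf_restr[OF E.fsheaf s W(1) W'] W W' by (auto simp: op_def)
      then show ?thesis unfolding op[OF s]
        by (auto simp: fun_eq_iff restr_apply L_zero[OF T U])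
    qed
    show "op U T W (fmul f s) = fmul f (op U T W s) + (\<lambda>y u. \<phi> y u f *\<^sub>C 0 y *\<^sub>C s y)" if f: "f \<in> holfun A W" for f
    proof (intro ext)
      fix y u
      show "op U T W (fmul f s) y u = (fmul f (op U T W s) + (\<lambda>y u. \<phi> y u f *\<^sub>C 0 y *\<^sub>C s y)) y u"
        unfolding op[OF fsheaf_fmul[OF E.fsheaf W(1) f s]] op[OF s]
        using lin(2)[OF E.hsec_fib[OF s W(1)] E.hsec_fib[OF s W(1)], of y u "f y"]
          fsheaf_out[OF E.fsheaf s W(1), of y] L_zero[OF T U, of y u]
        by (cases "y \<in> W") (auto simp: fmul_apply)
    qed
  next
    fix W s assume "\<not> (open W \<and> W \<subseteq> U \<and> s \<in> hsec (pbun P) W)"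
    then show "op U T W s = 0" unfolding op_def by (simp only: if_False)
  qed (rule hol_0)
  show "par U 0 (op U T)"
  proof (rule parI)
    fix x i W s u
    assume a: "x \<in> S" "x \<in> U" "i \<in> {1..plen P x}" "open W" "W \<subseteq> U" "x \<in> W"
       "s \<in> hsec (pbun P) W" "s x \<in> pfil P x i" "u \<in> fib V x"
    have "T x \<in> lowering x" using T a(2) by (simp add: L_sec[OF U])
    then have "T x u (s x) \<in> pfil P x (Suc i)" using a(1,3,8,9) unfolding lowering_def by blast
    then show "op U T W s x u - \<theta> x i u *\<^sub>C 0 x *\<^sub>C s x \<in> pfil P x (Suc i)"
      using a by (simp add: op_def)
  qed
qed

text \<open>Operators are compared on local sections through each vector of the fibre; arguments
  outside the domain or the fibres give 0 on both sides by convention.\<close>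

lemma op_inj:
  assumes T: "T \<in> sec L U" and T': "T' \<in> sec L U" and U: "open U" and eq: "op U T = op U T'"
  shows "T = T'"
proof (intro ext)
  fix y u v
  show "T y u v = T' y u v"
  proof (cases "y \<in> U \<and> u \<in> fib V y \<and> v \<in> fib (pbun P) y")
    case True
    then have y: "y \<in> U" and v: "v \<in> fib (pbun P) y" by auto
    obtain N s where s: "s \<in> hsec (pbun P) N" "open N" "y \<in> N" "N \<subseteq> U" "s y = v"
      by (rule E.section_through[OF U y v])
    have "op U T N s y u = op U T' N s y u" using eq by simp
    then show ?thesis using s by (simp add: op_def)
  next
    case False
    have z: "T y u v = 0" if "T \<in> sec L U" for T
    proof -
      have h: "T \<in> hsec (hom_bundle V EE) U" using that by (simp add: L_sec[OF U])
      consider "y \<notin> U" | "y \<in> U" "u \<notin> fib V y" | "y \<in> U" "u \<in> fib V y" "v \<notin> fib (pbun P) y" using False by blast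
      then show ?thesis
      proof cases
        case 1 then show ?thesis using hom_hsec_out[OF h] by simp
      next
        case 2 then show ?thesis using linear_maps_out[OF hom_hsec_lin[OF h]] by simp
      next
        case 3 then show ?thesis using linear_maps_out[OF L_lin[OF that U]] by simp
      qed
    qed
    show ?thesis using z[OF T] z[OF T'] by simp
  qed
qed

text \<open>With weight 0 the derivative term of the Leibniz rule vanishes at every point, so D s at
  y depends on s(y) alone and D is a field of linear maps. At weight 0, \<open>par\<close> says that
  this field is lowering.\<close>

lemma conn_weight_zero:
  assumes D: "conn U 0 D" and p: "par U 0 D" and U: "open U"
  shows "\<exists>T\<in>sec L U. op U T = D"
proof -
  \<comment> \<open>Phrased as an existential so that one value can be chosen for each point and
    vector; it is unconstrained where no local section in U passes through v.\<close>
  have "\<exists>a. \<forall>W s. s \<in> hsec (pbun P) W \<and> open W \<and> y \<in> W \<and> W \<subseteq> U \<and> s y = v \<longrightarrow> D W s y = a" for y v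
  proof (cases "\<exists>W s. s \<in> hsec (pbun P) W \<and> open W \<and> y \<in> W \<and> W \<subseteq> U \<and> s y = v")
    case True
    then obtain W s where s: "s \<in> hsec (pbun P) W" "open W" "y \<in> W" "W \<subseteq> U" "s y = v" by blast
    show ?thesis
    proof (intro exI[of _ "D W s y"] allI impI; elim conjE)
      fix W' s' assume s': "s' \<in> hsec (pbun P) W'" "open W'" "y \<in> W'" "W' \<subseteq> U" "s' y = v"
      show "D W' s' y = D W s y"
        by (rule conn_value[OF D s'(2,4,1) s(2,4,1) _ s'(3) s(3)]) (use s s' in auto)
    qed
  qed blast
  then obtain \<tau> where \<tau>: "\<And>y v W s. s \<in> hsec (pbun P) W \<Longrightarrow> open W \<Longrightarrow> y \<in> W \<Longrightarrow> W \<subseteq> U \<Longrightarrow> s y = v \<Longrightarrow> D W s y = \<tau> y v"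
    by metis
  define T where "T y u v = (if y \<in> U \<and> v \<in> fib (pbun P) y then \<tau> y v u else 0)" for y u v
  have TD: "T y u (s y) = D W s y u" if s: "s \<in> hsec (pbun P) W" and W: "open W" "W \<subseteq> U" and y: "y \<in> W" for y u s W
    using \<tau>[OF s W(1) y W(2) refl] W(2) y E.hsec_fib[OF s W(1) y] by (auto simp: T_def)
  have out: "T y = 0" if "y \<notin> U" for y using that by (auto simp: T_def fun_eq_iff)
  have lin: "T y u \<in> linear_maps (fib (pbun P) y) (fib (pbun P) y)" if y: "y \<in> U" and u: "u \<in> fib V y" for y u
  proof (rule linear_mapsI)
    show "T y u v = 0" if "v \<notin> fib (pbun P) y" for v using that by (simp add: T_def)
    fix v c assume v: "v \<in> fib (pbun P) y"
    obtain N s where s: "s \<in> hsec (pbun P) N" "open N" "y \<in> N" "N \<subseteq> U" "s y = v"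
      by (rule E.section_through[OF U y v])
    show "T y u v \<in> fib (pbun P) y"
      using TD[OF s(1,2,4,3), of u] s(5) linear_maps_mem[OF hom_hsec_lin[OF conn_sec[OF D s(1,2,4)] s(3)] u] by simp
    have "fmul (restr N (\<lambda>_. c)) s \<in> hsec (pbun P) N" by (rule fsheaf_fmul[OF E.fsheaf s(2) hol_const s(1)])
    from TD[OF this s(2,4,3), of u] show "T y u (c *\<^sub>C v) = c *\<^sub>C T y u v"
      unfolding conn_leibniz_at[OF D hol_const s(1,2,4)] using TD[OF s(1,2,4,3), of u] s(3,5) by (simp add: fmul_apply)
    fix v' assume v': "v' \<in> fib (pbun P) y"
    obtain N' s' where s': "s' \<in> hsec (pbun P) N'" "open N'" "y \<in> N'" "N' \<subseteq> N" "s' y = v'"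
      by (rule E.section_through[OF s(2,3) v'])
    have N'U: "N' \<subseteq> U" using s s' by blast
    have r: "restr N' s \<in> hsec (pbun P) N'" by (rule fsheaf_restr[OF E.fsheaf s(1,2) s'(2,4)])
    from TD[OF fsheaf_add[OF E.fsheaf s'(2) r s'(1)] s'(2) N'U s'(3), of u]
    show "T y u (v + v') = T y u v + T y u v'"
      using conn_add[OF D r s'(1,2) N'U] TD[OF r s'(2) N'U s'(3), of u] TD[OF s'(1,2) N'U s'(3), of u] s' s(5) by simp
  qed
  have Tu: "T y \<in> linear_maps (fib V y) (fib EE y)" if y: "y \<in> U" for y
  proof (rule linear_mapsI)
    show "T y u \<in> fib EE y" if "u \<in> fib V y" for u using lin[OF y that] by simp
    have val: "\<exists>W s. s \<in> hsec (pbun P) W \<and> open W \<and> W \<subseteq> U \<and> y \<in> W \<and> s y = v" if v: "v \<in> fib (pbun P) y" for v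
      using E.section_through[OF U y v] by metis
    have Dl: "D W s y \<in> linear_maps (fib V y) (fib (pbun P) y)"
      if "s \<in> hsec (pbun P) W" "open W" "W \<subseteq> U" "y \<in> W" for W s
      by (rule hom_hsec_lin[OF conn_sec[OF D that(1-3)] that(4)])
    have *: "\<exists>l\<in>linear_maps (fib V y) (fib (pbun P) y). \<forall>u. T y u v = l u" for v
    proof (cases "v \<in> fib (pbun P) y")
      case True
      then obtain W s where s: "s \<in> hsec (pbun P) W" "open W" "W \<subseteq> U" "y \<in> W" "s y = v" using val by blast
      then show ?thesis using Dl[OF s(1-4)] TD[OF s(1-4)] by (intro bexI[of _ "D W s y"]) auto
    next
      case False
      then show ?thesis
        using subspace_0[OF subspace_linear_maps[OF E.fib_subspace]] by (intro bexI[of _ 0]) (auto simp: T_def)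
    qed
    show "T y u = 0" if "u \<notin> fib V y" for u
      using * linear_maps_out[OF _ that] by (metis ext zero_fun_apply)
    show "T y (u + u') = T y u + T y u'" if "u \<in> fib V y" "u' \<in> fib V y" for u u'
    proof
      fix v obtain l where "l \<in> linear_maps (fib V y) (fib (pbun P) y)" "\<And>u. T y u v = l u" using *[of v] by blast
      then show "T y (u + u') v = (T y u + T y u') v" using linear_maps_add that by fastforce
    qed
    show "T y (c *\<^sub>C u) = c *\<^sub>C T y u" if "u \<in> fib V y" for u c
    proof
      fix v obtain l where "l \<in> linear_maps (fib V y) (fib (pbun P) y)" "\<And>u. T y u v = l u" using *[of v] by blast
      then show "T y (c *\<^sub>C u) v = (c *\<^sub>C T y u) v" using linear_maps_scale that by fastforce
    qed
  qed
  have "T \<in> hsec (hom_bundle V EE) U"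
  proof (rule hom_hsecI[OF Tu out])
    fix W t assume W: "open W" "W \<subseteq> U" and t: "t \<in> hsec V W"
    show "(\<lambda>y. T y (t y)) \<in> hsec EE W"
    proof (rule hom_hsecI)
      show "T y (t y) \<in> linear_maps (fib (pbun P) y) (fib (pbun P) y)" if "y \<in> W" for y
        using lin hsec_fib[OF t W(1) that] that W(2) by blast
      show "T y (t y) = 0" if "y \<notin> W" for y
        using fsheaf_out[OF fsheaf t W(1) that] linear_maps_0[OF Tu, of y] out[of y] by (cases "y \<in> U") auto
      fix W' s assume W': "open W'" "W' \<subseteq> W" and s: "s \<in> hsec (pbun P) W'"
      have W'U: "W' \<subseteq> U" using W W' by blast
      have "T y (t y) (s y) = D W' s y (restr W' t y)" for y
      proof (cases "y \<in> W'")
        case True then show ?thesis using TD[OF s W'(1) W'U True] by simp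
      next
        case False
        have "T y (t y) (0 :: 'e) = 0"
          using linear_maps_0[OF lin, of y "t y"] linear_maps_out[OF Tu, of y "t y"] out[of y]
          by (cases "y \<in> U"; cases "t y \<in> fib V y") auto
        then show ?thesis using False fsheaf_out[OF E.fsheaf s W'(1) False] conn_outside[OF D False] by simp
      qed
      then show "(\<lambda>y. T y (t y) (s y)) \<in> hsec (pbun P) W'"
        using hom_hsec_app[OF conn_sec[OF D s W'(1) W'U] fsheaf_restr[OF fsheaf t W(1) W'] W'(1) order_refl] by simp
    qed
  qed
  moreover have "T x \<in> lowering x" if x: "x \<in> U" for x
    unfolding lowering_def mem_Collect_eq
  proof (intro impI ballI)
    fix u i v assume a: "x \<in> S" "u \<in> fib V x" "i \<in> {1..plen P x}" "v \<in> pfil P x i"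
    have v: "v \<in> fib (pbun P) x" using fil_fib[OF a(1), of i] a(3,4) by auto
    obtain N s where s: "s \<in> hsec (pbun P) N" "open N" "x \<in> N" "N \<subseteq> U" "s x = v"
      by (rule E.section_through[OF U x v])
    show "T x u v \<in> pfil P x (Suc i)"
      using parD[OF p a(1) s(3) a(3) s(2,4,1) _ a(2)] TD[OF s(1,2,4,3), of u] s(5) a(4) by simp
  qed
  ultimately have TL: "T \<in> sec L U" by (simp add: L_sec[OF U])
  moreover have "op U T = D"
  proof (intro ext)
    fix W s y u
    show "op U T W s y u = D W s y u"
    proof (cases "open W \<and> W \<subseteq> U \<and> s \<in> hsec (pbun P) W")
      case True
      then have W: "open W" "W \<subseteq> U" and s: "s \<in> hsec (pbun P) W" by auto
      show ?thesis
      proof (cases "y \<in> W")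
        case True then show ?thesis using TD[OF s W True] W s by (simp add: op_def)
      next
        case False
        then show ?thesis using W s conn_outside[OF D False] fsheaf_out[OF E.fsheaf s W(1) False] L_zero[OF TL U]
          by (simp add: op_def)
      qed
    next
      case False
      have "op U T W s = 0" unfolding op_def using False by (simp only: if_False)
      then show ?thesis using conn_out[OF D False] by simp
    qed
  qed
  ultimately show ?thesis by blast
qed

end

section \<open>Frames adapted to the filtration\<close>

text \<open>The ambient space may have infinite dimension. Finiteness of B' comes from the values of
  a local frame at x, which span the fibre.\<close>

lemma (in hol_bundle) independent_extend:
  assumes F: "complex_vector.subspace F" "F \<subseteq> fib E x" and B: "complex_vector.independent B" "B \<subseteq> F"
  obtains B' where "B \<subseteq> B'" "B' \<subseteq> F" "complex_vector.independent B'" "complex_vector.span B' = F" "finite B'"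
proof -
  obtain B' where B': "B \<subseteq> B'" "B' \<subseteq> F" "complex_vector.independent B'" "F \<subseteq> complex_vector.span B'"
    by (rule complex_vector.maximal_independent_subset_extend[OF B(2,1)])
  obtain U and r :: nat and e \<kappa> where cf: "x \<in> U" "coframe A E U {..<r} e \<kappa>" using coframe_exists by blast
  have "B' \<subseteq> complex_vector.span ((\<lambda>i. e i x) ` {..<r})"
  proof
    fix b assume "b \<in> B'"
    then have "b \<in> fib E x" using B'(2) F(2) by blast
    then have "b = (\<Sum>i<r. \<kappa> i x b *\<^sub>C e i x)" by (rule coframe_expand[OF cf(2,1)])
    moreover have "(\<Sum>i<r. \<kappa> i x b *\<^sub>C e i x) \<in> complex_vector.span ((\<lambda>i. e i x) ` {..<r})"
      by (intro complex_vector.span_sum complex_vector.span_scale complex_vector.span_base) auto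
    ultimately show "b \<in> complex_vector.span ((\<lambda>i. e i x) ` {..<r})" by simp
  qed
  then have "finite B'" using complex_vector.independent_span_bound[OF _ B'(3)] by blast
  moreover have "complex_vector.span B' = F"
    using B'(2,4) complex_vector.span_minimal[OF B'(2) F(1)] by blast
  ultimately show thesis using that B' by blast
qed

context parabolic_setup
begin

text \<open>Downward induction along the filtration: start with the empty basis of the zero step and
  extend a basis of step k + 1 to one of step k. Added vectors cannot spoil the smaller steps, since
  only the part of the basis inside step i is required to span it.\<close>

lemma adapted_basis:
  assumes x: "x \<in> S"
  shows "\<exists>B. finite B \<and> complex_vector.independent B \<and> complex_vector.span B = fib (pbun P) x \<and>
    (\<forall>i\<in>{1..Suc (plen P x)}. complex_vector.span (B \<inter> pfil P x i) = pfil P x i)"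
proof -
  let ?l = "plen P x"
  have "\<exists>B. finite B \<and> complex_vector.independent B \<and> B \<subseteq> pfil P x 1 \<and>
    (\<forall>i\<in>{1..Suc ?l}. complex_vector.span (B \<inter> pfil P x i) = pfil P x i)"
  proof (rule inc_induct[of 1 "Suc ?l"
        "\<lambda>k. \<exists>B. finite B \<and> complex_vector.independent B \<and> B \<subseteq> pfil P x k \<and>
          (\<forall>i\<in>{k..Suc ?l}. complex_vector.span (B \<inter> pfil P x i) = pfil P x i)"])
    show "1 \<le> Suc ?l" by simp
    show "\<exists>B. finite B \<and> complex_vector.independent B \<and> B \<subseteq> pfil P x (Suc ?l) \<and>
          (\<forall>i\<in>{Suc ?l..Suc ?l}. complex_vector.span (B \<inter> pfil P x i) = pfil P x i)"
      by (intro exI[of _ "{}"]) (simp add: fil_last[OF x] complex_vector.independent_empty)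
    fix k assume k: "1 \<le> k" "k < Suc ?l" and "\<exists>B. finite B \<and> complex_vector.independent B \<and> B \<subseteq> pfil P x (Suc k) \<and>
          (\<forall>i\<in>{Suc k..Suc ?l}. complex_vector.span (B \<inter> pfil P x i) = pfil P x i)"
    then obtain B where B: "complex_vector.independent B" "B \<subseteq> pfil P x (Suc k)"
      "\<And>i. i \<in> {Suc k..Suc ?l} \<Longrightarrow> complex_vector.span (B \<inter> pfil P x i) = pfil P x i" by blast
    have sub: "complex_vector.subspace (pfil P x i)" if "k \<le> i" "i \<le> Suc ?l" for i
      using fil_subspace[OF x, of i] k(1) that by simp
    have "pfil P x (Suc k) \<subset> pfil P x k" using fil_Suc[OF x] k by simp
    then have Bk: "B \<subseteq> pfil P x k" using B(2) by blast
    have fk: "pfil P x k \<subseteq> fib (pbun P) x" using fil_fib[OF x] k by simp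
    have sk: "complex_vector.subspace (pfil P x k)" using sub[of k] k by simp
    obtain B' where B': "B \<subseteq> B'" "B' \<subseteq> pfil P x k" "complex_vector.independent B'"
      "complex_vector.span B' = pfil P x k" "finite B'"
      by (rule E.independent_extend[OF sk fk B(1) Bk])
    have "complex_vector.span (B' \<inter> pfil P x i) = pfil P x i" if i: "i \<in> {k..Suc ?l}" for i
    proof (cases "i = k")
      case True
      then show ?thesis using B'(2,4) by (simp add: Int_absorb2)
    next
      case False
      then have i': "i \<in> {Suc k..Suc ?l}" using i by auto
      have "complex_vector.span (B \<inter> pfil P x i) \<subseteq> complex_vector.span (B' \<inter> pfil P x i)"
        by (rule complex_vector.span_mono) (use B'(1) in auto)
      moreover have "complex_vector.span (B' \<inter> pfil P x i) \<subseteq> pfil P x i"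
        by (rule complex_vector.span_minimal[OF _ sub]) (use i in auto)
      ultimately show ?thesis using B(3)[OF i'] by blast
    qed
    then show "\<exists>B. finite B \<and> complex_vector.independent B \<and> B \<subseteq> pfil P x k \<and>
          (\<forall>i\<in>{k..Suc ?l}. complex_vector.span (B \<inter> pfil P x i) = pfil P x i)"
      using B'(2,3,5) by blast
  qed
  then obtain B where B: "finite B" "complex_vector.independent B" "B \<subseteq> pfil P x 1"
    "\<And>i. i \<in> {1..Suc ?l} \<Longrightarrow> complex_vector.span (B \<inter> pfil P x i) = pfil P x i" by blast
  have "complex_vector.span B = fib (pbun P) x"
    using B(3) B(4)[of 1] fil_1[OF x] by (simp add: Int_absorb2)
  then show ?thesis using B by blast
qed

text \<open>The level of a basis vector is the last filtration step that contains it. Step i is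
  spanned by the basis vectors of level at least i, hence is cut out by the vanishing of the
  coordinates of smaller level.\<close>

lemma adapted_coframe:
  "\<exists>U B e \<kappa> lvl. x \<in> U \<and> coframe A (pbun P) U (B :: 'e set) e \<kappa> \<and>
    (x \<in> S \<longrightarrow> (\<forall>b\<in>B. lvl b \<in> {1..plen P x}) \<and>
      (\<forall>i\<in>{1..Suc (plen P x)}. \<forall>v\<in>fib (pbun P) x. v \<in> pfil P x i \<longleftrightarrow> (\<forall>b\<in>B. \<kappa> b x v \<noteq> 0 \<longrightarrow> i \<le> lvl b)))"
proof -
  obtain U0 and r :: nat and e0 \<kappa>0 where cf0: "x \<in> U0" "coframe A (pbun P) U0 {..<r} e0 \<kappa>0"
    using E.coframe_exists by blast
  show ?thesis
  proof (cases "x \<in> S")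
    case False
    \<comment> \<open>Off S any basis of the fibre will do; it is chosen so that the frame is
      indexed by vectors in this case as well.\<close>
    obtain B where "{} \<subseteq> B" "B \<subseteq> fib (pbun P) x" "complex_vector.independent B"
        "complex_vector.span B = fib (pbun P) x" "finite B"
      by (rule E.independent_extend[OF E.fib_subspace order_refl complex_vector.independent_empty empty_subsetI])
    then obtain e \<kappa> where "coframe A (pbun P) U0 B e \<kappa>" using E.coframe_recenter[OF cf0(2,1)] by blast
    then show ?thesis using cf0(1) False by blast
  next
    case True
    note x = True
    let ?l = "plen P x"
    obtain B where B: "finite B" "complex_vector.independent B" "complex_vector.span B = fib (pbun P) x"
      "\<And>i. i \<in> {1..Suc ?l} \<Longrightarrow> complex_vector.span (B \<inter> pfil P x i) = pfil P x i"
      using adapted_basis[OF x] by blast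
    obtain e \<kappa> where cf: "coframe A (pbun P) U0 B e \<kappa>" and ex: "\<And>b. b \<in> B \<Longrightarrow> e b x = b"
      using E.coframe_recenter[OF cf0(2,1) B(1-3)] by blast
    define lvl where "lvl b = Max {i \<in> {1..?l}. b \<in> pfil P x i}" for b
    have lvl: "lvl b \<in> {1..?l} \<and> (\<forall>i\<in>{1..Suc ?l}. b \<in> pfil P x i \<longleftrightarrow> i \<le> lvl b)" if b: "b \<in> B" for b
    proof -
      let ?M = "{i \<in> {1..?l}. b \<in> pfil P x i}"
      have b0: "b \<noteq> 0" using B(2) b complex_vector.dependent_zero by blast
      have b1: "b \<in> pfil P x 1" using b B(3) complex_vector.span_base fil_1[OF x] by auto
      \<comment> \<open>A nonzero vector in the fibre forces at least one nonzero step, so the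
        maximum defining the level is taken over a nonempty set.\<close>
      have "?l \<noteq> 0"
      proof
        assume "?l = 0"
        then have "pfil P x 1 = {0}" using fil_last[OF x] by simp
        then show False using b0 b1 by blast
      qed
      then have ne: "1 \<in> ?M" using b1 by auto
      have "finite ?M" "?M \<noteq> {}" using ne by (simp, blast)
      then have m: "lvl b \<in> ?M" unfolding lvl_def by (rule Max_in)
      have "b \<in> pfil P x i \<longleftrightarrow> i \<le> lvl b" if i: "i \<in> {1..Suc ?l}" for i
      proof
        assume bi: "b \<in> pfil P x i"
        have "i \<noteq> Suc ?l"
        proof
          assume "i = Suc ?l"
          then show False using bi b0 fil_last[OF x] by blast
        qed
        then have "i \<in> ?M" using bi i by auto
        then show "i \<le> lvl b" unfolding lvl_def by (intro Max_ge) auto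
      next
        assume "i \<le> lvl b"
        then have "pfil P x (lvl b) \<subseteq> pfil P x i" using m i by (intro fil_antimono[OF x]) auto
        then show "b \<in> pfil P x i" using m by blast
      qed
      then show ?thesis using m by blast
    qed
    have "v \<in> pfil P x i \<longleftrightarrow> (\<forall>b\<in>B. \<kappa> b x v \<noteq> 0 \<longrightarrow> i \<le> lvl b)"
      if i: "i \<in> {1..Suc ?l}" and v: "v \<in> fib (pbun P) x" for i v
    proof
      note sub = fil_subspace[OF x i]
      assume vi: "v \<in> pfil P x i"
      show "\<forall>b\<in>B. \<kappa> b x v \<noteq> 0 \<longrightarrow> i \<le> lvl b"
      proof (rule ccontr)
        assume "\<not> (\<forall>b\<in>B. \<kappa> b x v \<noteq> 0 \<longrightarrow> i \<le> lvl b)"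
        then obtain b where b: "b \<in> B" "\<kappa> b x v \<noteq> 0" "\<not> i \<le> lvl b" by blast
        have k: "\<kappa> b x \<in> linear_maps (fib (pbun P) x) UNIV" by (rule E.coframe_lin[OF cf cf0(1) b(1)])
        \<comment> \<open>If b has level below i, then all basis vectors in step i lie in the kernel
          of the coordinate \<kappa> b, and so does their span, which is step i.\<close>
        let ?K = "{w \<in> fib (pbun P) x. \<kappa> b x w = 0}"
        have "complex_vector.subspace ?K"
          unfolding complex_vector.subspace_def
          using linear_maps_add[OF k] linear_maps_scale[OF k] linear_maps_0[OF k]
          by (auto intro: subspace_0[OF E.fib_subspace] subspace_add[OF E.fib_subspace] subspace_scale[OF E.fib_subspace])
        moreover have "B \<inter> pfil P x i \<subseteq> ?K"
        proof
          fix b' assume b': "b' \<in> B \<inter> pfil P x i"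
          then have "b' \<noteq> b" using lvl[of b'] i b(3) by auto
          then have "\<kappa> b x b' = 0" using coframe_delta[OF cf cf0(1) b(1), of b'] ex b' by auto
          then show "b' \<in> ?K" using b' fil_fib[OF x i] by blast
        qed
        ultimately have "complex_vector.span (B \<inter> pfil P x i) \<subseteq> ?K" by (rule complex_vector.span_minimal[rotated])
        then show False using vi B(4)[OF i] b(2) by auto
      qed
    next
      note sub = fil_subspace[OF x i]
      assume a: "\<forall>b\<in>B. \<kappa> b x v \<noteq> 0 \<longrightarrow> i \<le> lvl b"
      have "\<kappa> b x v *\<^sub>C e b x \<in> pfil P x i" if b: "b \<in> B" for b
        using a b lvl[OF b] ex[OF b] i subspace_scale[OF sub] subspace_0[OF sub]
        by (cases "\<kappa> b x v = 0") auto
      then have "(\<Sum>b\<in>B. \<kappa> b x v *\<^sub>C e b x) \<in> pfil P x i" by (rule subspace_sum[OF sub])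
      then show "v \<in> pfil P x i" using coframe_expand[OF cf cf0(1) v] by simp
    qed
    with lvl show ?thesis
      by (intro exI[of _ U0] exI[of _ B] exI[of _ e] exI[of _ \<kappa>] exI[of _ lvl] conjI impI ballI cf0(1) cf) blast+
  qed
qed

end

section \<open>A local connection of weight one\<close>

text \<open>Local data around one point x, inside S or not, on a neighbourhood that contains no
  other point of S. The conditions on levels and on \<theta> bind only when x lies in S.\<close>

locale local_frames = parabolic_setup A V S \<phi> P
  for A :: "'x::t2_space chart set" and V :: "('x, 'v::complex_vector) vbundle"
    and S :: "'x set" and \<phi> :: "'x \<Rightarrow> 'v \<Rightarrow> 'x tvec" and P :: "('x, 'e::complex_vector) parabolic" +
  fixes x U z d and m :: nat and f \<nu> and B :: "'e set" and e \<kappa> and lvl :: "'e \<Rightarrow> nat" and \<Psi>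
  assumes c: "coord x U z d" and US: "U \<inter> S \<subseteq> {x}"
    and frV: "coframe A V U {..<m} f \<nu>" and frE: "coframe A (pbun P) U B e \<kappa>"
    and adapted: "x \<in> S \<Longrightarrow> (\<forall>b\<in>B. lvl b \<in> {1..plen P x}) \<and>
      (\<forall>i\<in>{1..Suc (plen P x)}. \<forall>v\<in>fib (pbun P) x. v \<in> pfil P x i \<longleftrightarrow> (\<forall>b\<in>B. \<kappa> b x v \<noteq> 0 \<longrightarrow> i \<le> lvl b))"
    and Psi: "\<Psi> \<in> hsec (dual_bundle A V) U"
    and theta: "x \<in> S \<Longrightarrow> \<theta> x i = complex_of_real (pwt P x i) *\<^sub>C \<Psi> x"

text \<open>Frames of V and of E are restricted to one coordinate neighbourhood that meets S at most
  in x, and \<Psi> is built from the frame of V there.\<close>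

lemma (in parabolic_setup) local_frames_exist:
  "\<exists>U z d m f \<nu> B e \<kappa> lvl \<Psi>. local_frames A V S \<phi> P x U z d m f \<nu> B e \<kappa> lvl \<Psi>"
proof -
  obtain U1 and m :: nat and f \<nu> where V: "x \<in> U1" "coframe A V U1 {..<m} f \<nu>" using coframe_exists by blast
  from adapted_coframe[of x] obtain U2 B e \<kappa> lvl where
    E': "x \<in> U2 \<and> coframe A (pbun P) U2 (B :: 'e set) e \<kappa> \<and> (x \<in> S \<longrightarrow> (\<forall>b\<in>B. lvl b \<in> {1..plen P x}) \<and>
      (\<forall>i\<in>{1..Suc (plen P x)}. \<forall>v\<in>fib (pbun P) x. v \<in> pfil P x i \<longleftrightarrow> (\<forall>b\<in>B. \<kappa> b x v \<noteq> 0 \<longrightarrow> i \<le> lvl b)))"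
    by (elim exE)
  note E = E'[THEN conjunct1] E'[THEN conjunct2, THEN conjunct1] E'[THEN conjunct2, THEN conjunct2, THEN mp]
  have "open (U1 \<inter> U2)" "x \<in> U1 \<inter> U2" using V E coframe_open[OF V(2)] coframe_open[OF E(2)] by auto
  from coord_avoiding[OF S this] obtain W z d where c: "coord x W z d" "W \<subseteq> U1 \<inter> U2" "W \<inter> S \<subseteq> {x}" by blast
  note oW = coord_open[OF c(1)] and xW = coord_mem[OF c(1)]
  have W: "W \<subseteq> U1" "W \<subseteq> U2" using c(2) by auto
  note fV = coframe_restr[OF V(2) oW W(1)] and fE = E.coframe_restr[OF E(2) oW W(2)]
  obtain \<Psi> where \<Psi>: "\<Psi> \<in> hsec (dual_bundle A V) W"
    "\<And>i. x \<in> S \<Longrightarrow> \<theta> x i = complex_of_real (pwt P x i) *\<^sub>C \<Psi> x"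
  proof (cases "x \<in> S")
    case True
    obtain \<Psi> where p: "log_pull x W z d \<Psi>" using log_pull_coframe[OF c(1) True c(3) fV] by blast
    then have "\<Psi> \<in> hsec (dual_bundle A V) W" by (simp add: log_pull_def)
    then show ?thesis using that log_anchor_dual_at_eq[OF p] by (simp add: \<theta>_def)
  next
    case False
    \<comment> \<open>Off S the zero section serves as \<Psi>, the condition on \<theta> being
      vacuous.\<close>
    then show ?thesis using that fsheaf_0[OF fsheaf_dual oW] by blast
  qed
  have "local_frames A V S \<phi> P x W z d m (\<lambda>i. restr W (f i)) (\<lambda>i. restr W (\<nu> i)) B
     (\<lambda>i. restr W (e i)) (\<lambda>i. restr W (\<kappa> i)) lvl \<Psi>"
    by unfold_locales (use c fV fE E(3) \<Psi> xW in simp_all)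
  then show ?thesis by blast
qed

context local_frames
begin

lemma oU: "open U" and xU: "x \<in> U"
  using coord_open[OF c] coord_mem[OF c] by auto

lemma adapted_level: "x \<in> S \<Longrightarrow> b \<in> B \<Longrightarrow> lvl b \<in> {1..plen P x}"
  by (rule bspec[OF conjunct1[OF adapted]])

lemma adapted_iff:
  assumes "x \<in> S" "i \<in> {1..Suc (plen P x)}" "v \<in> fib (pbun P) x"
  shows "v \<in> pfil P x i \<longleftrightarrow> (\<forall>b\<in>B. \<kappa> b x v \<noteq> 0 \<longrightarrow> i \<le> lvl b)"
  by (rule bspec[OF bspec[OF conjunct2[OF adapted[OF assms(1)]] assms(2)] assms(3)])

definition co :: "('x \<Rightarrow> 'e) \<Rightarrow> 'e \<Rightarrow> 'x \<Rightarrow> complex" where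
  "co s b = (\<lambda>y. \<kappa> b y (s y))"

lemma co_hol: "s \<in> hsec (pbun P) W \<Longrightarrow> open W \<Longrightarrow> W \<subseteq> U \<Longrightarrow> b \<in> B \<Longrightarrow> co s b \<in> holfun A W"
  unfolding co_def by (rule dual_hsec_app[OF coframe_dual[OF frE]])

lemma co_expand: "s \<in> hsec (pbun P) W \<Longrightarrow> open W \<Longrightarrow> W \<subseteq> U \<Longrightarrow> s y = (\<Sum>b\<in>B. co s b y *\<^sub>C e b y)"
  using fun_cong[OF E.coframe_expand_sec[OF frE]] unfolding co_def by blast

lemma kappa_0: "b \<in> B \<Longrightarrow> \<kappa> b y 0 = 0"
  using linear_maps_0[OF E.coframe_lin[OF frE, of y b]] dual_hsec_out[OF coframe_dual[OF frE], of b y]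
  by (cases "y \<in> U") auto

lemma co_add:
  assumes "s \<in> hsec (pbun P) W" "t \<in> hsec (pbun P) W" "open W" "W \<subseteq> U" "b \<in> B"
  shows "co (s + t) b = co s b + co t b"
proof
  fix y
  show "co (s + t) b y = (co s b + co t b) y"
    using linear_maps_add[OF E.coframe_lin[OF frE _ assms(5)] E.hsec_fib[OF assms(1,3)] E.hsec_fib[OF assms(2,3)], of y]
      fsheaf_out[OF E.fsheaf assms(1,3), of y] fsheaf_out[OF E.fsheaf assms(2,3), of y] assms(4,5) kappa_0[of b y]
    by (cases "y \<in> W") (auto simp: co_def)
qed

lemma co_fmul:
  assumes "s \<in> hsec (pbun P) W" "open W" "W \<subseteq> U" "b \<in> B"
  shows "co (fmul g s) b = fmul g (co s b)"
proof
  fix y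
  show "co (fmul g s) b y = fmul g (co s b) y"
    using linear_maps_scale[OF E.coframe_lin[OF frE _ assms(4)] E.hsec_fib[OF assms(1,2)], of y "g y"]
      fsheaf_out[OF E.fsheaf assms(1,2), of y] assms(3,4) kappa_0[of b y]
    by (cases "y \<in> W") (auto simp: co_def fmul_def)
qed

lemma co_restr: "b \<in> B \<Longrightarrow> co (restr W s) b = restr W (co s b)"
  by (auto simp: co_def restr_apply fun_eq_iff kappa_0)

definition \<beta> :: "'e \<Rightarrow> complex" where
  "\<beta> b = complex_of_real (pwt P x (lvl b))"

text \<open>In the frame this is \<phi>* composed with d, plus the diagonal matrix of the \<beta> b
  times \<Psi>. The first part is the trivial connection of the frame; the second one supplies the
  weights as eigenvalues at x. \<open>\<phi> y u (co s b)\<close> is the dual anchor of the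
  differential of a coefficient, evaluated on u.\<close>

definition D0 :: "('x, 'v, 'e) operator" where
  "D0 W s = (if open W \<and> W \<subseteq> U \<and> s \<in> hsec (pbun P) W
    then restr W (\<lambda>y u. \<Sum>b\<in>B. (\<phi> y u (co s b) + \<beta> b * co s b y * \<Psi> y u) *\<^sub>C e b y) else 0)"

lemma D0_eq:
  assumes "open W" "W \<subseteq> U" "s \<in> hsec (pbun P) W" "y \<in> W"
  shows "D0 W s y u = (\<Sum>b\<in>B. (\<phi> y u (co s b) + \<beta> b * co s b y * \<Psi> y u) *\<^sub>C e b y)"
  using assms by (simp add: D0_def)

lemma Psi_lin: "y \<in> U \<Longrightarrow> \<Psi> y \<in> linear_maps (fib V y) UNIV"
  by (rule dual_hsec_lin[OF Psi])

lemma Psi_0 [simp]: "\<Psi> y 0 = 0"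
  using linear_maps_0[OF Psi_lin] dual_hsec_out[OF Psi] by (cases "y \<in> U") auto

definition one :: "'x \<Rightarrow> complex" where "one = restr U (\<lambda>_. 1)"

text \<open>Only the derivation \<phi> y u contributes an extra term to the Leibniz rule, the
  \<Psi>-part being linear over the functions. In that term the coefficients reassemble to s, which
  gives weight 1.\<close>

lemma D0_conn: "conn U one D0"
proof (rule connI)
  show "one \<in> holfun A U" unfolding one_def by (rule hol_const)
  show "D0 W s = 0" if "\<not> (open W \<and> W \<subseteq> U \<and> s \<in> hsec (pbun P) W)" for W s
    unfolding D0_def using that by (simp only: if_False)
  fix W s assume W: "open W" "W \<subseteq> U" and s: "s \<in> hsec (pbun P) W"
  have out: "D0 W s y = 0" if "y \<notin> W" for W s y using that by (simp add: D0_def)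
  show "D0 W s \<in> hsec (hom_bundle V (pbun P)) W"
  proof (rule hom_hsecI[OF _ out])
    fix y assume y: "y \<in> W"
    then have yU: "y \<in> U" using W by blast
    show "D0 W s y \<in> linear_maps (fib V y) (fib (pbun P) y)"
    proof (rule linear_mapsI; (simp only: D0_eq[OF W s y])?)
      fix u
      show "(\<Sum>b\<in>B. (\<phi> y u (co s b) + \<beta> b * co s b y * \<Psi> y u) *\<^sub>C e b y) \<in> fib (pbun P) y"
        by (intro subspace_sum[OF E.fib_subspace] subspace_scale[OF E.fib_subspace] E.coframe_fib[OF frE yU])
      show "(\<Sum>b\<in>B. (\<phi> y u (co s b) + \<beta> b * co s b y * \<Psi> y u) *\<^sub>C e b y) = 0" if "u \<notin> fib V y"
        using linear_maps_out[OF anchor_lin that] linear_maps_out[OF Psi_lin[OF yU] that] by simp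
      assume u: "u \<in> fib V y"
      show "(\<Sum>b\<in>B. (\<phi> y (k *\<^sub>C u) (co s b) + \<beta> b * co s b y * \<Psi> y (k *\<^sub>C u)) *\<^sub>C e b y) =
        k *\<^sub>C (\<Sum>b\<in>B. (\<phi> y u (co s b) + \<beta> b * co s b y * \<Psi> y u) *\<^sub>C e b y)" for k
        by (simp add: linear_maps_scale[OF anchor_lin u] linear_maps_scale[OF Psi_lin[OF yU] u] scaleC_sum_right
            algebra_simps)
      fix u' assume u': "u' \<in> fib V y"
      show "(\<Sum>b\<in>B. (\<phi> y (u + u') (co s b) + \<beta> b * co s b y * \<Psi> y (u + u')) *\<^sub>C e b y) =
        (\<Sum>b\<in>B. (\<phi> y u (co s b) + \<beta> b * co s b y * \<Psi> y u) *\<^sub>C e b y) +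
        (\<Sum>b\<in>B. (\<phi> y u' (co s b) + \<beta> b * co s b y * \<Psi> y u') *\<^sub>C e b y)"
        unfolding sum.distrib[symmetric] linear_maps_add[OF anchor_lin u u'] linear_maps_add[OF Psi_lin[OF yU] u u']
        by (intro sum.cong refl) (simp add: scaleC_add_left distrib_left)
    qed
  next
    fix W' t assume W': "open W'" "W' \<subseteq> W" and t: "t \<in> hsec V W'"
    have W'U: "W' \<subseteq> U" using W W' by blast
    \<comment> \<open>The coefficient of e b after contraction with a local section t of V; the
      contracted operator is a holomorphic section once these are holomorphic.\<close>
    define h where "h b = (\<lambda>y. \<phi> y (t y) (co s b)) + fmul (\<beta> b *\<^sub>C restr W' (co s b)) (\<lambda>y. \<Psi> y (t y))" for b
    have "h b \<in> holfun A W'" if b: "b \<in> B" for b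
      unfolding h_def
      by (intro hol_add hol_fmul hol_scale anchor_hol[OF t W' W(1) co_hol[OF s W b]]
          hol_restr[OF co_hol[OF s W b] W'(2)] dual_hsec_app[OF Psi t W'(1) W'U])
    then have "(\<lambda>y. \<Sum>b\<in>B. h b y *\<^sub>C e b y) \<in> hsec (pbun P) W'"
      by (rule E.coframe_lincomb[OF frE W'(1) W'U])
    moreover have "D0 W s y (t y) = (\<Sum>b\<in>B. h b y *\<^sub>C e b y)" for y
    proof (cases "y \<in> W'")
      case True
      then have "y \<in> W" using W' by blast
      then show ?thesis using True by (simp add: D0_eq[OF W s] h_def fmul_apply)
    next
      case False
      then have "t y = 0" using fsheaf_out[OF fsheaf t W'(1)] by blast
      then show ?thesis by (cases "y \<in> W") (simp_all add: D0_eq[OF W s] out h_def fmul_apply)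
    qed
    ultimately show "(\<lambda>y. D0 W s y (t y)) \<in> hsec (pbun P) W'" by simp
  qed
  show "D0 W (s + t) = D0 W s + D0 W t" if t: "t \<in> hsec (pbun P) W" for t
  proof (intro ext)
    fix y u
    show "D0 W (s + t) y u = (D0 W s + D0 W t) y u"
    proof (cases "y \<in> W")
      case True
      have "(\<phi> y u (co (s + t) b) + \<beta> b * co (s + t) b y * \<Psi> y u) *\<^sub>C e b y =
        (\<phi> y u (co s b) + \<beta> b * co s b y * \<Psi> y u) *\<^sub>C e b y + (\<phi> y u (co t b) + \<beta> b * co t b y * \<Psi> y u) *\<^sub>C e b y"
        if b: "b \<in> B" for b
        unfolding co_add[OF s t W b] scaleC_add_left[symmetric]
        by (simp add: tangent_add[OF anchor_tangent W(1) True co_hol[OF s W b] co_hol[OF t W b]] algebra_simps)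
      then show ?thesis
        by (simp add: D0_eq[OF W _ True] fsheaf_add[OF E.fsheaf W(1) s t] s t sum.distrib[symmetric])
    qed (simp add: out)
  qed
  show "D0 W' (restr W' s) = restr W' (D0 W s)" if W': "open W'" "W' \<subseteq> W" for W'
  proof (intro ext)
    fix y u
    have W'U: "W' \<subseteq> U" using W W' by blast
    show "D0 W' (restr W' s) y u = restr W' (D0 W s) y u"
    proof (cases "y \<in> W'")
      case True
      then have y: "y \<in> W" using W' by blast
      have "\<phi> y u (co (restr W' s) b) = \<phi> y u (co s b)" if b: "b \<in> B" for b
        unfolding co_restr[OF b]
        by (rule tangent_restr[OF anchor_tangent W(1) y co_hol[OF s W b] W'(1) True W'(2)])
      then show ?thesis using True
        by (simp add: D0_eq[OF W'(1) W'U fsheaf_restr[OF E.fsheaf s W(1) W'] True] D0_eq[OF W s y] co_restr)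
    qed (simp add: out)
  qed
  show "D0 W (fmul g s) = fmul g (D0 W s) + (\<lambda>y u. \<phi> y u g *\<^sub>C one y *\<^sub>C s y)" if g: "g \<in> holfun A W" for g
  proof (intro ext)
    fix y u
    show "D0 W (fmul g s) y u = (fmul g (D0 W s) + (\<lambda>y u. \<phi> y u g *\<^sub>C one y *\<^sub>C s y)) y u"
    proof (cases "y \<in> W")
      case True
      then have o: "one y = 1" using W by (auto simp: one_def)
      have gs: "fmul g s \<in> hsec (pbun P) W" by (rule fsheaf_fmul[OF E.fsheaf W(1) g s])
      have "D0 W (fmul g s) y u = (\<Sum>b\<in>B. (g y * (\<phi> y u (co s b) + \<beta> b * co s b y * \<Psi> y u)) *\<^sub>C e b y +
         (\<phi> y u g * co s b y) *\<^sub>C e b y)"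
        unfolding D0_eq[OF W gs True]
      proof (intro sum.cong refl)
        fix b assume b: "b \<in> B"
        show "(\<phi> y u (co (fmul g s) b) + \<beta> b * co (fmul g s) b y * \<Psi> y u) *\<^sub>C e b y =
          (g y * (\<phi> y u (co s b) + \<beta> b * co s b y * \<Psi> y u)) *\<^sub>C e b y + (\<phi> y u g * co s b y) *\<^sub>C e b y"
          unfolding co_fmul[OF s W b] tangent_mult[OF anchor_tangent W(1) True g co_hol[OF s W b]] scaleC_add_left[symmetric]
          by (simp add: fmul_apply algebra_simps)
      qed
      also have "\<dots> = g y *\<^sub>C D0 W s y u + \<phi> y u g *\<^sub>C (\<Sum>b\<in>B. co s b y *\<^sub>C e b y)"
        by (simp add: sum.distrib scaleC_sum_right D0_eq[OF W s True])
      also have "(\<Sum>b\<in>B. co s b y *\<^sub>C e b y) = s y" by (rule co_expand[OF s W, symmetric])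
      finally have *: "D0 W (fmul g s) y u = g y *\<^sub>C D0 W s y u + \<phi> y u g *\<^sub>C s y" .
      show ?thesis unfolding * by (simp add: o fmul_apply)
    next
      case False
      then show ?thesis using fsheaf_out[OF E.fsheaf s W(1) False] by (simp add: out fmul_apply)
    qed
  qed
qed

text \<open>At x in S the derivative term is gone, and the difference has the coefficients (\<beta>
  b - weight i) times a coefficient of s times \<Psi>(x). Levels below i drop out because s lies in
  step i, level i because its eigenvalue is the subtracted weight. Only levels above i survive, and
  they span step i + 1.\<close>

lemma D0_par: "par U one D0"
proof (rule parI)
  fix x' i W s u
  assume a: "x' \<in> S" "x' \<in> U" "i \<in> {1..plen P x'}" "open W" "W \<subseteq> U" "x' \<in> W"
     "s \<in> hsec (pbun P) W" "s x' \<in> pfil P x' i" "u \<in> fib V x'"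
  have x': "x' = x" using US a(1,2) by blast
  have xS: "x \<in> S" using a(1) x' by simp
  have o: "one x = 1" using xU by (simp add: one_def)
  have i: "i \<in> {1..Suc (plen P x)}" "Suc i \<in> {1..Suc (plen P x)}" using a(3) x' by auto
  define \<gamma> where "\<gamma> b = (\<beta> b - complex_of_real (pwt P x i)) * co s b x * \<Psi> x u" for b
  have "D0 W s x u = (\<Sum>b\<in>B. (\<beta> b * co s b x * \<Psi> x u) *\<^sub>C e b x)"
    using a(6) x' anchor_vanish[OF xS] by (simp add: D0_eq[OF a(4,5,7)])
  moreover have "\<theta> x i u *\<^sub>C s x = (\<Sum>b\<in>B. (complex_of_real (pwt P x i) * co s b x * \<Psi> x u) *\<^sub>C e b x)"
    by (subst co_expand[OF a(7,4,5)]) (simp add: theta[OF xS] scaleC_sum_right mult_ac)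
  ultimately have eq: "D0 W s x u - \<theta> x i u *\<^sub>C s x = (\<Sum>b\<in>B. \<gamma> b *\<^sub>C e b x)"
    by (simp add: \<gamma>_def sum_subtractf scaleC_diff_left left_diff_distrib)
  have sx: "s x \<in> fib (pbun P) x" using E.hsec_fib[OF a(7,4)] a(6) x' by simp
  have "(\<Sum>b\<in>B. \<gamma> b *\<^sub>C e b x) \<in> fib (pbun P) x"
    by (intro subspace_sum[OF E.fib_subspace] subspace_scale[OF E.fib_subspace] E.coframe_fib[OF frE xU])
  moreover have "Suc i \<le> lvl b" if b: "b \<in> B" and nz: "\<kappa> b x (\<Sum>b\<in>B. \<gamma> b *\<^sub>C e b x) \<noteq> 0" for b
  proof -
    have g: "\<gamma> b \<noteq> 0" using nz E.coframe_coord[OF frE xU b] by simp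
    then have k: "\<kappa> b x (s x) \<noteq> 0" by (auto simp: \<gamma>_def co_def)
    have "s x \<in> pfil P x i" using a(8) x' by simp
    then have "i \<le> lvl b" using adapted_iff[OF xS i(1) sx] b k by blast
    moreover have "lvl b \<noteq> i" using g by (auto simp: \<gamma>_def \<beta>_def)
    ultimately show ?thesis by simp
  qed
  ultimately have "(\<Sum>b\<in>B. \<gamma> b *\<^sub>C e b x) \<in> pfil P x (Suc i)"
    by (intro iffD2[OF adapted_iff[OF xS i(2)]]) blast+
  then show "D0 W s x' u - \<theta> x' i u *\<^sub>C one x' *\<^sub>C s x' \<in> pfil P x' (Suc i)" using eq o x' by simp
qed

end

section \<open>Local freeness and exactness\<close>

text \<open>The frames below are indexed by triples, by an option type or by \<open>unit\<close>. A
  bijection with an initial segment of the naturals transports the basis property to the form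
  required.\<close>

lemma locally_freeI:
  assumes "\<And>x. \<exists>U I e. open U \<and> x \<in> U \<and> finite (I :: 'i set) \<and> (\<forall>i\<in>I. e i \<in> sec M U) \<and>
    (\<forall>W. open W \<and> W \<subseteq> U \<longrightarrow>
      bij_betw (\<lambda>c. \<Sum>i\<in>I. smul M (c i) (res M W (e i))) (I \<rightarrow>\<^sub>E holfun A W) (sec M W))"
  shows "locally_free A M"
  unfolding locally_free_def
proof
  fix x
  from assms[of x] obtain U and I :: "'i set" and e where *: "open U \<and> x \<in> U \<and> finite I \<and> (\<forall>i\<in>I. e i \<in> sec M U) \<and>
    (\<forall>W. open W \<and> W \<subseteq> U \<longrightarrow>
      bij_betw (\<lambda>c. \<Sum>i\<in>I. smul M (c i) (res M W (e i))) (I \<rightarrow>\<^sub>E holfun A W) (sec M W))"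
    by (elim exE)
  then have U: "open U" "x \<in> U" and I: "finite I" and e: "\<forall>i\<in>I. e i \<in> sec M U"
    and bij: "\<And>W. open W \<Longrightarrow> W \<subseteq> U \<Longrightarrow>
      bij_betw (\<lambda>c. \<Sum>i\<in>I. smul M (c i) (res M W (e i))) (I \<rightarrow>\<^sub>E holfun A W) (sec M W)"
    by simp_all
  obtain h where h: "bij_betw h {..<card I} I"
    using ex_bij_betw_nat_finite[OF I] by (auto simp: atLeast0LessThan)
  define g where "g = inv_into {..<card I} h"
  have g: "bij_betw g I {..<card I}" unfolding g_def by (rule bij_betw_inv_into[OF h])
  have gh: "g (h n) = n" if "n < card I" for n
    using bij_betw_inv_into_left[OF h] that by (simp add: g_def)
  have hg: "h (g i) = i" if "i \<in> I" for i
    using bij_betw_inv_into_right[OF h that] by (simp add: g_def)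
  have bij': "bij_betw (\<lambda>c. \<Sum>n<card I. smul M (c n) (res M W (e (h n)))) ({..<card I} \<rightarrow>\<^sub>E holfun A W) (sec M W)"
    if W: "open W" "W \<subseteq> U" for W
  proof -
    have "bij_betw (\<lambda>c. restrict (\<lambda>i. c (g i)) I) ({..<card I} \<rightarrow>\<^sub>E holfun A W) (I \<rightarrow>\<^sub>E holfun A W)"
    proof (rule bij_betw_byWitness[where f' = "\<lambda>c. restrict (\<lambda>n. c (h n)) {..<card I}"])
      show "\<forall>c\<in>{..<card I} \<rightarrow>\<^sub>E holfun A W. restrict (\<lambda>n. restrict (\<lambda>i. c (g i)) I (h n)) {..<card I} = c"
        using bij_betwE[OF h] gh by (auto simp: fun_eq_iff PiE_def extensional_def)
      show "\<forall>c\<in>I \<rightarrow>\<^sub>E holfun A W. restrict (\<lambda>i. restrict (\<lambda>n. c (h n)) {..<card I} (g i)) I = c"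
        using bij_betwE[OF g] hg by (auto simp: fun_eq_iff PiE_def extensional_def)
      show "(\<lambda>c. restrict (\<lambda>i. c (g i)) I) ` ({..<card I} \<rightarrow>\<^sub>E holfun A W) \<subseteq> I \<rightarrow>\<^sub>E holfun A W"
        using bij_betwE[OF g] by fastforce
      show "(\<lambda>c. restrict (\<lambda>n. c (h n)) {..<card I}) ` (I \<rightarrow>\<^sub>E holfun A W) \<subseteq> {..<card I} \<rightarrow>\<^sub>E holfun A W"
        using bij_betwE[OF h] by fastforce
    qed
    from bij_betw_trans[OF this bij[OF W]] show ?thesis
    proof (rule iffD1[OF bij_betw_cong, rotated])
      fix c
      have "(\<Sum>i\<in>I. smul M (c (g i)) (res M W (e i))) = (\<Sum>n<card I. smul M (c (g (h n))) (res M W (e (h n))))"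
        by (rule sum.reindex_bij_betw[OF h, symmetric])
      then show "((\<lambda>c. \<Sum>i\<in>I. smul M (c i) (res M W (e i))) \<circ> (\<lambda>c. restrict (\<lambda>i. c (g i)) I)) c =
          (\<Sum>n<card I. smul M (c n) (res M W (e (h n))))"
        by (simp add: gh)
    qed
  qed
  show "\<exists>U r e. open U \<and> x \<in> U \<and> (\<forall>i<(r::nat). e i \<in> sec M U) \<and> (\<forall>W. open W \<and> W \<subseteq> U \<longrightarrow>
      bij_betw (\<lambda>c. \<Sum>i<r. smul M (c i) (res M W (e i))) ({..<r} \<rightarrow>\<^sub>E holfun A W) (sec M W))"
    by (rule exI[of _ U], rule exI[of _ "card I"], rule exI[of _ "\<lambda>n. e (h n)"])
      (use U e bij_betwE[OF h] bij' in simp)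
qed

lemma sum_single: "finite I \<Longrightarrow> i \<in> I \<Longrightarrow> (\<And>j. j \<in> I \<Longrightarrow> j \<noteq> i \<Longrightarrow> g j = 0) \<Longrightarrow> sum g I = g i"
  by (simp add: sum.remove)

section \<open>A frame for the twisted lowering endomorphisms\<close>

context local_frames
begin

definition \<mu> :: "'e \<Rightarrow> 'e \<Rightarrow> 'x \<Rightarrow> complex" where
  "\<mu> j k = (if x \<in> S \<and> lvl j \<le> lvl k then z else one)"

text \<open>
  The matrix unit sending \<open>e k\<close> to \<open>e j\<close> is multiplied by the coordinate where it does not lower the
  filtration strictly.
\<close>

definition G :: "nat \<times> 'e \<times> 'e \<Rightarrow> 'x \<Rightarrow> 'v \<Rightarrow> 'e \<Rightarrow> 'e" where
  "G = (\<lambda>(l, j, k) y u v. (\<nu> l y u * \<kappa> k y v * \<mu> j k y) *\<^sub>C e j y)"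

abbreviation "I \<equiv> {..<m} \<times> B \<times> B"

lemma finite_I: "finite I"
  using coframe_finite[OF frE] by simp

lemma one_in: "y \<in> U \<Longrightarrow> one y = 1"
  by (simp add: one_def)

lemma mu_hol: "\<mu> j k \<in> holfun A U"
  using coord_hol[OF c] hol_const by (simp add: \<mu>_def one_def)

lemma mu_nonzero: "y \<in> U \<Longrightarrow> y \<noteq> x \<Longrightarrow> \<mu> j k y \<noteq> 0"
  using coord_zero[OF c] by (auto simp: \<mu>_def one_in)

lemma G_hom:
  assumes l: "l < m" and j: "j \<in> B" and k: "k \<in> B"
  shows "G (l, j, k) \<in> hsec (hom_bundle V EE) U"
proof (rule hom_hsecI)
  have nu: "\<nu> l y \<in> linear_maps (fib V y) UNIV" if "y \<in> U" for y
    using coframe_lin[OF frV that] l by simp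
  have ka: "\<kappa> k y \<in> linear_maps (fib (pbun P) y) UNIV" if "y \<in> U" for y
    using E.coframe_lin[OF frE that k] .
  have lin: "G (l, j, k) y u \<in> linear_maps (fib (pbun P) y) (fib (pbun P) y)" if y: "y \<in> U" for y u
    by (rule linear_mapsI)
      (auto simp: G_def linear_maps_out[OF ka[OF y]] linear_maps_add[OF ka[OF y]] linear_maps_scale[OF ka[OF y]]
        scaleC_add_left distrib_left distrib_right mult_ac intro: subspace_scale[OF E.fib_subspace] E.coframe_fib[OF frE y j])
  show "G (l, j, k) y \<in> linear_maps (fib V y) (fib EE y)" if y: "y \<in> U" for y
    by (rule linear_mapsI)
      (use lin[OF y] in \<open>auto simp: G_def fun_eq_iff linear_maps_out[OF nu[OF y]] linear_maps_add[OF nu[OF y]]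
        linear_maps_scale[OF nu[OF y]] scaleC_add_left distrib_left distrib_right mult_ac\<close>)
  show "G (l, j, k) y = 0" if "y \<notin> U" for y
    using dual_hsec_out[OF coframe_dual[OF frV] that, of l] l by (auto simp: G_def fun_eq_iff)
  fix W t assume W: "open W" "W \<subseteq> U" and t: "t \<in> hsec V W"
  have nt: "(\<lambda>y. \<nu> l y (t y)) \<in> holfun A W"
    by (rule dual_hsec_app[OF coframe_dual[OF frV] t W]) (use l in simp)
  show "(\<lambda>y. G (l, j, k) y (t y)) \<in> hsec EE W"
  proof (rule hom_hsecI)
    show "G (l, j, k) y (t y) \<in> linear_maps (fib (pbun P) y) (fib (pbun P) y)" if "y \<in> W" for y
      using lin that W by blast
    show "G (l, j, k) y (t y) = 0" if "y \<notin> W" for y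
      using holfun_out[OF nt that] by (auto simp: G_def fun_eq_iff)
    fix W' s assume W': "open W'" "W' \<subseteq> W" and s: "s \<in> hsec (pbun P) W'"
    have W'U: "W' \<subseteq> U" using W W' by blast
    have ks: "(\<lambda>y. \<kappa> k y (s y)) \<in> holfun A W'" by (rule dual_hsec_app[OF coframe_dual[OF frE k] s W'(1) W'U])
    let ?h = "fmul (fmul (restr W' (\<lambda>y. \<nu> l y (t y))) (\<lambda>y. \<kappa> k y (s y))) (restr W' (\<mu> j k))"
    have "?h \<in> holfun A W'"
      by (intro hol_fmul ks hol_restr[OF nt W'(2)] hol_restr[OF mu_hol W'U])
    from fsheaf_fmul[OF E.fsheaf W'(1) this fsheaf_restr[OF E.fsheaf coframe_sec[OF frE j] oU W'(1) W'U]]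
    have "fmul ?h (restr W' (e j)) \<in> hsec (pbun P) W'" .
    moreover have "fmul ?h (restr W' (e j)) = (\<lambda>y. G (l, j, k) y (t y) (s y))"
      using holfun_out[OF ks] by (intro ext) (auto simp: fmul_def G_def restr_apply)
    ultimately show "(\<lambda>y. G (l, j, k) y (t y) (s y)) \<in> hsec (pbun P) W'" by simp
  qed
qed

text \<open>At x in S, either the factor is z and the matrix unit vanishes, or the level of j
  exceeds that of k. In the second case a vector of step n with nonzero coordinate k has n \<le> lvl
  k < lvl j, so its image lies in step n + 1.\<close>

lemma G_L: "i \<in> I \<Longrightarrow> G i \<in> sec L U"
proof -
  assume "i \<in> I"
  then obtain l j k where i: "i = (l, j, k)" "l < m" "j \<in> B" "k \<in> B" by auto
  have "G i y \<in> lowering y" if y: "y \<in> U" for y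
    unfolding lowering_def mem_Collect_eq
  proof (intro impI ballI)
    fix u n v assume yS: "y \<in> S" and n: "n \<in> {1..plen P y}" and v: "v \<in> pfil P y n"
    have yx: "y = x" using US y yS by blast
    have xS: "x \<in> S" using yS yx by simp
    have n': "n \<in> {1..Suc (plen P x)}" "Suc n \<in> {1..Suc (plen P x)}" using n yx by auto
    have vx: "v \<in> pfil P x n" using v yx by simp
    have vf: "v \<in> fib (pbun P) x" using fil_fib[OF xS n'(1)] vx by blast
    let ?c = "\<nu> l x u * \<kappa> k x v * \<mu> j k x"
    have ef: "e j x \<in> fib (pbun P) x" by (rule E.coframe_fib[OF frE xU i(3)])
    have "?c *\<^sub>C e j x \<in> pfil P x (Suc n)"
    proof (rule iffD2[OF adapted_iff[OF xS n'(2) subspace_scale[OF E.fib_subspace ef]]], intro ballI impI)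
      fix b assume b: "b \<in> B" and nz: "\<kappa> b x (?c *\<^sub>C e j x) \<noteq> 0"
      have eq: "\<kappa> b x (?c *\<^sub>C e j x) = ?c * of_bool (b = j)"
        using linear_maps_scale[OF E.coframe_lin[OF frE xU b] ef] coframe_delta[OF frE xU b i(3)] by simp
      then have "b = j" "\<kappa> k x v \<noteq> 0" "\<mu> j k x \<noteq> 0" using nz by (auto split: if_splits)
      moreover have "n \<le> lvl k" using adapted_iff[OF xS n'(1) vf] vx i(4) \<open>\<kappa> k x v \<noteq> 0\<close> by blast
      moreover have "\<not> lvl j \<le> lvl k" using \<open>\<mu> j k x \<noteq> 0\<close> xS coord_center[OF c] by (auto simp: \<mu>_def)
      ultimately show "Suc n \<le> lvl b" by simp
    qed
    then show "G i y u v \<in> pfil P y (Suc n)" by (simp add: G_def i(1) yx)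
  qed
  then show "G i \<in> sec L U" using G_hom[OF i(2-4)] by (simp add: L_sec[OF oU] i(1))
qed

definition FL :: "'x set \<Rightarrow> (nat \<times> 'e \<times> 'e \<Rightarrow> 'x \<Rightarrow> complex) \<Rightarrow> 'x \<Rightarrow> 'v \<Rightarrow> 'e \<Rightarrow> 'e" where
  "FL W c = (\<Sum>i\<in>I. fmul (c i) (restr W (G i)))"

lemma FL_apply:
  assumes "y \<in> W"
  shows "FL W c y u v = (\<Sum>l<m. \<Sum>j\<in>B. \<Sum>k\<in>B. (c (l, j, k) y * (\<nu> l y u * \<kappa> k y v * \<mu> j k y)) *\<^sub>C e j y)"
  using assms by (simp add: FL_def fun_sum_apply fmul_apply G_def sum.cartesian_product')

lemma FL_mem:
  assumes W: "open W" "W \<subseteq> U" and c: "\<And>i. i \<in> I \<Longrightarrow> c i \<in> holfun A W"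
  shows "FL W c \<in> sec L W"
  unfolding FL_def
  by (intro fsheaf_sum[OF fsheaf_L W(1)] fsheaf_fmul[OF fsheaf_L W(1)] c fsheaf_restr[OF fsheaf_L G_L oU W])

text \<open>Contraction with the frames and dual frames isolates one summand. The factor \<mu>
  remains, but it has no zero in U off x and can be cancelled there.\<close>

lemma FL_coeff:
  assumes W: "W \<subseteq> U" and y: "y \<in> W" and i: "l < m" "j \<in> B" "k \<in> B"
  shows "\<kappa> j y (FL W c y (f l y) (e k y)) = c (l, j, k) y * \<mu> j k y"
proof -
  have yU: "y \<in> U" using W y by blast
  have nu: "\<nu> l' y (f l y) = of_bool (l' = l)" if "l' < m" for l'
    using coframe_delta[OF frV yU, of l' l] that i(1) by simp
  have ka: "\<kappa> k' y (e k y) = of_bool (k' = k)" if "k' \<in> B" for k'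
    using coframe_delta[OF frE yU that i(3)] .
  have "FL W c y (f l y) (e k y) = (\<Sum>j\<in>B. (c (l, j, k) y * \<mu> j k y) *\<^sub>C e j y)"
    unfolding FL_apply[OF y]
  proof (subst sum_single[of _ l])
    show "(\<Sum>j\<in>B. \<Sum>k'\<in>B. (c (l, j, k') y * (\<nu> l y (f l y) * \<kappa> k' y (e k y) * \<mu> j k' y)) *\<^sub>C e j y) =
      (\<Sum>j\<in>B. (c (l, j, k) y * \<mu> j k y) *\<^sub>C e j y)"
    proof (rule sum.cong[OF refl])
      fix j
      show "(\<Sum>k'\<in>B. (c (l, j, k') y * (\<nu> l y (f l y) * \<kappa> k' y (e k y) * \<mu> j k' y)) *\<^sub>C e j y) =
        (c (l, j, k) y * \<mu> j k y) *\<^sub>C e j y"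
        by (subst sum_single[OF coframe_finite[OF frE] i(3)]) (use i in \<open>auto simp: nu ka\<close>)
    qed
  qed (use i in \<open>auto simp: nu\<close>)
  then show ?thesis using E.coframe_coord[OF frE yU i(2)] by simp
qed

lemma L_coeff:
  assumes W: "open W" "W \<subseteq> U" and T: "T \<in> sec L W" and i: "l < m" "j \<in> B" "k \<in> B"
  shows "(\<lambda>y. \<kappa> j y (T y (f l y) (e k y))) \<in> holfun A W"
proof -
  have T': "T \<in> hsec (hom_bundle V EE) W" using T by (simp add: L_sec[OF W(1)])
  have fl: "restr W (f l) \<in> hsec V W"
    by (rule fsheaf_restr[OF fsheaf coframe_sec[OF frV] oU W]) (use i in simp)
  have ek: "restr W (e k) \<in> hsec (pbun P) W"
    by (rule fsheaf_restr[OF E.fsheaf coframe_sec[OF frE i(3)] oU W])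
  have "(\<lambda>y. T y (restr W (f l) y)) \<in> hsec EE W" by (rule hom_hsec_app[OF T' fl W(1) order_refl])
  from dual_hsec_app[OF coframe_dual[OF frE i(2)] hom_hsec_app[OF this ek W(1) order_refl] W]
  have "(\<lambda>y. \<kappa> j y (T y (restr W (f l) y) (restr W (e k) y))) \<in> holfun A W" .
  moreover have "T y (restr W (f l) y) (restr W (e k) y) = T y (f l y) (e k y)" for y
    using hom_hsec_out[OF T', of y] by (cases "y \<in> W") auto
  ultimately show ?thesis by simp
qed

text \<open>Expand u and v in their frames and the image in the frame of E; the matrix entries of T
  then stand in front of the products of \<nu> l with matrix units.\<close>

lemma L_expand:
  assumes W: "open W" "W \<subseteq> U" and T: "T \<in> sec L W" and y: "y \<in> W" and u: "u \<in> fib V y" and v: "v \<in> fib (pbun P) y"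
  shows "T y u v = (\<Sum>l<m. \<Sum>j\<in>B. \<Sum>k\<in>B. (\<kappa> j y (T y (f l y) (e k y)) * (\<nu> l y u * \<kappa> k y v)) *\<^sub>C e j y)"
proof -
  have yU: "y \<in> U" using W y by blast
  have T': "T \<in> hsec (hom_bundle V EE) W" using T by (simp add: L_sec[OF W(1)])
  note lT = hom_hsec_lin[OF T' y]
  have fl: "f l y \<in> fib V y" if "l < m" for l using coframe_fib[OF frV yU] that by simp
  note ek = E.coframe_fib[OF frE yU]
  have "T y u = T y (\<Sum>l<m. \<nu> l y u *\<^sub>C f l y)" using coframe_expand[OF frV yU u] by simp
  also have "\<dots> = (\<Sum>l<m. \<nu> l y u *\<^sub>C T y (f l y))"
    by (rule linear_maps_sum[OF lT fib_subspace]) (use fl in auto)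
  finally have 1: "T y u v = (\<Sum>l<m. \<nu> l y u *\<^sub>C T y (f l y) v)" by (simp add: fun_sum_apply)
  have 2: "T y (f l y) v = (\<Sum>j\<in>B. \<Sum>k\<in>B. (\<kappa> j y (T y (f l y) (e k y)) * \<kappa> k y v) *\<^sub>C e j y)" if l: "l < m" for l
  proof -
    note lTl = L_lin[OF T W(1) y fl[OF l]]
    have "T y (f l y) v = T y (f l y) (\<Sum>k\<in>B. \<kappa> k y v *\<^sub>C e k y)" using coframe_expand[OF frE yU v] by simp
    also have "\<dots> = (\<Sum>k\<in>B. \<kappa> k y v *\<^sub>C T y (f l y) (e k y))"
      by (rule linear_maps_sum[OF lTl E.fib_subspace ek])
    also have "\<dots> = (\<Sum>k\<in>B. \<kappa> k y v *\<^sub>C (\<Sum>j\<in>B. \<kappa> j y (T y (f l y) (e k y)) *\<^sub>C e j y))"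
      by (intro sum.cong refl arg_cong[where f = "\<lambda>w. _ *\<^sub>C w"] coframe_expand[OF frE yU] linear_maps_mem[OF lTl] ek)
    also have "\<dots> = (\<Sum>k\<in>B. \<Sum>j\<in>B. (\<kappa> j y (T y (f l y) (e k y)) * \<kappa> k y v) *\<^sub>C e j y)"
      by (simp add: scaleC_sum_right mult.commute)
    finally show ?thesis by (subst (asm) sum.swap)
  qed
  show ?thesis unfolding 1 by (intro sum.cong refl) (simp add: 2 scaleC_sum_right mult_ac)
qed

text \<open>Uniqueness: off x the factors \<mu> can be cancelled, and holomorphic coefficients that
  agree off x are equal. Existence for x in S: an entry with level of j at most that of k vanishes
  at x because T lowers the filtration, hence is divisible by z, while the other entries are
  coefficients as they stand. Off S all entries are of the latter kind.\<close>

lemma L_frame: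
  assumes W: "open W" "W \<subseteq> U"
  shows "bij_betw (FL W) (I \<rightarrow>\<^sub>E holfun A W) (sec L W)"
  unfolding bij_betw_def
proof
  show "inj_on (FL W) (I \<rightarrow>\<^sub>E holfun A W)"
  proof (rule inj_onI)
    fix a b assume a: "a \<in> I \<rightarrow>\<^sub>E holfun A W" and b: "b \<in> I \<rightarrow>\<^sub>E holfun A W" and eq: "FL W a = FL W b"
    show "a = b"
    proof (rule PiE_ext[OF a b])
      fix i assume i: "i \<in> I"
      then obtain l j k where ijk: "i = (l, j, k)" "l < m" "j \<in> B" "k \<in> B" by auto
      show "a i = b i"
      proof (rule hol_eq_off_finite[where S = "{x}"])
        show "a i \<in> holfun A W" "b i \<in> holfun A W" using a b i by (auto simp: PiE_mem)
        fix y assume y: "y \<in> W - {x}"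
        have "\<kappa> j y (FL W a y (f l y) (e k y)) = \<kappa> j y (FL W b y (f l y) (e k y))" using eq by simp
        then have "a i y * \<mu> j k y = b i y * \<mu> j k y"
          unfolding FL_coeff[OF W(2) DiffD1[OF y] ijk(2-4)] ijk(1) .
        moreover have "\<mu> j k y \<noteq> 0" using mu_nonzero y W by blast
        ultimately show "a i y = b i y" by simp
      qed (use W in auto)
    qed
  qed
  show "FL W ` (I \<rightarrow>\<^sub>E holfun A W) = sec L W"
  proof (intro equalityI subsetI)
    fix T assume "T \<in> FL W ` (I \<rightarrow>\<^sub>E holfun A W)"
    then obtain a where a: "a \<in> I \<rightarrow>\<^sub>E holfun A W" "T = FL W a" by blast
    show "T \<in> sec L W" unfolding a(2) by (rule FL_mem[OF W PiE_mem[OF a(1)]])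
  next
    fix T assume T: "T \<in> sec L W"
    have "\<exists>g\<in>holfun A W. \<forall>y\<in>W. \<kappa> j y (T y (f l y) (e k y)) = g y * \<mu> j k y"
      if ijk: "l < m" "j \<in> B" "k \<in> B" for l j k
    proof (cases "x \<in> S \<and> lvl j \<le> lvl k")
      case True
      then have xS: "x \<in> S" by simp
      \<comment> \<open>e k x lies in step \<open>lvl k\<close>, so T sends it into the next step; a
        nonzero coordinate j there would force \<open>lvl j\<close> above
        \<open>lvl k\<close>.\<close>
      have "\<kappa> j x (T x (f l x) (e k x)) = 0" if xW: "x \<in> W"
      proof (rule ccontr)
        assume nz: "\<kappa> j x (T x (f l x) (e k x)) \<noteq> 0"
        have n: "lvl k \<in> {1..plen P x}" by (rule adapted_level[OF xS ijk(3)])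
        have n': "lvl k \<in> {1..Suc (plen P x)}" "Suc (lvl k) \<in> {1..Suc (plen P x)}" using n by auto
        note ekf = E.coframe_fib[OF frE xU ijk(3)]
        have fl: "f l x \<in> fib V x" using coframe_fib[OF frV xU] ijk(1) by simp
        have "e k x \<in> pfil P x (lvl k)"
          by (rule iffD2[OF adapted_iff[OF xS n'(1) ekf]]) (use coframe_delta[OF frE xU _ ijk(3)] in auto)
        moreover have "T x \<in> lowering x" using T xW by (simp add: L_sec[OF W(1)])
        ultimately have "T x (f l x) (e k x) \<in> pfil P x (Suc (lvl k))"
          using xS fl n unfolding lowering_def by blast
        moreover have "T x (f l x) (e k x) \<in> fib (pbun P) x"
          by (rule linear_maps_mem[OF L_lin[OF T W(1) xW fl] ekf])
        ultimately have "Suc (lvl k) \<le> lvl j" using adapted_iff[OF xS n'(2)] ijk(2) nz by blast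
        then show False using True by simp
      qed
      then obtain g where "g \<in> holfun A W" "(\<lambda>y. \<kappa> j y (T y (f l y) (e k y))) = fmul z g"
        using coord_div[OF c W L_coeff[OF W T ijk]] by blast
      then show ?thesis using True
        by (intro bexI[of _ g]) (auto simp: \<mu>_def fmul_def mult.commute dest: fun_cong)
    next
      case False
      show ?thesis
        by (rule bexI[OF _ L_coeff[OF W T ijk]]) (use False W in \<open>auto simp: \<mu>_def one_in subsetD\<close>)
    qed
    \<comment> \<open>Rewritten with projections so that a single choice function on triples can be
      extracted.\<close>
    then have "\<exists>g\<in>holfun A W. \<forall>y\<in>W. \<kappa> (fst (snd i)) y (T y (f (fst i) y) (e (snd (snd i)) y)) =
        g y * \<mu> (fst (snd i)) (snd (snd i)) y" if "i \<in> I" for i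
      using that by auto
    then obtain a where a: "\<And>i. i \<in> I \<Longrightarrow> a i \<in> holfun A W \<and> (\<forall>y\<in>W. \<kappa> (fst (snd i)) y (T y (f (fst i) y) (e (snd (snd i)) y)) =
        a i y * \<mu> (fst (snd i)) (snd (snd i)) y)" by metis
    have co: "\<kappa> j y (T y (f l y) (e k y)) = a (l, j, k) y * \<mu> j k y" if "l < m" "j \<in> B" "k \<in> B" "y \<in> W" for l j k y
      using a[of "(l, j, k)"] that by simp
    let ?a = "restrict a I"
    have aI: "?a \<in> I \<rightarrow>\<^sub>E holfun A W" using a by simp
    have FLa: "FL W ?a \<in> sec L W" by (rule FL_mem[OF W]) (use a in auto)
    have "T = FL W ?a"
    proof (intro ext)
      fix y u v
      show "T y u v = FL W ?a y u v"
      proof (cases "y \<in> W \<and> u \<in> fib V y \<and> v \<in> fib (pbun P) y")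
        case True
        then have y: "y \<in> W" by simp
        have "T y u v = (\<Sum>l<m. \<Sum>j\<in>B. \<Sum>k\<in>B. (\<kappa> j y (T y (f l y) (e k y)) * (\<nu> l y u * \<kappa> k y v)) *\<^sub>C e j y)"
          using L_expand[OF W T] True by blast
        also have "\<dots> = FL W ?a y u v"
          unfolding FL_apply[OF y] by (intro sum.cong refl) (simp add: co[OF _ _ _ y] mult_ac)
        finally show ?thesis .
      next
        case False
        have z: "R y u v = 0" if R: "R \<in> sec L W" for R
        proof -
          have R': "R \<in> hsec (hom_bundle V EE) W" using R by (simp add: L_sec[OF W(1)])
          consider "y \<notin> W" | "y \<in> W" "u \<notin> fib V y" | "y \<in> W" "u \<in> fib V y" "v \<notin> fib (pbun P) y" using False by blast
          then show ?thesis
          proof cases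
            case 1 then show ?thesis using hom_hsec_out[OF R'] by simp
          next
            case 2 then show ?thesis using linear_maps_out[OF hom_hsec_lin[OF R']] by simp
          next
            case 3 then show ?thesis using linear_maps_out[OF L_lin[OF R W(1)]] by simp
          qed
        qed
        show ?thesis using z[OF T] z[OF FLa] by simp
      qed
    qed
    then show "T \<in> FL W ` (I \<rightarrow>\<^sub>E holfun A W)" using aI by blast
  qed
qed

end

section \<open>Local freeness of the two sheaves and local lifting of weights\<close>

context parabolic_setup
begin

lemma op_add: "op W (T + T') = op W T + op W T'"
  by (auto simp: op_def fun_eq_iff)

lemma op_sum: "op W (\<Sum>i\<in>J. T i) = (\<Sum>i\<in>J. op W (T i))"
proof (induction J rule: infinite_finite_induct)
  case (insert i J)
  show ?case by (simp only: sum.insert[OF insert(1,2)] op_add insert(3))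
qed (auto simp: op_def fun_eq_iff)

lemma smul_op:
  assumes "open W" "T \<in> sec L W"
  shows "smul C g (0, op W T) = (0, op W (fmul g T))"
  by (auto simp: C_smul op_def fmul_def fun_eq_iff)

lemma res_op:
  assumes U: "open U" and W: "open W" "W \<subseteq> U" and T: "T \<in> sec L U"
  shows "res C W (0, op U T) = (0, op W (restr W T))"
proof -
  have "(if N \<subseteq> W then op U T N else 0) s y u = op W (restr W T) N s y u" for N s y u
  proof (cases "open N \<and> N \<subseteq> W \<and> s \<in> hsec (pbun P) N")
    case True
    then have s: "s \<in> hsec (pbun P) N" "open N" and N: "N \<subseteq> W" "N \<subseteq> U" using W by auto
    show ?thesis
      using True N W fsheaf_out[OF E.fsheaf s, of y] L_zero[OF T U, of y u]
      by (cases "y \<in> N") (auto simp: op_def restr_apply)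
  next
    case False
    then show ?thesis by (auto simp: op_def)
  qed
  then have "(\<lambda>N. if N \<subseteq> W then op U T N else 0) = op W (restr W T)" by (intro ext)
  then show ?thesis by (simp add: C_res)
qed

lemma C_add: "open W \<Longrightarrow> a \<in> sec C W \<Longrightarrow> b \<in> sec C W \<Longrightarrow> a + b \<in> sec C W"
proof -
  assume W: "open W" and a: "a \<in> sec C W" and b: "b \<in> sec C W"
  have d: "s - t \<in> sec C W" if "s \<in> sec C W" "t \<in> sec C W" for s t
    using that conn_diff par_diff by (cases s, cases t) (auto simp: C_sec[OF W])
  have "0 \<in> sec C W" unfolding zero_prod_def C_sec[OF W] by (rule conn_zero_pair[OF W])
  then have "a - (0 - b) \<in> sec C W" using d a b by blast
  then show ?thesis by simp
qed

lemma sum_zero_pair: "(\<Sum>i\<in>J. (0, D i)) = (0, \<Sum>i\<in>J. D i)"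
  by (induction J rule: infinite_finite_induct) (auto simp: zero_prod_def)

lemma L_locally_free: "locally_free A L"
proof (rule locally_freeI)
  fix x
  obtain U z d m f \<nu> B e \<kappa> lvl \<Psi> where "local_frames A V S \<phi> P x U z d m f \<nu> B e \<kappa> lvl \<Psi>"
    using local_frames_exist[of x] by (elim exE)
  then interpret local_frames A V S \<phi> P x U z d m f \<nu> B e \<kappa> lvl \<Psi> .
  have FL: "(\<lambda>a. \<Sum>i\<in>I. smul L (a i) (res L W (G i))) = FL W" for W
    by (rule ext) (simp add: FL_def L_smul L_res)
  show "\<exists>U I e. open U \<and> x \<in> U \<and> finite (I :: (nat \<times> 'e \<times> 'e) set) \<and> (\<forall>i\<in>I. e i \<in> sec L U) \<and>
    (\<forall>W. open W \<and> W \<subseteq> U \<longrightarrow>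
      bij_betw (\<lambda>c. \<Sum>i\<in>I. smul L (c i) (res L W (e i))) (I \<rightarrow>\<^sub>E holfun A W) (sec L W))"
  proof (rule exI[of _ U], rule exI[of _ I], rule exI[of _ G], intro conjI allI impI ballI)
    show "open U" "x \<in> U" by (rule oU xU)+
    show "finite I" by (rule finite_I)
    show "G i \<in> sec L U" if "i \<in> I" for i by (rule G_L[OF that])
    show "bij_betw (\<lambda>c. \<Sum>i\<in>I. smul L (c i) (res L W (G i))) (I \<rightarrow>\<^sub>E holfun A W) (sec L W)" if "open W \<and> W \<subseteq> U" for W
      unfolding FL using L_frame that by blast
  qed
qed

text \<open>The connection D0 of weight 1, adjoined under the index \<open>None\<close> to the
  operators of a frame of the kernel, gives a frame. This is the local splitting of the sequence,
  expressed through bases.\<close>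

lemma C_locally_free: "locally_free A C"
proof (rule locally_freeI)
  fix x
  obtain U z d m f \<nu> B e \<kappa> lvl \<Psi> where "local_frames A V S \<phi> P x U z d m f \<nu> B e \<kappa> lvl \<Psi>"
    using local_frames_exist[of x] by (elim exE)
  then interpret local_frames A V S \<phi> P x U z d m f \<nu> B e \<kappa> lvl \<Psi> .
  let ?J = "insert None (Some ` I)"
  define t where "t i = (case i of None \<Rightarrow> (one, D0) | Some i \<Rightarrow> (0, op U (G i)))" for i
  define F where "F W a = (\<Sum>i\<in>?J. smul C (a i) (res C W (t i)))" for W a
  have F: "F W a = smul C (a None) (res C W (one, D0)) + (0, op W (FL W (\<lambda>i. a (Some i))))"
    if W: "open W" "W \<subseteq> U" for W a
  proof -
    have "F W a = smul C (a None) (res C W (t None)) + (\<Sum>i\<in>Some ` I. smul C (a i) (res C W (t i)))"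
      unfolding F_def using finite_I by (subst sum.insert) auto
    also have "(\<Sum>i\<in>Some ` I. smul C (a i) (res C W (t i))) =
      (\<Sum>i\<in>I. smul C (a (Some i)) (res C W (t (Some i))))"
      by (subst sum.reindex) auto
    also have "\<dots> = (\<Sum>i\<in>I. (0, op W (fmul (a (Some i)) (restr W (G i)))))"
    proof (intro sum.cong refl)
      fix i assume i: "i \<in> I"
      show "smul C (a (Some i)) (res C W (t (Some i))) = (0, op W (fmul (a (Some i)) (restr W (G i))))"
        using res_op[OF oU W G_L[OF i]] smul_op[OF W(1) fsheaf_restr[OF fsheaf_L G_L[OF i] oU W]]
        by (simp add: t_def)
    qed
    also have "\<dots> = (0, op W (FL W (\<lambda>i. a (Some i))))" by (simp add: sum_zero_pair FL_def op_sum)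
    finally show ?thesis by (simp add: t_def)
  qed
  have one_mul: "fmul g (restr W one) = g" if "g \<in> holfun A W" "W \<subseteq> U" for g W
    using holfun_out[OF that(1)] that(2) by (intro ext) (auto simp: fmul_def restr_apply one_in subsetD)
  have base: "(one, D0) \<in> sec C U" using D0_conn D0_par by (simp add: C_sec[OF oU])
  have smem: "smul C g (res C W (one, D0)) \<in> sec C W" if W: "open W" "W \<subseteq> U" and g: "g \<in> holfun A W" for W g
    using conn_smul[OF g conn_restrict[OF D0_conn W(2)]] par_smul[OF par_restrict[OF D0_par W(2)], of g]
    by (simp add: C_res C_smul C_sec[OF W(1)])
  have bij: "bij_betw (F W) (?J \<rightarrow>\<^sub>E holfun A W) (sec C W)" if W: "open W" "W \<subseteq> U" for W
    unfolding bij_betw_def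
  proof
    show "inj_on (F W) (?J \<rightarrow>\<^sub>E holfun A W)"
    proof (rule inj_onI)
      fix a b assume a: "a \<in> ?J \<rightarrow>\<^sub>E holfun A W" and b: "b \<in> ?J \<rightarrow>\<^sub>E holfun A W" and eq: "F W a = F W b"
      have aN: "a None \<in> holfun A W" "b None \<in> holfun A W" using a b by (auto simp: PiE_mem)
      have aS: "a (Some i) \<in> holfun A W" "b (Some i) \<in> holfun A W" if "i \<in> I" for i
        by (rule PiE_mem[OF a], use that in blast, rule PiE_mem[OF b], use that in blast)
      have "fst (F W a) = fst (F W b)" using eq by simp
      \<comment> \<open>Only the \<open>None\<close> term carries a weight, so comparison of first
        components determines its coefficient.\<close>
      then have N: "a None = b None" by (simp add: F[OF W] C_res C_smul one_mul[OF aN(1) W(2)] one_mul[OF aN(2) W(2)])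
      then have "(0, op W (FL W (\<lambda>i. a (Some i)))) = (0 :: 'x \<Rightarrow> complex, op W (FL W (\<lambda>i. b (Some i))))"
        using eq unfolding F[OF W] by simp
      then have "op W (FL W (\<lambda>i. a (Some i))) = op W (FL W (\<lambda>i. b (Some i)))" by simp
      then have "FL W (\<lambda>i. a (Some i)) = FL W (\<lambda>i. b (Some i))"
        by (intro op_inj[OF FL_mem[OF W] FL_mem[OF W] W(1)] aS)
      then have "FL W (restrict (\<lambda>i. a (Some i)) I) = FL W (restrict (\<lambda>i. b (Some i)) I)"
        by (simp add: FL_def)
      then have r: "restrict (\<lambda>i. a (Some i)) I = restrict (\<lambda>i. b (Some i)) I"
        by (rule inj_onD[OF bij_betw_imp_inj_on[OF L_frame[OF W]]]) (use aS in auto)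
      show "a = b"
      proof (rule PiE_ext[OF a b])
        fix i assume i: "i \<in> ?J"
        show "a i = b i"
        proof (cases i)
          case (Some k)
          then have "k \<in> I" using i by auto
          then show ?thesis using fun_cong[OF r, of k] Some by simp
        qed (simp add: N)
      qed
    qed
    show "F W ` (?J \<rightarrow>\<^sub>E holfun A W) = sec C W"
    proof (intro equalityI subsetI)
      fix q assume "q \<in> F W ` (?J \<rightarrow>\<^sub>E holfun A W)"
      then obtain a where a: "a \<in> ?J \<rightarrow>\<^sub>E holfun A W" "q = F W a" by blast
      have "FL W (\<lambda>i. a (Some i)) \<in> sec L W" by (intro FL_mem[OF W] PiE_mem[OF a(1)]) blast
      then have "(0, op W (FL W (\<lambda>i. a (Some i)))) \<in> sec C W" using op_conn W(1) by (simp add: C_sec[OF W(1)])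
      moreover have "a None \<in> holfun A W" using a(1) by (auto simp: PiE_mem)
      ultimately show "q \<in> sec C W" unfolding a(2) F[OF W] by (intro C_add[OF W(1)] smem[OF W])
    next
      fix q assume q: "q \<in> sec C W"
      obtain w D where wD: "q = (w, D)" by (cases q)
      have cD: "conn W w D" "par W w D" using q by (auto simp: wD C_sec[OF W(1)])
      have w: "w \<in> holfun A W" by (rule conn_weight[OF cD(1)])
      define r where "r = snd (smul C w (res C W (one, D0)))"
      \<comment> \<open>Subtracting w times D0 leaves a parabolic operator of weight 0, and these
        are known to come from sections of the kernel sheaf.\<close>
      let ?D = "D - r"
      have s1: "smul C w (res C W (one, D0)) = (w, r)"
        by (simp add: r_def C_res C_smul one_mul[OF w W(2)])
      then have c1: "conn W w r" "par W w r" using smem[OF W w] by (simp_all add: C_sec[OF W(1)])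
      have "conn W 0 ?D" "par W 0 ?D" using conn_diff[OF cD(1) c1(1)] par_diff[OF cD(2) c1(2)] by simp_all
      then obtain T where T: "T \<in> sec L W" "op W T = ?D" using conn_weight_zero W(1) by blast
      obtain a where a: "a \<in> I \<rightarrow>\<^sub>E holfun A W" "T = FL W a"
        using T(1) bij_betw_imp_surj_on[OF L_frame[OF W]] by blast
      define b where "b = restrict (\<lambda>i. case i of None \<Rightarrow> w | Some i \<Rightarrow> a i) ?J"
      have "b \<in> ?J \<rightarrow>\<^sub>E holfun A W" using w a(1) by (auto simp: b_def PiE_mem)
      moreover have "FL W (\<lambda>i. b (Some i)) = FL W a"
        unfolding FL_def by (intro sum.cong refl) (simp add: b_def)
      then have "F W b = q"
        unfolding F[OF W] using s1 T(2) a(2) by (simp add: b_def wD)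
      ultimately show "q \<in> F W ` (?J \<rightarrow>\<^sub>E holfun A W)" by blast
    qed
  qed
  show "\<exists>U J t. open U \<and> x \<in> U \<and> finite (J :: (nat \<times> 'e \<times> 'e) option set) \<and> (\<forall>i\<in>J. t i \<in> sec C U) \<and>
    (\<forall>W. open W \<and> W \<subseteq> U \<longrightarrow>
      bij_betw (\<lambda>c. \<Sum>i\<in>J. smul C (c i) (res C W (t i))) (J \<rightarrow>\<^sub>E holfun A W) (sec C W))"
  proof (rule exI[of _ U], rule exI[of _ ?J], rule exI[of _ t], intro conjI allI impI ballI)
    show "open U" "x \<in> U" by (rule oU xU)+
    show "finite ?J" using finite_I by blast
    show "t i \<in> sec C U" if "i \<in> ?J" for i
      using that base op_conn[OF G_L oU] by (auto simp: t_def C_sec[OF oU])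
    show "bij_betw (\<lambda>c. \<Sum>i\<in>?J. smul C (c i) (res C W (t i))) (?J \<rightarrow>\<^sub>E holfun A W) (sec C W)" if "open W \<and> W \<subseteq> U" for W
      using bij that unfolding F_def by blast
  qed
qed

text \<open>The restriction of u times the local connection D0 of weight 1 is a lift of u.\<close>

lemma weight_locally_surjective:
  assumes U: "open U" and u: "u \<in> holfun A U" and x: "x \<in> U"
  shows "\<exists>W. open W \<and> x \<in> W \<and> W \<subseteq> U \<and> (\<exists>t\<in>sec C W. fst t = restr W u)"
proof -
  obtain U' z d m f \<nu> B e \<kappa> lvl \<Psi> where "local_frames A V S \<phi> P x U' z d m f \<nu> B e \<kappa> lvl \<Psi>"
    using local_frames_exist[of x] by (elim exE)
  then interpret local_frames A V S \<phi> P x U' z d m f \<nu> B e \<kappa> lvl \<Psi> .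
  let ?W = "U \<inter> U'"
  have W: "open ?W" "?W \<subseteq> U" "?W \<subseteq> U'" using U oU by auto
  have g: "restr ?W u \<in> holfun A ?W" by (rule hol_restr[OF u W(2)])
  have "smul C (restr ?W u) (res C ?W (one, D0)) \<in> sec C ?W"
    using conn_smul[OF g conn_restrict[OF D0_conn W(3)]] par_smul[OF par_restrict[OF D0_par W(3)], of "restr ?W u"]
    by (simp add: C_res C_smul C_sec[OF W(1)])
  moreover have "fst (smul C (restr ?W u) (res C ?W (one, D0))) = restr ?W u"
    by (auto simp: C_res C_smul fmul_def restr_apply one_in fun_eq_iff)
  ultimately show ?thesis using W x xU by (intro exI[of _ ?W]) auto
qed

end

text \<open>The constant function 1 is a frame on the whole surface.\<close>

lemma (in riemann) structure_sheaf_locally_free: "locally_free A (structure_sheaf A)"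
proof (rule locally_freeI)
  fix x
  let ?e = "\<lambda>_::unit. restr UNIV (\<lambda>_. 1) :: 'x \<Rightarrow> complex"
  have "bij_betw (\<lambda>c. fmul (c ()) (restr W (?e ()))) ({()} \<rightarrow>\<^sub>E holfun A W) (holfun A W)" for W
  proof -
    have eq: "fmul g (restr W (?e ())) = g" if "g \<in> holfun A W" for g
      using holfun_out[OF that] by (intro ext) (auto simp: fmul_def restr_apply)
    show ?thesis
    proof (rule bij_betw_byWitness[where f' = "\<lambda>g _. g"])
      show "\<forall>c\<in>{()} \<rightarrow>\<^sub>E holfun A W. (\<lambda>_. fmul (c ()) (restr W (?e ()))) = c"
        using eq by (auto simp: fun_eq_iff PiE_mem)
    qed (use eq in \<open>auto simp: PiE_mem\<close>)
  qed
  then show "\<exists>U I e. open U \<and> x \<in> U \<and> finite (I :: unit set) \<and> (\<forall>i\<in>I. e i \<in> sec (structure_sheaf A) U) \<and>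
    (\<forall>W. open W \<and> W \<subseteq> U \<longrightarrow>
      bij_betw (\<lambda>c. \<Sum>i\<in>I. smul (structure_sheaf A) (c i) (res (structure_sheaf A) W (e i))) (I \<rightarrow>\<^sub>E holfun A W)
        (sec (structure_sheaf A) W))"
    by (intro exI[of _ UNIV] exI[of _ "{()}"] exI[of _ ?e])
      (simp add: structure_sheaf_def section_sheaf_def hol_const)
qed

theorem lemma3p7:
  fixes A :: "'x::t2_space chart set"
    and S :: "'x set"
    and V :: "('x, 'v::complex_vector) vbundle"
    and br :: "'x set \<Rightarrow> ('x \<Rightarrow> 'v) \<Rightarrow> ('x \<Rightarrow> 'v) \<Rightarrow> 'x \<Rightarrow> 'v"
    and \<phi> :: "'x \<Rightarrow> 'v \<Rightarrow> 'x tvec"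
    and P :: "('x, 'e::complex_vector) parabolic"
  assumes "riemann_surface A"
    and "compact (UNIV :: 'x set)"
    and "connected (UNIV :: 'x set)"
    and "finite S" and "S \<noteq> {}"
    and "lie_algebroid A V br \<phi>"
    and "\<forall>x\<in>S. \<forall>\<kappa>\<in>fib (cotangent_bundle A) x. anchor_dual \<phi> x \<kappa> = 0"
    and "parabolic_bundle A S P"
  shows "short_exact_bundles A
           (end_n_dual_sheaf S V P) (end_incl P)
           (conn_sheaf A S V \<phi> P) weight_map
           (structure_sheaf A)"
proof -
  note alg = assms(6)[unfolded lie_algebroid_def]
  interpret parabolic_setup A V S \<phi> P
    using assms(1,4,7,8) alg[THEN conjunct1] alg[THEN conjunct2, THEN conjunct2, THEN conjunct1]
    by unfold_locales
  have hL: "omod_hom A L C (end_incl P)"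
    unfolding omod_hom_def end_incl_op
  proof (intro allI impI conjI ballI; (elim conjE)?)
    fix U T assume U: "open U" and T: "T \<in> sec L U"
    show "(0, op U T) \<in> sec C U" using op_conn[OF T U] by (simp add: C_sec[OF U])
    show "(0 :: 'x \<Rightarrow> complex, op U (T + T')) = (0, op U T) + (0, op U T')" for T' by (simp add: op_add)
    show "(0, op U (smul L f T)) = smul C f (0, op U T)" for f
      by (simp add: smul_op[OF U T] L_smul)
    show "(0, op W (res L W T)) = res C W (0, op U T)" if "open W" "W \<subseteq> U" for W
      by (simp add: res_op[OF U that T] L_res)
  qed
  have hC: "omod_hom A C (structure_sheaf A) weight_map"
    unfolding omod_hom_def
  proof (intro allI impI conjI ballI; (elim conjE)?)
    fix U t assume U: "open U" and t: "t \<in> sec C U"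
    obtain w D where wD: "t = (w, D)" by (cases t)
    show "weight_map U t \<in> sec (structure_sheaf A) U"
      using t conn_weight by (auto simp: wD weight_map_def C_sec[OF U] structure_sheaf_def section_sheaf_def)
    show "weight_map U (t + t') = weight_map U t + weight_map U t'" for t' :: "('x \<Rightarrow> complex) \<times> ('x, 'v, 'e) operator"
      by (simp add: weight_map_def)
    show "weight_map U (smul C f t) = smul (structure_sheaf A) f (weight_map U t)" for f
      by (simp add: wD weight_map_def C_smul structure_sheaf_def section_sheaf_def)
    show "weight_map W (res C W t) = res (structure_sheaf A) W (weight_map U t)" for W
      by (simp add: wD weight_map_def C_res structure_sheaf_def section_sheaf_def)
  qed
  have "short_exact A L (end_incl P) C weight_map (structure_sheaf A)"
    unfolding short_exact_def
  proof (intro conjI allI impI ballI hL hC)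
    fix U :: "'x set" assume U: "open U"
    show "inj_on (end_incl P U) (sec L U)"
      by (rule inj_onI) (use op_inj U in \<open>auto simp: end_incl_op\<close>)
    show "weight_map U (end_incl P U T) = 0" if "T \<in> sec L U" for T by (simp add: end_incl_op weight_map_def)
    show "\<exists>W. open W \<and> x \<in> W \<and> W \<subseteq> U \<and> (\<exists>s\<in>sec L W. end_incl P W s = res C W t)"
      if t: "t \<in> sec C U" "weight_map U t = 0" and x: "x \<in> U" for t x
    proof -
      obtain D where D: "t = (0, D)" using t(2) by (cases t) (simp add: weight_map_def)
      obtain T where T: "T \<in> sec L U" "op U T = D"
        using conn_weight_zero U t(1) by (auto simp: D C_sec[OF U])
      \<comment> \<open>A connection of weight 0 comes from a section over all of U, so the
        neighbourhood demanded by exactness in the middle may be U itself.\<close>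
      have "end_incl P U T = res C U t"
        using res_op[OF U U order_refl T(1)] T fsheaf_restr_self[OF fsheaf_L U T(1)] by (simp add: D end_incl_op)
      then show ?thesis using U x T(1) by blast
    qed
    show "\<exists>W. open W \<and> x \<in> W \<and> W \<subseteq> U \<and> (\<exists>t\<in>sec C W. weight_map W t = res (structure_sheaf A) W u)"
      if "u \<in> sec (structure_sheaf A) U" and x: "x \<in> U" for u x
      using weight_locally_surjective[OF U _ x, of u] that
      by (simp add: weight_map_def structure_sheaf_def section_sheaf_def)
  qed
  moreover have "is_omod A L" using fsheaf_is_omod[OF fsheaf_L] by (simp add: L_sheaf)
  moreover have "is_omod A (structure_sheaf A)"
    unfolding structure_sheaf_def by (rule fsheaf_is_omod[OF fsheaf_holfun])
  ultimately show ?thesis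
    unfolding short_exact_bundles_def
    using L_locally_free is_omod_conn C_locally_free structure_sheaf_locally_free by blast
qed

end
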